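(* Flexible stability and stability are not equivalent in the operator norm. Indeed, the group $\mathbb{Z}^2$ is flexibly stable in the operator norm but not stable in the operator norm.
   Context: For $n\in\mathbb{N}$, let $M_n=M_n(\mathbb{C})$, let $\mathcal{U}_n$ be the group of $n\times n$ unitary matrices, and let $\|\cdot\|$ denote the operator norm. Let $\Gamma$ be a countable discrete group. An asymptotic representation of $\Gamma$ in the operator norm is a sequence of maps $\varphi_n\colon\Gamma\to\mathcal{U}_{d_n}$ (with $(d_n)$ a sequence of positive integers) such that $\|\varphi_n(gh)-\varphi_n(g)\varphi_n(h)\|\to 0$ for every $g,h\in\Gamma$. The group $\Gamma$ is stable (respectively, flexibly stable) in the operator norm if, for every asymptotic representation $(\varphi_n)$ of $\Gamma$ in the operator norm, there exist integers $k_n\ge d_n$, isometries $W_n\colon\mathbb{C}^{d_n}\to\mathbb{C}^{k_n}$, and genuine unitary representations (group homomorphisms) $\pi_n\colon\Gamma\to\mathcal{U}_{k_n}$ such that $\|W_n^*\pi_n(g)W_n-\varphi_n(g)\|\to 0$ for every $g\in\Gamma$, subject to the constraint $k_n=d_n$ for stability (respectively, $k_n/d_n\to 1$ for flexible stability). *)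

theory Defs
  imports
    "Jordan_Normal_Form.Schur_Decomposition"
    "HOL-Algebra.Elementary_Groups"
    "HOL-Library.Countable_Set"
begin

definition l2_norm_vec :: "complex vec \<Rightarrow> real" where
  "l2_norm_vec v = sqrt (\<Sum>i<dim_vec v. (cmod (v $ i))\<^sup>2)"

definition op_norm :: "complex mat \<Rightarrow> real" where
  "op_norm A =
     (SUP v \<in> {v \<in> carrier_vec (dim_col A). l2_norm_vec v \<le> 1}. l2_norm_vec (A *\<^sub>v v))"

definition isometry_mat :: "nat \<Rightarrow> nat \<Rightarrow> complex mat set" where
  \<comment> \<open>isometries from the space of dimension \<open>d\<close> into the space of dimension \<open>k\<close>\<close>
  "isometry_mat k d = {W \<in> carrier_mat k d. mat_adjoint W * W = 1\<^sub>m d}"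

definition unitary_group :: "nat \<Rightarrow> complex mat monoid" where
  "unitary_group n =
     \<lparr>carrier = {U \<in> carrier_mat n n. mat_adjoint U * U = 1\<^sub>m n \<and> U * mat_adjoint U = 1\<^sub>m n},
      monoid.mult = (*), one = 1\<^sub>m n\<rparr>"

definition asymptotic_representation ::
  "('g, 'b) monoid_scheme \<Rightarrow> (nat \<Rightarrow> nat) \<Rightarrow> (nat \<Rightarrow> 'g \<Rightarrow> complex mat) \<Rightarrow> bool" where
  "asymptotic_representation G d \<phi> \<longleftrightarrow>
     (\<forall>n. 0 < d n) \<and>
     (\<forall>n. \<phi> n \<in> carrier G \<rightarrow> carrier (unitary_group (d n))) \<and>
     (\<forall>g \<in> carrier G. \<forall>h \<in> carrier G.
        (\<lambda>n. op_norm (\<phi> n (g \<otimes>\<^bsub>G\<^esub> h) - \<phi> n g * \<phi> n h)) \<longlonglongrightarrow> 0)"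

definition approx_by_compressions ::
  "('g, 'b) monoid_scheme \<Rightarrow> (nat \<Rightarrow> nat) \<Rightarrow> (nat \<Rightarrow> 'g \<Rightarrow> complex mat) \<Rightarrow>
   (nat \<Rightarrow> nat) \<Rightarrow> bool" where
  "approx_by_compressions G d \<phi> k \<longleftrightarrow>
     (\<forall>n. d n \<le> k n) \<and>
     (\<exists>W \<pi>. (\<forall>n. W n \<in> isometry_mat (k n) (d n)) \<and>
            (\<forall>n. \<pi> n \<in> hom G (unitary_group (k n))) \<and>
            (\<forall>g \<in> carrier G.
               (\<lambda>n. op_norm (mat_adjoint (W n) * \<pi> n g * W n - \<phi> n g)) \<longlonglongrightarrow> 0))"

definition stable_op_norm :: "('g, 'b) monoid_scheme \<Rightarrow> bool" where
  "stable_op_norm G \<longleftrightarrow>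
     (\<forall>d \<phi>. asymptotic_representation G d \<phi> \<longrightarrow>
        (\<exists>k. approx_by_compressions G d \<phi> k \<and> (\<forall>n. k n = d n)))"

definition flexibly_stable_op_norm :: "('g, 'b) monoid_scheme \<Rightarrow> bool" where
  "flexibly_stable_op_norm G \<longleftrightarrow>
     (\<forall>d \<phi>. asymptotic_representation G d \<phi> \<longrightarrow>
        (\<exists>k. approx_by_compressions G d \<phi> k \<and> (\<lambda>n. real (k n) / real (d n)) \<longlonglongrightarrow> 1))"

end

theory Submission
  imports Defs "Jordan_Normal_Form.Spectral_Radius" "HOL-Analysis.Analysis"
begin

text \<open>
  \<^emph>\<open>Flexible stability.\<close> Let \<open>U, V\<close> be almost commuting unitaries and cover the circle by short arcs. Let
  \<open>\<chi>\<^sub>j\<close> be continuous with \<open>\<chi>\<^sub>j\<close> supported in the \<open>j\<close>-th arc and \<open>\<Sum> \<chi>\<^sub>j\<^sup>2 = 1\<close>. By Stone-Weierstrass the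
  \<open>\<chi>\<^sub>j(V)\<close> almost commute with \<open>U\<close>. The isometry \<open>v \<mapsto> (\<chi>\<^sub>j(V) v)\<^sub>j\<close> into the direct sum of the spectral
  subspaces of \<open>V\<close> for the arcs therefore almost intertwines \<open>V\<close> with the operator that is scalar on each
  summand, and \<open>U\<close> with the direct sum of the compressions of \<open>U\<close>; replacing each compression by the
  unitary part of its polar decomposition costs little, because it is almost isometric on the range
  of \<open>\<chi>\<^sub>j(V)\<close>. The two resulting unitaries commute exactly. Shifting the arcs so that only few eigenvalues of
  \<open>V\<close> lie in their overlaps makes the dimension of the direct sum at most \<open>(1 + \<epsilon>) d\<close>.

  \<^emph>\<open>Instability.\<close> The cyclic shift and the clock matrix of size \<open>n\<close> commute up to the factor \<open>cis (2 \<pi> / n)\<close>, but the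
  winding number of \<open>t \<mapsto> det ((1 - t) U V + t V U)\<close> separates them from all commuting pairs.\<close>

section \<open>Operator norm of complex matrices\<close>

text \<open>The tolerance \<delta> for the commutator must not depend on the size \<open>d\<close>,
  and this dictates the order of choices: \<epsilon> fixes \<open>N\<close> and the number
  \<open>m\<close> of arcs, these fix the finitely many functions \<chi>, and only then does the
  commutator estimate, uniform in \<open>d\<close>, give \<delta>. The factor of order sqrt m lost
  in the dilation is harmless because \<open>m\<close> is already fixed. Exact commutation survives
  the polar decomposition: a unitary that is scalar on each summand commutes with every block
  diagonal matrix and with its adjoint, and the unitary part is built from these. Estimates are kept
  in the intertwining form, \<open>A W\<close> close to \<open>W U\<close>. It passes to products
  and inverses, so the two generators suffice; the compressions of the definition are not
  multiplicative and appear only at the end. For instability, equal dimensions make \<open>W\<close>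
  unitary, so the compressions of a representation are again commuting unitaries. The determinant
  can compare the two pairs because they have the same size; this is where flexible stability
  escapes the obstruction.\<close>

unbundle no vec_syntax
declare minus_carrier_mat [simp]
unbundle no inner_syntax
hide_type (open) Finite_Cartesian_Product.vec
hide_const (open) Finite_Cartesian_Product.mat Finite_Cartesian_Product.vec
  Finite_Cartesian_Product.row Determinants.det

section \<open>Matrix identities and adjoints\<close>

lemma carrier_mat_dim: "A \<in> carrier_mat m n \<longleftrightarrow> dim_row A = m \<and> dim_col A = n"
  by auto

lemma assoc_mult_mat_dim:
  "dim_col A = dim_row B \<Longrightarrow> dim_col B = dim_row C \<Longrightarrow> A * B * C = A * (B * C)"
  by (rule assoc_mult_mat[OF carrier_matI carrier_matI carrier_matI]) auto

lemma assoc_mult_mat_vec_dim: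
  "dim_col A = dim_row B \<Longrightarrow> dim_col B = dim_vec v \<Longrightarrow> A * B *\<^sub>v v = A *\<^sub>v (B *\<^sub>v v)"
  by (rule assoc_mult_mat_vec[OF carrier_matI carrier_matI carrier_vecI]) auto

lemma mult_mat_vec_smult_dim:
  fixes A :: "complex mat"
  shows "dim_col A = dim_vec v \<Longrightarrow> A *\<^sub>v (c \<cdot>\<^sub>v v) = c \<cdot>\<^sub>v (A *\<^sub>v v)"
  by (rule mult_mat_vec[OF carrier_matI carrier_vecI]) auto

lemma adjoint_dim [simp]: "dim_row (mat_adjoint A) = dim_col A" "dim_col (mat_adjoint A) = dim_row A"
  unfolding mat_adjoint_def by auto

lemma adjoint_carrier [simp]: "mat_adjoint A \<in> carrier_mat n m \<longleftrightarrow> A \<in> carrier_mat m n"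
  unfolding carrier_mat_dim adjoint_dim by (rule conj_commute)

lemma adjoint_index [simp]:
  assumes "i < dim_col A" "j < dim_row A"
  shows "mat_adjoint A $$ (i,j) = conjugate (A $$ (j,i))"
  using assms unfolding mat_adjoint_def by (simp add: mat_of_rows_index)

lemma adjoint_mult:
  fixes A B :: "complex mat"
  assumes "dim_col A = dim_row B"
  shows "mat_adjoint (A * B) = mat_adjoint B * mat_adjoint A"
  using assms by (intro eq_matI) (auto simp: scalar_prod_def intro!: sum.cong)

lemma adjoint_adjoint [simp]: "mat_adjoint (mat_adjoint A) = (A :: complex mat)"
  by (rule eq_matI) auto

lemma adjoint_one [simp]: "mat_adjoint (1\<^sub>m n) = (1\<^sub>m n :: complex mat)"
  by (rule eq_matI) auto

lemma adjoint_add: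
  fixes A B :: "complex mat"
  assumes "A \<in> carrier_mat m n" "B \<in> carrier_mat m n"
  shows "mat_adjoint (A + B) = mat_adjoint A + mat_adjoint B"
  using assms by (intro eq_matI) auto

lemma adjoint_smult: "mat_adjoint (c \<cdot>\<^sub>m A) = cnj c \<cdot>\<^sub>m mat_adjoint (A :: complex mat)"
  by (intro eq_matI) auto

lemma adjoint_cscalar_prod:
  fixes A :: "complex mat"
  assumes A: "A \<in> carrier_mat m n" and v: "v \<in> carrier_vec n" and w: "w \<in> carrier_vec m"
  shows "(A *\<^sub>v v) \<bullet>c w = v \<bullet>c (mat_adjoint A *\<^sub>v w)"
proof -
  have "(A *\<^sub>v v) \<bullet>c w = (\<Sum>i<m. \<Sum>j<n. A $$ (i,j) * v $ j * cnj (w $ i))"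
    using assms by (auto simp: scalar_prod_def sum_distrib_right atLeast0LessThan intro!: sum.cong)
  also have "\<dots> = (\<Sum>j<n. \<Sum>i<m. A $$ (i,j) * v $ j * cnj (w $ i))"
    by (rule sum.swap)
  also have "\<dots> = v \<bullet>c (mat_adjoint A *\<^sub>v w)"
    using assms
    by (auto simp: scalar_prod_def sum_distrib_left atLeast0LessThan algebra_simps intro!: sum.cong)
  finally show ?thesis .
qed

section \<open>The Euclidean norm of vectors\<close>

lemma l2_norm_vec_L2_set: "l2_norm_vec v = L2_set (\<lambda>i. cmod (v $ i)) {..<dim_vec v}"
  unfolding l2_norm_vec_def L2_set_def ..

lemma l2_norm_vec_nonneg [simp]: "0 \<le> l2_norm_vec v"
  unfolding l2_norm_vec_L2_set by simp

lemma l2_norm_vec_power2: "(l2_norm_vec v)\<^sup>2 = (\<Sum>i<dim_vec v. (cmod (v $ i))\<^sup>2)"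
  unfolding l2_norm_vec_def by (simp add: sum_nonneg)

lemma cscalar_prod_self: "v \<bullet>c v = complex_of_real ((l2_norm_vec v)\<^sup>2)"
  unfolding l2_norm_vec_power2
  by (simp add: scalar_prod_def atLeast0LessThan complex_norm_square[symmetric] del: of_real_power)

lemma l2_norm_vec_zero [simp]: "l2_norm_vec (0\<^sub>v n) = 0"
  unfolding l2_norm_vec_def by simp

lemma l2_norm_vec_eq_0: "v \<in> carrier_vec n \<Longrightarrow> l2_norm_vec v = 0 \<longleftrightarrow> v = 0\<^sub>v n"
  unfolding l2_norm_vec_L2_set by (auto simp: L2_set_eq_0_iff)

lemma l2_norm_vec_smult: "l2_norm_vec (c \<cdot>\<^sub>v v) = cmod c * l2_norm_vec v"
proof -
  have "l2_norm_vec (c \<cdot>\<^sub>v v) = L2_set (\<lambda>i. cmod c * cmod (v $ i)) {..<dim_vec v}"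
    unfolding l2_norm_vec_L2_set by (intro L2_set_cong) (auto simp: norm_mult)
  then show ?thesis
    by (simp add: L2_set_right_distrib l2_norm_vec_L2_set)
qed

lemma l2_norm_vec_triangle:
  assumes "v \<in> carrier_vec n" "w \<in> carrier_vec n"
  shows "l2_norm_vec (v + w) \<le> l2_norm_vec v + l2_norm_vec w"
proof -
  have "l2_norm_vec (v + w) = L2_set (\<lambda>i. cmod (v $ i + w $ i)) {..<n}"
    using assms by (auto simp: l2_norm_vec_L2_set intro!: L2_set_cong)
  also have "\<dots> \<le> L2_set (\<lambda>i. cmod (v $ i) + cmod (w $ i)) {..<n}"
    by (intro L2_set_mono) (auto intro: norm_triangle_ineq)
  also have "\<dots> \<le> L2_set (\<lambda>i. cmod (v $ i)) {..<n} + L2_set (\<lambda>i. cmod (w $ i)) {..<n}"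
    by (rule L2_set_triangle_ineq)
  also have "\<dots> = l2_norm_vec v + l2_norm_vec w"
    using assms by (simp add: l2_norm_vec_L2_set)
  finally show ?thesis .
qed

lemma l2_norm_isometry:
  assumes A: "A \<in> carrier_mat m n" and iso: "mat_adjoint A * A = 1\<^sub>m n" and v: "v \<in> carrier_vec n"
  shows "l2_norm_vec (A *\<^sub>v v) = l2_norm_vec v"
proof -
  have "(A *\<^sub>v v) \<bullet>c (A *\<^sub>v v) = v \<bullet>c (mat_adjoint A *\<^sub>v (A *\<^sub>v v))"
    using A v by (intro adjoint_cscalar_prod) auto
  also have "mat_adjoint A *\<^sub>v (A *\<^sub>v v) = (mat_adjoint A * A) *\<^sub>v v"
    using A v by (intro assoc_mult_mat_vec[symmetric]) auto
  also have "\<dots> = v"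
    using v iso by simp
  finally have "(l2_norm_vec (A *\<^sub>v v))\<^sup>2 = (l2_norm_vec v)\<^sup>2"
    unfolding cscalar_prod_self of_real_eq_iff .
  then show ?thesis
    by (simp add: power2_eq_iff_nonneg)
qed

text \<open>\<open>op_norm\<close> is a supremum of reals and carries information only if the set is
  bounded above; the sum of the moduli of all entries is a crude bound that suffices.\<close>

lemma l2_norm_mult_mat_vec_exists_bound:
  "\<exists>c\<ge>0. \<forall>v\<in>carrier_vec (dim_col A). l2_norm_vec (A *\<^sub>v v) \<le> c * l2_norm_vec v"
proof -
  define c where "c = (\<Sum>i<dim_row A. \<Sum>j<dim_col A. cmod (A $$ (i,j)))"
  have "l2_norm_vec (A *\<^sub>v v) \<le> c * l2_norm_vec v" if v: "v \<in> carrier_vec (dim_col A)" for v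
  proof -
    have vj: "cmod (v $ j) \<le> l2_norm_vec v" if "j < dim_col A" for j
      unfolding l2_norm_vec_L2_set using v that by (intro member_le_L2_set) auto
    have "l2_norm_vec (A *\<^sub>v v) \<le> (\<Sum>i<dim_row A. cmod ((A *\<^sub>v v) $ i))"
      unfolding l2_norm_vec_L2_set dim_mult_mat_vec by (rule L2_set_le_sum) simp
    also have "\<dots> \<le> (\<Sum>i<dim_row A. \<Sum>j<dim_col A. cmod (A $$ (i,j)) * l2_norm_vec v)"
    proof (rule sum_mono)
      fix i assume "i \<in> {..<dim_row A}"
      then have "(A *\<^sub>v v) $ i = (\<Sum>j<dim_col A. A $$ (i,j) * v $ j)"
        using v by (auto simp: scalar_prod_def atLeast0LessThan intro!: sum.cong)
      also have "cmod \<dots> \<le> (\<Sum>j<dim_col A. cmod (A $$ (i,j)) * l2_norm_vec v)"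
        by (rule sum_norm_le) (auto simp: norm_mult intro!: mult_left_mono vj)
      finally show "cmod ((A *\<^sub>v v) $ i) \<le> \<dots>" .
    qed
    also have "\<dots> = c * l2_norm_vec v"
      unfolding c_def by (simp add: sum_distrib_right)
    finally show ?thesis .
  qed
  moreover have "c \<ge> 0"
    unfolding c_def by (intro sum_nonneg) auto
  ultimately show ?thesis
    by blast
qed

lemma op_norm_bdd:
  "bdd_above ((\<lambda>v. l2_norm_vec (A *\<^sub>v v)) ` {v \<in> carrier_vec (dim_col A). l2_norm_vec v \<le> 1})"
proof -
  obtain c where c: "c \<ge> 0" "\<forall>v\<in>carrier_vec (dim_col A). l2_norm_vec (A *\<^sub>v v) \<le> c * l2_norm_vec v"
    using l2_norm_mult_mat_vec_exists_bound by blast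
  have "l2_norm_vec (A *\<^sub>v v) \<le> c" if "v \<in> carrier_vec (dim_col A)" "l2_norm_vec v \<le> 1" for v
    using c(2)[rule_format, OF that(1)] mult_left_mono[OF that(2) c(1)] by simp
  then show ?thesis
    by (intro bdd_aboveI[of _ c]) auto
qed

lemma op_norm_nonneg [simp]: "0 \<le> op_norm A"
proof -
  have "l2_norm_vec (A *\<^sub>v 0\<^sub>v (dim_col A)) \<le> op_norm A"
    unfolding op_norm_def by (rule cSUP_upper[OF _ op_norm_bdd]) auto
  then show ?thesis
    using l2_norm_vec_nonneg order_trans by blast
qed

lemma l2_norm_le_op_norm:
  assumes "A \<in> carrier_mat m n" and v: "v \<in> carrier_vec n"
  shows "l2_norm_vec (A *\<^sub>v v) \<le> op_norm A * l2_norm_vec v"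
proof (cases "l2_norm_vec v = 0")
  case True
  then have "v = 0\<^sub>v n"
    using l2_norm_vec_eq_0 v by blast
  moreover have "A *\<^sub>v 0\<^sub>v n = 0\<^sub>v m"
    using assms by (intro eq_vecI) auto
  ultimately show ?thesis
    by simp
next
  case False
  define u where "u = complex_of_real (1 / l2_norm_vec v) \<cdot>\<^sub>v v"
  have u: "u \<in> carrier_vec n" "l2_norm_vec u = 1"
    using v False by (simp_all add: u_def l2_norm_vec_smult norm_divide)
  have "l2_norm_vec (A *\<^sub>v u) \<le> op_norm A"
    unfolding op_norm_def by (rule cSUP_upper[OF _ op_norm_bdd]) (use u assms in auto)
  moreover have "A *\<^sub>v u = complex_of_real (1 / l2_norm_vec v) \<cdot>\<^sub>v (A *\<^sub>v v)"
    unfolding u_def using assms by (simp add: mult_mat_vec)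
  ultimately have "1 / l2_norm_vec v * l2_norm_vec (A *\<^sub>v v) \<le> op_norm A"
    by (simp add: l2_norm_vec_smult norm_divide)
  moreover have "l2_norm_vec v > 0"
    using False l2_norm_vec_nonneg[of v] by linarith
  ultimately show ?thesis
    by (simp add: field_simps)
qed

lemma op_norm_leI:
  assumes A: "A \<in> carrier_mat m n" and c: "c \<ge> 0"
    and le: "\<And>v. v \<in> carrier_vec n \<Longrightarrow> l2_norm_vec (A *\<^sub>v v) \<le> c * l2_norm_vec v"
  shows "op_norm A \<le> c"
  unfolding op_norm_def
proof (rule cSUP_least)
  show "{v \<in> carrier_vec (dim_col A). l2_norm_vec v \<le> 1} \<noteq> {}"
    by (auto intro!: exI[of _ "0\<^sub>v (dim_col A)"])
  fix v assume "v \<in> {v \<in> carrier_vec (dim_col A). l2_norm_vec v \<le> 1}"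
  then show "l2_norm_vec (A *\<^sub>v v) \<le> c"
    using le[of v] A mult_left_mono[OF _ c, of "l2_norm_vec v" 1] by auto
qed

lemma op_norm_triangle:
  assumes "A \<in> carrier_mat m n" "B \<in> carrier_mat m n"
  shows "op_norm (A + B) \<le> op_norm A + op_norm B"
proof (rule op_norm_leI)
  show "A + B \<in> carrier_mat m n"
    using assms by simp
  fix v :: "complex vec" assume v: "v \<in> carrier_vec n"
  have "l2_norm_vec ((A + B) *\<^sub>v v) \<le> l2_norm_vec (A *\<^sub>v v) + l2_norm_vec (B *\<^sub>v v)"
    using assms v by (simp add: add_mult_distrib_mat_vec l2_norm_vec_triangle[of _ m])
  also have "\<dots> \<le> (op_norm A + op_norm B) * l2_norm_vec v"
    using l2_norm_le_op_norm[OF assms(1) v] l2_norm_le_op_norm[OF assms(2) v]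
    by (simp add: distrib_right)
  finally show "l2_norm_vec ((A + B) *\<^sub>v v) \<le> \<dots>" .
qed simp

lemma op_norm_mult:
  assumes "A \<in> carrier_mat m n" "B \<in> carrier_mat n k"
  shows "op_norm (A * B) \<le> op_norm A * op_norm B"
proof (rule op_norm_leI)
  show "A * B \<in> carrier_mat m k"
    using assms by simp
  fix v :: "complex vec" assume v: "v \<in> carrier_vec k"
  have "l2_norm_vec (A * B *\<^sub>v v) \<le> op_norm A * l2_norm_vec (B *\<^sub>v v)"
    using assms v l2_norm_le_op_norm[OF assms(1), of "B *\<^sub>v v"] by simp
  also have "\<dots> \<le> op_norm A * (op_norm B * l2_norm_vec v)"
    using l2_norm_le_op_norm[OF assms(2) v] by (intro mult_left_mono) auto
  finally show "l2_norm_vec (A * B *\<^sub>v v) \<le> op_norm A * op_norm B * l2_norm_vec v"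
    by (simp add: mult_ac)
qed simp

lemma op_norm_smult: "op_norm (c \<cdot>\<^sub>m A) \<le> cmod c * op_norm A"
proof (rule op_norm_leI)
  fix v :: "complex vec" assume v: "v \<in> carrier_vec (dim_col A)"
  then have "(c \<cdot>\<^sub>m A) *\<^sub>v v = c \<cdot>\<^sub>v (A *\<^sub>v v)"
    by (intro eq_vecI) auto
  then have "l2_norm_vec (c \<cdot>\<^sub>m A *\<^sub>v v) = cmod c * l2_norm_vec (A *\<^sub>v v)"
    by (simp only: l2_norm_vec_smult)
  also have "\<dots> \<le> cmod c * (op_norm A * l2_norm_vec v)"
    using v by (intro mult_left_mono l2_norm_le_op_norm[of _ "dim_row A"]) auto
  finally show "l2_norm_vec (c \<cdot>\<^sub>m A *\<^sub>v v) \<le> cmod c * op_norm A * l2_norm_vec v"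
    by (simp only: mult.assoc)
qed auto

lemma op_norm_uminus: "op_norm (- A) = op_norm A"
proof -
  have le: "op_norm (- B) \<le> op_norm B" for B
  proof -
    have "- B = (-1) \<cdot>\<^sub>m B"
      by (intro eq_matI) auto
    then show ?thesis
      using op_norm_smult[of "-1" B] by simp
  qed
  have "- (- A) = A"
    by (intro eq_matI) auto
  then show ?thesis
    using le[of A] le[of "- A"] by simp
qed

lemma op_norm_minus_commute:
  assumes "A \<in> carrier_mat m n" "B \<in> carrier_mat m n"
  shows "op_norm (A - B) = op_norm (B - A)"
proof -
  have "A - B = - (B - A)"
    using assms by (intro eq_matI) auto
  then show ?thesis
    by (simp add: op_norm_uminus)
qed

lemma op_norm_triangle_minus:
  assumes "A \<in> carrier_mat m n" "B \<in> carrier_mat m n"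
  shows "op_norm (A - B) \<le> op_norm A + op_norm B"
proof -
  have "A - B = A + (- B)"
    using assms by (intro eq_matI) auto
  then show ?thesis
    using op_norm_triangle[OF assms(1), of "- B"] assms by (simp add: op_norm_uminus)
qed

lemma op_norm_triangle_dist:
  assumes "A \<in> carrier_mat m n" "B \<in> carrier_mat m n" "C \<in> carrier_mat m n"
  shows "op_norm (A - C) \<le> op_norm (A - B) + op_norm (B - C)"
proof -
  have "A - C = (A - B) + (B - C)"
    using assms by (intro eq_matI) auto
  then show ?thesis
    using op_norm_triangle[OF minus_carrier_mat[OF assms(2)] minus_carrier_mat[OF assms(3)], of A B] by simp
qed

lemma op_norm_isometry_le:
  assumes "A \<in> carrier_mat m n" "mat_adjoint A * A = 1\<^sub>m n"
  shows "op_norm A \<le> 1"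
  using assms by (intro op_norm_leI) (auto simp: l2_norm_isometry)

lemma cauchy_schwarz_cscalar_prod:
  fixes v w :: "complex vec"
  assumes "v \<in> carrier_vec n" "w \<in> carrier_vec n"
  shows "cmod (v \<bullet>c w) \<le> l2_norm_vec v * l2_norm_vec w"
proof -
  have "cmod (v \<bullet>c w) \<le> (\<Sum>i<n. \<bar>cmod (v $ i)\<bar> * \<bar>cmod (w $ i)\<bar>)"
    using assms by (auto simp: scalar_prod_def atLeast0LessThan norm_mult intro!: sum_norm_le)
  also have "\<dots> \<le> l2_norm_vec v * l2_norm_vec w"
    using L2_set_mult_ineq[of "\<lambda>i. cmod (v $ i)" "\<lambda>i. cmod (w $ i)" "{..<n}"] assms
    by (simp add: l2_norm_vec_L2_set)
  finally show ?thesis .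
qed

text \<open>For \<open>v\<close> the image of \<open>w\<close> under the adjoint, the squared norm
  of \<open>v\<close> is the inner product of \<open>A v\<close> with \<open>w\<close>.
  Cauchy-Schwarz bounds it by the product of the norms of \<open>A\<close>, \<open>v\<close> and
  \<open>w\<close>, and one norm of \<open>v\<close> cancels.\<close>

lemma op_norm_adjoint_le:
  assumes A: "A \<in> carrier_mat m n"
  shows "op_norm (mat_adjoint A) \<le> op_norm A"
proof (rule op_norm_leI)
  show "mat_adjoint A \<in> carrier_mat n m"
    using A unfolding adjoint_carrier .
  fix w :: "complex vec" assume w: "w \<in> carrier_vec m"
  define v where "v = mat_adjoint A *\<^sub>v w"
  have v: "v \<in> carrier_vec n"
    unfolding v_def by (rule mult_mat_vec_carrier[OF iffD2[OF adjoint_carrier A] w])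
  have "complex_of_real ((l2_norm_vec v)\<^sup>2) = (A *\<^sub>v v) \<bullet>c w"
    unfolding cscalar_prod_self[symmetric] adjoint_cscalar_prod[OF A v w] v_def[symmetric] ..
  then have "(l2_norm_vec v)\<^sup>2 = cmod ((A *\<^sub>v v) \<bullet>c w)"
    by (metis abs_of_nonneg norm_of_real zero_le_power2)
  also have "\<dots> \<le> l2_norm_vec (A *\<^sub>v v) * l2_norm_vec w"
    using A v w by (intro cauchy_schwarz_cscalar_prod[of _ m]) auto
  also have "\<dots> \<le> (op_norm A * l2_norm_vec v) * l2_norm_vec w"
    using l2_norm_le_op_norm[OF A v] by (intro mult_right_mono) auto
  finally have "l2_norm_vec v * l2_norm_vec v \<le> l2_norm_vec v * (op_norm A * l2_norm_vec w)"
    by (simp add: power2_eq_square mult_ac)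
  then have "l2_norm_vec v \<le> op_norm A * l2_norm_vec w"
    using l2_norm_vec_nonneg[of v] l2_norm_vec_nonneg[of w] op_norm_nonneg[of A]
    by (cases "l2_norm_vec v = 0") (simp_all add: mult_le_cancel_left)
  then show "l2_norm_vec (mat_adjoint A *\<^sub>v w) \<le> op_norm A * l2_norm_vec w"
    unfolding v_def .
qed simp

lemma op_norm_adjoint: "op_norm (mat_adjoint A) = op_norm A"
proof -
  have A: "A \<in> carrier_mat (dim_row A) (dim_col A)"
    by (rule carrier_matI[OF refl refl])
  have A': "mat_adjoint A \<in> carrier_mat (dim_col A) (dim_row A)"
    by (rule iffD2[OF adjoint_carrier A])
  have "op_norm A \<le> op_norm (mat_adjoint A)"
    by (rule op_norm_adjoint_le[OF A', unfolded adjoint_adjoint])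
  then show ?thesis
    by (rule antisym[OF op_norm_adjoint_le[OF A]])
qed

section \<open>Unitary diagonalization of normal matrices\<close>

text \<open>Associativity of matrix products is conditional on matching dimensions. These rules
  bring products to right-associated form; together with the dimension equations of the matrices at
  hand they prove product identities by \<open>simp only\<close>.\<close>

lemmas mat_normalize = assoc_mult_mat_dim adjoint_mult adjoint_adjoint adjoint_dim index_mult_mat(2,3)
  index_minus_mat(2,3)

lemmas mat_dims = carrier_mat_dim mat_normalize

abbreviation unitaries :: "nat \<Rightarrow> complex mat set" where
  "unitaries n \<equiv> carrier (unitary_group n)"

lemma unitaries_iff:
  "U \<in> unitaries n \<longleftrightarrow> U \<in> carrier_mat n n \<and> mat_adjoint U * U = 1\<^sub>m n \<and> U * mat_adjoint U = 1\<^sub>m n"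
  by (simp add: unitary_group_def)

lemma unitaries_carrier: "U \<in> unitaries n \<Longrightarrow> U \<in> carrier_mat n n"
  by (simp add: unitaries_iff)

lemma unitariesD:
  assumes "U \<in> unitaries n"
  shows "mat_adjoint U * U = 1\<^sub>m n" "U * mat_adjoint U = 1\<^sub>m n"
  using conjunct2[OF iffD1[OF unitaries_iff assms]] by (blast dest: conjunct1 conjunct2)+

lemma unitariesI:
  assumes "U \<in> carrier_mat n n" "mat_adjoint U * U = 1\<^sub>m n"
  shows "U \<in> unitaries n"
  using assms mat_mult_left_right_inverse[of "mat_adjoint U" n U] by (simp add: unitaries_iff)

lemma unitaries_adjoint: "U \<in> unitaries n \<Longrightarrow> mat_adjoint U \<in> unitaries n"
  by (simp add: unitaries_iff)

lemma unitaries_one: "1\<^sub>m n \<in> unitaries n"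
  by (simp add: unitaries_iff)

lemma adjoint_cancel:
  assumes U: "U \<in> unitaries n" and X: "X \<in> carrier_mat n m"
  shows "mat_adjoint U * (U * X) = X" "U * (mat_adjoint U * X) = X"
proof -
  have "mat_adjoint U * (U * X) = mat_adjoint U * U * X" "U * (mat_adjoint U * X) = U * mat_adjoint U * X"
    using carrier_matD[OF unitaries_carrier[OF U]] carrier_matD[OF X]
    by (simp_all only: assoc_mult_mat_dim adjoint_dim)
  then show "mat_adjoint U * (U * X) = X" "U * (mat_adjoint U * X) = X"
    using U X by (simp_all add: unitaries_iff)
qed

lemma adjoint_cancel_right:
  assumes U: "U \<in> unitaries n" and X: "X \<in> carrier_mat m n"
  shows "X * mat_adjoint U * U = X" "X * U * mat_adjoint U = X"
proof -
  have "X * mat_adjoint U * U = X * (mat_adjoint U * U)" "X * U * mat_adjoint U = X * (U * mat_adjoint U)"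
    using carrier_matD[OF unitaries_carrier[OF U]] carrier_matD[OF X]
    by (simp_all only: assoc_mult_mat_dim adjoint_dim)
  then show "X * mat_adjoint U * U = X" "X * U * mat_adjoint U = X"
    using U X by (simp_all add: unitaries_iff)
qed

lemma unitaries_mult:
  assumes "U \<in> unitaries n" "V \<in> unitaries n"
  shows "U * V \<in> unitaries n"
proof (rule unitariesI)
  have c: "U \<in> carrier_mat n n" "V \<in> carrier_mat n n"
    using assms by (auto simp: unitaries_iff)
  then show "U * V \<in> carrier_mat n n"
    by simp
  have "mat_adjoint (U * V) * (U * V) = mat_adjoint V * (mat_adjoint U * (U * V))"
    by (simp only: mat_normalize carrier_matD[OF c(1)] carrier_matD[OF c(2)])
  also have "\<dots> = 1\<^sub>m n"
    using assms by (simp only: adjoint_cancel[OF assms(1) c(2)]) (simp add: unitaries_iff)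
  finally show "mat_adjoint (U * V) * (U * V) = 1\<^sub>m n" .
qed

lemma op_norm_unitary_le: "U \<in> unitaries n \<Longrightarrow> op_norm U \<le> 1"
  by (auto simp: unitaries_iff intro: op_norm_isometry_le)

lemma l2_norm_unitary:
  "U \<in> unitaries n \<Longrightarrow> v \<in> carrier_vec n \<Longrightarrow> l2_norm_vec (U *\<^sub>v v) = l2_norm_vec v"
  by (auto simp: unitaries_iff intro: l2_norm_isometry)

lemma adjoint_mat_diag: "mat_adjoint (mat_diag n f) = mat_diag n (\<lambda>i. cnj (f i))"
  by (rule eq_matI) (auto simp: mat_diag_def)

text \<open>The direct sum of the scalar \<open>a\<close> and \<open>B\<close>: the shape of a
  normal matrix once an eigenvector is the first basis vector.\<close>

definition bordered_mat :: "complex \<Rightarrow> nat \<Rightarrow> complex mat \<Rightarrow> complex mat" where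
  "bordered_mat a n B = mat (Suc n) (Suc n)
     (\<lambda>(i,j). case i of 0 \<Rightarrow> (case j of 0 \<Rightarrow> a | Suc j' \<Rightarrow> 0)
                      | Suc i' \<Rightarrow> (case j of 0 \<Rightarrow> 0 | Suc j' \<Rightarrow> B $$ (i',j')))"

lemma bordered_mat_carrier [simp]: "bordered_mat a n B \<in> carrier_mat (Suc n) (Suc n)"
  by (simp add: bordered_mat_def)

lemma bordered_mat_mult:
  assumes "B \<in> carrier_mat n n" "C \<in> carrier_mat n n"
  shows "bordered_mat a n B * bordered_mat b n C = bordered_mat (a * b) n (B * C)"
  using assms
  by (intro eq_matI)
    (auto simp: bordered_mat_def scalar_prod_def sum.atLeast0_lessThan_Suc_shift simp del: sum.op_ivl_Suc
      split: nat.splits)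

lemma bordered_mat_adjoint:
  "B \<in> carrier_mat n n \<Longrightarrow> mat_adjoint (bordered_mat a n B) = bordered_mat (cnj a) n (mat_adjoint B)"
  by (intro eq_matI) (auto simp: bordered_mat_def split: nat.splits)

lemma bordered_mat_diag:
  "bordered_mat a n (mat_diag n f) = mat_diag (Suc n) (\<lambda>i. case i of 0 \<Rightarrow> a | Suc j \<Rightarrow> f j)"
  by (intro eq_matI) (auto simp: bordered_mat_def mat_diag_def split: nat.splits)

lemma bordered_mat_one: "bordered_mat 1 n (1\<^sub>m n) = 1\<^sub>m (Suc n)"
  by (intro eq_matI) (auto simp: bordered_mat_def split: nat.splits)

lemma bordered_mat_inject:
  assumes "bordered_mat a n B = bordered_mat b n C" "B \<in> carrier_mat n n" "C \<in> carrier_mat n n"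
  shows "B = C"
proof (rule eq_matI)
  fix i j assume "i < dim_row C" "j < dim_col C"
  then show "B $$ (i,j) = C $$ (i,j)"
    using arg_cong[OF assms(1), of "\<lambda>M. M $$ (Suc i, Suc j)"] assms(2,3)
    by (simp add: bordered_mat_def)
qed (use assms in auto)

text \<open>Gram-Schmidt on a basis that starts with \<open>v\<close> gives orthogonal columns,
  which are then normalised. The factor \<open>c\<close> may stay unspecified because a multiple of
  an eigenvector serves equally well.\<close>

lemma exists_unitary_first_col:
  fixes v :: "complex vec"
  assumes v: "v \<in> carrier_vec n" and v0: "v \<noteq> 0\<^sub>v n"
  shows "\<exists>W\<in>unitaries n. \<exists>c. W *\<^sub>v unit_vec n 0 = c \<cdot>\<^sub>v v"
proof -
  interpret cof_vec_space n "TYPE(complex)" .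
  define b where "b = basis_completion v"
  define ws where "ws = gram_schmidt n b"
  from basis_completion[OF v v0, folded b_def]
  have dist_b: "distinct b" and indep: "\<not> lin_dep (set b)" and b: "set b \<subseteq> carrier_vec n"
    and hdb: "hd b = v" and len_b: "length b = n"
    by auto
  have n: "n \<noteq> 0"
    using v v0 by (auto intro!: eq_vecI)
  from hdb len_b n obtain vs where bv: "b = v # vs"
    by (cases b) auto
  from gram_schmidt_result[OF b dist_b indep refl, folded ws_def]
  have ws: "set ws \<subseteq> carrier_vec n" "corthogonal ws" "length ws = n"
    by (auto simp: len_b)
  from gram_schmidt_hd[OF v, of vs, folded bv] have hdws: "hd ws = v"
    unfolding ws_def .
  have wsi: "ws ! i \<in> carrier_vec n" if "i < n" for i
    using ws that by auto
  define r where "r i = complex_of_real (1 / l2_norm_vec (ws ! i))" for i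
  have r: "cnj (r i) * r i * (ws ! i \<bullet>c ws ! i) = 1" if "i < n" for i
  proof -
    have "ws ! i \<bullet>c ws ! i \<noteq> 0"
      using corthogonalD[OF ws(2), of i i] that ws(3) by simp
    then have "l2_norm_vec (ws ! i) \<noteq> 0"
      unfolding cscalar_prod_self by auto
    then show ?thesis
      unfolding cscalar_prod_self r_def by (simp add: power2_eq_square)
  qed
  define W where "W = mat n n (\<lambda>(i,j). r j * (ws ! j) $ i)"
  have W: "W \<in> carrier_mat n n"
    by (simp add: W_def)
  have "mat_adjoint W * W = 1\<^sub>m n"
  proof (rule eq_matI)
    fix i j assume "i < dim_row (1\<^sub>m n :: complex mat)" "j < dim_col (1\<^sub>m n :: complex mat)"
    then have ij: "i < n" "j < n"
      by auto
    have "(mat_adjoint W * W) $$ (i,j) = (\<Sum>k<n. cnj (r i * (ws ! i) $ k) * (r j * (ws ! j) $ k))"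
      using ij by (simp add: W_def scalar_prod_def atLeast0LessThan)
    also have "\<dots> = cnj (r i) * r j * (ws ! j \<bullet>c ws ! i)"
      using ij wsi[OF ij(1)] wsi[OF ij(2)]
      by (simp add: scalar_prod_def atLeast0LessThan sum_distrib_left mult_ac)
    also have "\<dots> = 1\<^sub>m n $$ (i,j)"
      using r[OF ij(1)] corthogonalD[OF ws(2), of j i] ws(3) ij by auto
    finally show "(mat_adjoint W * W) $$ (i,j) = 1\<^sub>m n $$ (i,j)" .
  qed (simp_all add: W_def)
  then have "W \<in> unitaries n"
    using W by (rule unitariesI[rotated])
  moreover have "W *\<^sub>v unit_vec n 0 = r 0 \<cdot>\<^sub>v v"
  proof (rule eq_vecI)
    have "ws ! 0 = v"
      using hdws ws(3) n by (metis hd_conv_nth length_0_conv)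
    then show "(W *\<^sub>v unit_vec n 0) $ i = (r 0 \<cdot>\<^sub>v v) $ i" if "i < dim_vec (r 0 \<cdot>\<^sub>v v)" for i
      using that v n by (simp add: W_def)
  qed (use v W in simp_all)
  ultimately show ?thesis
    by blast
qed

lemma unitary_conj_inverse:
  assumes W: "W \<in> unitaries n" and A: "A \<in> carrier_mat n n"
  shows "W * (mat_adjoint W * A * W) * mat_adjoint W = A"
proof -
  note dims = carrier_matD[OF unitaries_carrier[OF W]] carrier_matD[OF A]
  have "W * (mat_adjoint W * A * W) * mat_adjoint W
      = W * (mat_adjoint W * (A * (W * mat_adjoint W)))"
    by (simp only: mat_normalize dims)
  also have "\<dots> = A"
    using W A by (subst adjoint_cancel[OF W, of _ n]) (auto simp: unitaries_iff)
  finally show ?thesis .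
qed

lemma unitary_conj_mult:
  assumes W: "W \<in> unitaries n" and A: "A \<in> carrier_mat n n" and B: "B \<in> carrier_mat n n"
  shows "(mat_adjoint W * A * W) * (mat_adjoint W * B * W) = mat_adjoint W * (A * B) * W"
proof -
  note dims = carrier_matD[OF unitaries_carrier[OF W]] carrier_matD[OF A] carrier_matD[OF B]
  have "(mat_adjoint W * A * W) * (mat_adjoint W * B * W)
      = mat_adjoint W * (A * (W * (mat_adjoint W * (B * W))))"
    by (simp only: mat_normalize dims)
  also have "W * (mat_adjoint W * (B * W)) = B * W"
    using W B by (intro adjoint_cancel[OF W, of _ n]) (simp add: unitaries_iff)
  finally show ?thesis
    by (simp only: mat_normalize dims)
qed

lemma unitary_conj_adjoint:
  assumes W: "W \<in> unitaries n" and A: "A \<in> carrier_mat n n"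
  shows "mat_adjoint (mat_adjoint W * A * W) = mat_adjoint W * mat_adjoint A * W"
proof -
  note dims = carrier_matD[OF unitaries_carrier[OF W]] carrier_matD[OF A]
  show ?thesis
    by (simp only: mat_normalize dims)
qed

text \<open>Induction on the size. A unitary conjugation moves an eigenvector to the first
  coordinate and clears the first column; normality then clears the first row as well, and the
  remaining block is again normal.\<close>

theorem normal_mat_diagonalizable:
  fixes A :: "complex mat"
  assumes "A \<in> carrier_mat n n" "mat_adjoint A * A = A * mat_adjoint A"
  shows "\<exists>S\<in>unitaries n. \<exists>f. A = S * mat_diag n f * mat_adjoint S"
  using assms
proof (induction n arbitrary: A)
  case 0
  then have "A = 1\<^sub>m 0 * mat_diag 0 (\<lambda>_. 0) * mat_adjoint (1\<^sub>m 0)"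
    by (intro eq_matI) auto
  then show ?case
    using unitaries_one[of 0] by blast
next
  case (Suc n)
  let ?N = "Suc n"
  have A: "A \<in> carrier_mat ?N ?N"
    by fact
  obtain e where "eigenvalue A e"
    using spectrum_non_empty[OF A] by (auto simp: spectrum_def)
  then obtain v where v: "v \<in> carrier_vec ?N" "v \<noteq> 0\<^sub>v ?N" "A *\<^sub>v v = e \<cdot>\<^sub>v v"
    using A unfolding eigenvalue_def eigenvector_def by auto
  obtain W c where W: "W \<in> unitaries ?N" and Wc: "W *\<^sub>v unit_vec ?N 0 = c \<cdot>\<^sub>v v"
    using exists_unitary_first_col[OF v(1,2)] by blast
  have Wcar: "W \<in> carrier_mat ?N ?N" "mat_adjoint W \<in> carrier_mat ?N ?N"
    using W by (auto simp: unitaries_iff)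
  define A' where "A' = mat_adjoint W * A * W"
  have A': "A' \<in> carrier_mat ?N ?N"
    using A Wcar unfolding A'_def by simp
  have norm': "mat_adjoint A' * A' = A' * mat_adjoint A'"
    using A Suc.prems(2) unfolding A'_def
    by (simp add: unitary_conj_adjoint[OF W] unitary_conj_mult[OF W])
  have "A' *\<^sub>v unit_vec ?N 0 = mat_adjoint W *\<^sub>v (A *\<^sub>v (W *\<^sub>v unit_vec ?N 0))"
    unfolding A'_def
    by (simp only: assoc_mult_mat_dim assoc_mult_mat_vec_dim index_mult_mat(2,3) carrier_matD[OF A]
        carrier_matD[OF Wcar(1)] adjoint_dim dim_mult_mat_vec index_unit_vec(3))
  also have "A *\<^sub>v (W *\<^sub>v unit_vec ?N 0) = e \<cdot>\<^sub>v (W *\<^sub>v unit_vec ?N 0)"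
    unfolding Wc using A v by (simp add: mult_mat_vec smult_smult_assoc mult.commute)
  also have "mat_adjoint W *\<^sub>v \<dots> = e \<cdot>\<^sub>v ((mat_adjoint W * W) *\<^sub>v unit_vec ?N 0)"
    by (simp only: mult_mat_vec_smult_dim assoc_mult_mat_vec_dim carrier_matD[OF Wcar(1)] adjoint_dim
        dim_mult_mat_vec index_unit_vec(3))
  also have "mat_adjoint W * W = 1\<^sub>m ?N"
    using W by (simp add: unitaries_iff)
  finally have A'0: "A' *\<^sub>v unit_vec ?N 0 = e \<cdot>\<^sub>v unit_vec ?N 0"
    by simp
  have col0: "A' $$ (i, 0) = (if i = 0 then e else 0)" if "i < ?N" for i
    using arg_cong[OF A'0, of "\<lambda>w. w $ i"] that A' by simp
  \<comment> \<open>The corner entry is the squared norm of the first column in one order of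
    multiplication and of the first row in the other. Their equality leaves nothing for the row
    outside the corner.\<close>
  have "(mat_adjoint A' * A') $$ (0,0) = cnj e * e"
    using A' col0 by (simp add: scalar_prod_def sum.atLeast0_lessThan_Suc_shift del: sum.op_ivl_Suc)
  moreover have "(A' * mat_adjoint A') $$ (0,0) = e * cnj e + (\<Sum>j=0..<n. complex_of_real ((cmod (A' $$ (0, Suc j)))\<^sup>2))"
    using A' col0[of 0]
    by (simp add: scalar_prod_def sum.atLeast0_lessThan_Suc_shift complex_norm_square
        del: sum.op_ivl_Suc of_real_power)
  ultimately have "complex_of_real (\<Sum>j=0..<n. (cmod (A' $$ (0, Suc j)))\<^sup>2) = 0"
    using norm' by simp
  then have "(\<Sum>j=0..<n. (cmod (A' $$ (0, Suc j)))\<^sup>2) = 0"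
    unfolding of_real_eq_0_iff .
  then have row0: "A' $$ (0, Suc j) = 0" if "j < n" for j
    using that by (simp add: sum_nonneg_eq_0_iff)
  define B where "B = mat n n (\<lambda>(i,j). A' $$ (Suc i, Suc j))"
  have B: "B \<in> carrier_mat n n"
    by (simp add: B_def)
  have A'B: "A' = bordered_mat e n B"
    using A' col0 row0 by (intro eq_matI) (auto simp: bordered_mat_def B_def split: nat.splits)
  have "bordered_mat (cnj e * e) n (mat_adjoint B * B) = bordered_mat (e * cnj e) n (B * mat_adjoint B)"
    using norm' B unfolding A'B by (simp add: bordered_mat_adjoint bordered_mat_mult)
  then have "mat_adjoint B * B = B * mat_adjoint B"
    by (rule bordered_mat_inject) (simp_all only: mat_dims carrier_matD[OF B])
  then obtain T f where T: "T \<in> unitaries n" and BT: "B = T * mat_diag n f * mat_adjoint T"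
    using Suc.IH[OF B] by blast
  have Tcar: "T \<in> carrier_mat n n" "mat_adjoint T \<in> carrier_mat n n"
    using T by (auto simp: unitaries_iff)
  define T' where "T' = bordered_mat 1 n T"
  have T': "T' \<in> unitaries ?N"
    using T Tcar
    by (intro unitariesI)
      (simp_all add: T'_def bordered_mat_adjoint bordered_mat_mult bordered_mat_one[symmetric] unitaries_iff)
  have T'car: "T' \<in> carrier_mat ?N ?N" "mat_adjoint T' \<in> carrier_mat ?N ?N"
    using T' by (auto simp: unitaries_iff)
  define g where "g i = (case i of 0 \<Rightarrow> e | Suc j \<Rightarrow> f j)" for i
  have "A' = T' * mat_diag ?N g * mat_adjoint T'"
    unfolding A'B BT T'_def g_def using Tcar
    by (simp add: bordered_mat_adjoint bordered_mat_mult bordered_mat_diag[symmetric])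
  then have "A = W * (T' * mat_diag ?N g * mat_adjoint T') * mat_adjoint W"
    using unitary_conj_inverse[OF W A] unfolding A'_def by simp
  also have "\<dots> = (W * T') * mat_diag ?N g * mat_adjoint (W * T')"
    by (simp only: mat_normalize carrier_matD[OF mat_diag_dim]
        carrier_matD[OF Wcar(1)] carrier_matD[OF T'car(1)])
  finally show ?case
    using unitaries_mult[OF W T'] by blast
qed

section \<open>Polar decomposition\<close>

text \<open>A fixed diagonalising \<open>S\<close> gives the functional calculus from which the
  square root of the modulus and its inverse are taken below.\<close>

lemma spectral_mult:
  assumes "S \<in> unitaries n"
  shows "(S * mat_diag n f * mat_adjoint S) * (S * mat_diag n g * mat_adjoint S)
    = S * mat_diag n (\<lambda>i. f i * g i) * mat_adjoint S"
  using unitary_conj_mult[OF unitaries_adjoint[OF assms] mat_diag_dim[of n f] mat_diag_dim[of n g]]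
  unfolding adjoint_adjoint mat_diag_diag .

lemma spectral_adjoint:
  assumes "S \<in> unitaries n"
  shows "mat_adjoint (S * mat_diag n f * mat_adjoint S) = S * mat_diag n (\<lambda>i. cnj (f i)) * mat_adjoint S"
  using unitary_conj_adjoint[OF unitaries_adjoint[OF assms] mat_diag_dim[of n f]]
  unfolding adjoint_adjoint adjoint_mat_diag .

lemma spectral_one:
  assumes "S \<in> unitaries n"
  shows "S * mat_diag n (\<lambda>_. 1) * mat_adjoint S = 1\<^sub>m n"
  using assms unfolding mat_diag_one right_mult_one_mat[OF unitaries_carrier[OF assms]]
  by (simp add: unitaries_iff)

lemma smult_one_mult_mat_vec:
  fixes v :: "complex vec"
  assumes "v \<in> carrier_vec n"
  shows "(c \<cdot>\<^sub>m 1\<^sub>m n) *\<^sub>v v = c \<cdot>\<^sub>v v"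
  using assms by (intro eq_vecI) (auto simp: smult_scalar_prod_distrib[of _ n])

lemma spectral_carrier:
  assumes "S \<in> unitaries n"
  shows "S * mat_diag n f * mat_adjoint S \<in> carrier_mat n n"
  using carrier_matD[OF unitaries_carrier[OF assms]] by (simp only: mat_dims)

text \<open>Commuting with a diagonal matrix means that entry \<open>(i,j)\<close> vanishes whenever
  the diagonal values at \<open>i\<close> and \<open>j\<close> differ. Applying \<open>g\<close> can
  only merge values, so the condition survives.\<close>

lemma mat_diag_commute_comp:
  fixes M :: "complex mat"
  assumes M: "M \<in> carrier_mat n n" and comm: "M * mat_diag n f = mat_diag n f * M"
  shows "M * mat_diag n (\<lambda>i. g (f i)) = mat_diag n (\<lambda>i. g (f i)) * M"
proof -
  have "M $$ (i,j) * f j = f i * M $$ (i,j)" if "i < n" "j < n" for i j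
    using arg_cong[OF comm, of "\<lambda>A. A $$ (i,j)"] that
    unfolding mat_diag_mult_left[OF M] mat_diag_mult_right[OF M] by simp
  then have "M $$ (i,j) = 0 \<or> f i = f j" if "i < n" "j < n" for i j
    using that by (metis mult.commute mult_right_cancel)
  then show ?thesis
    unfolding mat_diag_mult_left[OF M] mat_diag_mult_right[OF M]
    by (intro eq_matI) fastforce+
qed

lemma unitary_conj_commute_iff:
  assumes S: "S \<in> unitaries n" and A: "A \<in> carrier_mat n n" and B: "B \<in> carrier_mat n n"
  shows "B * (S * A * mat_adjoint S) = (S * A * mat_adjoint S) * B \<longleftrightarrow>
    (mat_adjoint S * B * S) * A = A * (mat_adjoint S * B * S)" (is "?L \<longleftrightarrow> ?R")
proof -
  note dims = carrier_matD[OF unitaries_carrier[OF S]] carrier_matD[OF A] carrier_matD[OF B]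
  have Sc: "S \<in> carrier_mat n n" "mat_adjoint S \<in> carrier_mat n n"
    using S by (auto simp: unitaries_iff)
  have c: "S * (X * mat_adjoint S) \<in> carrier_mat n n" "mat_adjoint S * (X * S) \<in> carrier_mat n n"
    if "X \<in> carrier_mat n n" for X
    using that by (simp_all only: mat_dims dims)
  have 1: "S * ((mat_adjoint S * B * S) * A) * mat_adjoint S = B * (S * A * mat_adjoint S)"
    by (simp only: mat_normalize dims adjoint_cancel[OF S, of _ n] c A B carrier_mat_dim)
  have 2: "S * (A * (mat_adjoint S * B * S)) * mat_adjoint S = (S * A * mat_adjoint S) * B"
  proof -
    have "S * mat_adjoint S = 1\<^sub>m n"
      using S by (simp add: unitaries_iff)
    then show ?thesis
      by (simp only: mat_normalize dims right_mult_one_mat[OF B])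
  qed
  have 3: "mat_adjoint S * (S * X * mat_adjoint S) * S = X" if X: "X \<in> carrier_mat n n" for X
    using unitary_conj_inverse[OF unitaries_adjoint[OF S] X] unfolding adjoint_adjoint .
  have c1: "(mat_adjoint S * B * S) * A \<in> carrier_mat n n" "A * (mat_adjoint S * B * S) \<in> carrier_mat n n"
    by (simp_all only: mat_dims dims)
  show ?thesis
    using 1 2 3[OF c1(1)] 3[OF c1(2)] by metis
qed

text \<open>Used to pass commutation from a positive matrix to its inverse square root.\<close>

lemma spectral_commute_comp:
  assumes S: "S \<in> unitaries n" and B: "B \<in> carrier_mat n n"
    and "B * (S * mat_diag n f * mat_adjoint S) = (S * mat_diag n f * mat_adjoint S) * B"
  shows "B * (S * mat_diag n (\<lambda>i. g (f i)) * mat_adjoint S) = (S * mat_diag n (\<lambda>i. g (f i)) * mat_adjoint S) * B"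
proof -
  have "mat_adjoint S * B * S \<in> carrier_mat n n"
    using carrier_matD[OF unitaries_carrier[OF S]] by (simp only: mat_dims)
  then show ?thesis
    using assms(3) unfolding unitary_conj_commute_iff[OF S mat_diag_dim B]
    by (rule mat_diag_commute_comp)
qed

text \<open>In the eigenbasis the difference is coordinatewise, so comparing how far two functions
  of one matrix are from the identity becomes comparing the scalars \<open>1 - f i\<close>.\<close>

lemma l2_norm_spectral_diff:
  assumes S: "S \<in> unitaries n" and v: "v \<in> carrier_vec n"
  shows "l2_norm_vec (v - (S * mat_diag n f * mat_adjoint S) *\<^sub>v v)
    = sqrt (\<Sum>i<n. (cmod (1 - f i) * cmod ((mat_adjoint S *\<^sub>v v) $ i))\<^sup>2)"
proof -
  define u where "u = mat_adjoint S *\<^sub>v v"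
  note dims = carrier_matD[OF unitaries_carrier[OF S]] carrier_vecD[OF v]
  have u: "u \<in> carrier_vec n"
    unfolding u_def carrier_vec_def using dims by simp
  have v_eq: "v = S *\<^sub>v u"
  proof -
    have "S *\<^sub>v u = (S * mat_adjoint S) *\<^sub>v v"
      unfolding u_def by (rule assoc_mult_mat_vec_dim[symmetric]) (simp_all add: dims)
    then show ?thesis
      using S v by (simp add: unitaries_iff)
  qed
  have diag: "mat_diag n f *\<^sub>v u = vec n (\<lambda>i. f i * u $ i)"
    using u by (intro eq_vecI) (auto simp: mat_diag_def scalar_prod_def if_distrib[of "\<lambda>x. x * _"] cong: if_cong)
  have "(S * mat_diag n f * mat_adjoint S) *\<^sub>v v = S *\<^sub>v (mat_diag n f *\<^sub>v u)"
    unfolding u_def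
    by (simp only: assoc_mult_mat_dim assoc_mult_mat_vec_dim mat_normalize dims dim_mult_mat_vec
        carrier_matD[OF mat_diag_dim])
  then have "v - (S * mat_diag n f * mat_adjoint S) *\<^sub>v v = S *\<^sub>v u - S *\<^sub>v vec n (\<lambda>i. f i * u $ i)"
    using v_eq diag by simp
  also have "\<dots> = S *\<^sub>v (u - vec n (\<lambda>i. f i * u $ i))"
    using u unitaries_carrier[OF S] by (intro mult_minus_distrib_mat_vec[symmetric]) auto
  also have "u - vec n (\<lambda>i. f i * u $ i) = vec n (\<lambda>i. (1 - f i) * u $ i)"
    using u by (intro eq_vecI) (auto simp: algebra_simps)
  finally have "l2_norm_vec (v - (S * mat_diag n f * mat_adjoint S) *\<^sub>v v)
      = l2_norm_vec (vec n (\<lambda>i. (1 - f i) * u $ i))"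
    by (simp only: l2_norm_unitary[OF S vec_carrier])
  also have "\<dots> = sqrt (\<Sum>i<n. (cmod (1 - f i) * cmod (u $ i))\<^sup>2)"
    by (simp add: l2_norm_vec_def norm_mult)
  finally show ?thesis
    unfolding u_def .
qed

text \<open>The unitary part of the polar decomposition of a small shift \<open>X + t\<close>; the shift makes the
  modulus invertible.\<close>

lemma exists_commuting_polar_part:
  assumes X: "X \<in> carrier_mat n n" and X1: "op_norm X \<le> 1"
    and B: "B \<in> unitaries n" and BX: "B * X = X * B" and \<tau>: "\<tau> > 0"
  shows "\<exists>Q\<in>unitaries n. B * Q = Q * B \<and>
    (\<forall>v\<in>carrier_vec n. l2_norm_vec (Q *\<^sub>v v - X *\<^sub>v v)
       \<le> l2_norm_vec (v - mat_adjoint X *\<^sub>v (X *\<^sub>v v)) + \<tau> * l2_norm_vec v)"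
proof -
  have Bc: "B \<in> carrier_mat n n"
    by (rule unitaries_carrier[OF B])
  \<comment> \<open>The spectrum of \<open>X\<close> excludes only finitely many values. The bound 1
    keeps \<open>t\<close> times a norm below that norm; \<tau> / 4 makes room for the four errors
    of size \<open>t\<close> below.\<close>
  obtain t where t: "0 < t" "t < min 1 (\<tau> / 4)" "\<not> eigenvalue X (- complex_of_real t)"
  proof -
    have "finite (spectrum X)"
      using card_finite_spectrum(1)[OF X] .
    then have "finite ((\<lambda>t. - complex_of_real t) -` spectrum X)"
      by (rule finite_vimageI) (simp add: inj_on_def)
    moreover have "infinite {0<..<min 1 (\<tau> / 4)}"
      using \<tau> by (intro infinite_Ioo) simp
    ultimately have "\<not> {0<..<min 1 (\<tau> / 4)} \<subseteq> (\<lambda>t. - complex_of_real t) -` spectrum X"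
      using finite_subset by blast
    then obtain t where "t \<in> {0<..<min 1 (\<tau> / 4)}" "- complex_of_real t \<notin> spectrum X"
      by blast
    then show thesis
      by (intro that[of t]) (simp_all add: spectrum_def)
  qed
  let ?t = "complex_of_real t"
  define Y where "Y = X + ?t \<cdot>\<^sub>m 1\<^sub>m n"
  have Y: "Y \<in> carrier_mat n n"
    using X by (simp add: Y_def)
  note dims = carrier_matD[OF X] carrier_matD[OF Y] carrier_matD[OF Bc]
  have Yv: "Y *\<^sub>v v = X *\<^sub>v v + ?t \<cdot>\<^sub>v v" if v: "v \<in> carrier_vec n" for v
  proof -
    have "Y *\<^sub>v v = X *\<^sub>v v + (?t \<cdot>\<^sub>m 1\<^sub>m n) *\<^sub>v v"
      unfolding Y_def by (rule add_mult_distrib_mat_vec[OF X _ v]) simp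
    also have "(?t \<cdot>\<^sub>m 1\<^sub>m n) *\<^sub>v v = ?t \<cdot>\<^sub>v v"
      by (rule smult_one_mult_mat_vec[OF v])
    finally show ?thesis .
  qed
  have BY: "B * Y = Y * B"
  proof -
    have "B * Y = B * X + ?t \<cdot>\<^sub>m B"
      unfolding Y_def using X Bc
      by (subst mult_add_distrib_mat[OF Bc X])
        (simp_all add: mult_smult_distrib[OF Bc one_carrier_mat] right_mult_one_mat[OF Bc])
    moreover have "Y * B = X * B + ?t \<cdot>\<^sub>m B"
      unfolding Y_def using X Bc
      by (subst add_mult_distrib_mat[OF X _ Bc])
        (simp_all add: mult_smult_assoc_mat[OF one_carrier_mat Bc] left_mult_one_mat[OF Bc])
    ultimately show ?thesis
      using BX by simp
  qed
  \<comment> \<open>Adjoints of the previous relation give commutation with the adjoint of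
    \<open>B\<close>; multiplying by the unitary \<open>B\<close> on both sides turns this into
    commutation with \<open>B\<close>.\<close>
  have BYa: "B * mat_adjoint Y = mat_adjoint Y * B"
  proof -
    have "mat_adjoint Y * mat_adjoint B = mat_adjoint B * mat_adjoint Y"
      using arg_cong[OF BY, of mat_adjoint] by (simp only: adjoint_mult dims)
    then have "B * (mat_adjoint Y * mat_adjoint B) * B = B * (mat_adjoint B * mat_adjoint Y) * B"
      by simp
    moreover have "B * (mat_adjoint Y * mat_adjoint B) * B = B * mat_adjoint Y"
    proof -
      have "mat_adjoint B * B = 1\<^sub>m n"
        using B by (simp add: unitaries_iff)
      moreover have "mat_adjoint Y * 1\<^sub>m n = mat_adjoint Y"
        using Y by (intro right_mult_one_mat[of _ n n]) simp
      ultimately show ?thesis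
        by (simp only: mat_normalize dims)
    qed
    moreover have "B * (mat_adjoint B * mat_adjoint Y) = mat_adjoint Y"
      using Y by (intro adjoint_cancel[OF B, of _ n]) simp
    ultimately show ?thesis
      by simp
  qed
  define H where "H = mat_adjoint Y * Y"
  have Hc: "H \<in> carrier_mat n n"
    unfolding H_def by (simp only: mat_dims dims)
  have Ha: "mat_adjoint H = H"
    unfolding H_def by (simp only: mat_normalize dims)
  obtain S f where S: "S \<in> unitaries n" and HS: "H = S * mat_diag n f * mat_adjoint S"
    using normal_mat_diagonalizable[OF Hc] unfolding Ha by blast
  have BH: "B * H = H * B"
  proof -
    have "B * (mat_adjoint Y * Y) = B * mat_adjoint Y * Y"
      by (simp only: mat_normalize dims)
    also have "\<dots> = mat_adjoint Y * (B * Y)"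
      unfolding BYa by (simp only: mat_normalize dims)
    finally show ?thesis
      unfolding H_def BY by (simp only: mat_normalize dims)
  qed
  note Sdims = carrier_matD[OF unitaries_carrier[OF S]]
  \<comment> \<open>Eigenvalues of \<open>H\<close> are squared norms of \<open>Y u\<close> for unit
    eigenvectors \<open>u\<close>. They are nonzero because the choice of \<open>t\<close> makes
    \<open>Y\<close> injective.\<close>
  have "\<exists>l>0. f i = complex_of_real l" if i: "i < n" for i
  proof -
    define u where "u = S *\<^sub>v unit_vec n i"
    have u: "u \<in> carrier_vec n"
      unfolding u_def carrier_vec_def using Sdims by simp
    have lu: "l2_norm_vec u = 1"
    proof -
      have "(\<Sum>j<n. (cmod (if j = i then 1 else 0))\<^sup>2) = (\<Sum>j<n. if j = i then 1 else (0::real))"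
        by (intro sum.cong) auto
      then show ?thesis
        unfolding u_def l2_norm_unitary[OF S unit_vec_carrier] using i
        by (simp add: l2_norm_vec_def unit_vec_def)
    qed
    have "H *\<^sub>v u = S *\<^sub>v (mat_diag n f *\<^sub>v ((mat_adjoint S * S) *\<^sub>v unit_vec n i))"
      unfolding HS u_def
      by (simp only: assoc_mult_mat_dim assoc_mult_mat_vec_dim mat_normalize Sdims dim_mult_mat_vec
        carrier_matD[OF mat_diag_dim] index_unit_vec(3))
    also have "mat_adjoint S * S = 1\<^sub>m n"
      using S by (simp add: unitaries_iff)
    also have "1\<^sub>m n *\<^sub>v unit_vec n i = (unit_vec n i :: complex vec)"
      by simp
    also have "mat_diag n f *\<^sub>v unit_vec n i = f i \<cdot>\<^sub>v unit_vec n i"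
      using i by (intro eq_vecI) (auto simp: mat_diag_def)
    also have "S *\<^sub>v \<dots> = f i \<cdot>\<^sub>v u"
      unfolding u_def by (rule mult_mat_vec_smult_dim) (simp add: Sdims)
    finally have Hu: "H *\<^sub>v u = f i \<cdot>\<^sub>v u" .
    have Yu: "Y *\<^sub>v u \<in> carrier_vec n"
      unfolding carrier_vec_def using dims by simp
    have "complex_of_real ((l2_norm_vec (Y *\<^sub>v u))\<^sup>2) = u \<bullet>c (mat_adjoint Y *\<^sub>v (Y *\<^sub>v u))"
      unfolding cscalar_prod_self[symmetric] by (rule adjoint_cscalar_prod[OF Y u Yu])
    also have "mat_adjoint Y *\<^sub>v (Y *\<^sub>v u) = H *\<^sub>v u"
      unfolding H_def by (rule assoc_mult_mat_vec_dim[symmetric]) (simp_all add: dims carrier_vecD[OF u])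
    also have "u \<bullet>c (H *\<^sub>v u) = cnj (f i) * (u \<bullet>c u)"
      unfolding Hu using u by (simp add: conjugate_smult_vec)
    also have "\<dots> = cnj (f i)"
      unfolding cscalar_prod_self lu by simp
    finally have "f i = complex_of_real ((l2_norm_vec (Y *\<^sub>v u))\<^sup>2)"
      by (metis complex_cnj_cnj complex_cnj_complex_of_real)
    moreover have "l2_norm_vec (Y *\<^sub>v u) \<noteq> 0"
    proof
      assume "l2_norm_vec (Y *\<^sub>v u) = 0"
      then have Y0: "X *\<^sub>v u + ?t \<cdot>\<^sub>v u = 0\<^sub>v n"
        using l2_norm_vec_eq_0[OF Yu] Yv[OF u] by simp
      have "X *\<^sub>v u = (- ?t) \<cdot>\<^sub>v u"
      proof (rule eq_vecI)
        fix j assume "j < dim_vec ((- ?t) \<cdot>\<^sub>v u)"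
        then show "(X *\<^sub>v u) $ j = ((- ?t) \<cdot>\<^sub>v u) $ j"
          using arg_cong[OF Y0, of "\<lambda>w. w $ j"] u dims
          by (simp add: eq_neg_iff_add_eq_0 del: index_mult_mat_vec)
      qed (use dims u in simp)
      moreover have "u \<noteq> 0\<^sub>v n"
        using lu by auto
      ultimately have "eigenvalue X (- ?t)"
        unfolding eigenvalue_def eigenvector_def using u dims by (intro exI[of _ u]) simp
      with t show False
        by simp
    qed
    ultimately show ?thesis
      by (intro exI[of _ "(l2_norm_vec (Y *\<^sub>v u))\<^sup>2"]) simp
  qed
  then obtain l where l: "\<And>i. i < n \<Longrightarrow> l i > 0" "\<And>i. i < n \<Longrightarrow> f i = complex_of_real (l i)"
    by metis
  have diag_cong: "mat_diag n g = mat_diag n h" if "\<And>i. i < n \<Longrightarrow> g i = h i" for g h :: "nat \<Rightarrow> complex"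
    using that by (intro eq_matI) (auto simp: mat_diag_def)
  \<comment> \<open>The root acts on the eigenvalue and not on its index, which makes
    \<open>R\<close> a function of \<open>H\<close> as \<open>spectral_commute_comp\<close>
    requires.\<close>
  define root where "root z = complex_of_real (sqrt (Re z))" for z :: complex
  define R where "R = S * mat_diag n (\<lambda>i. 1 / root (f i)) * mat_adjoint S"
  define P where "P = S * mat_diag n (\<lambda>i. root (f i)) * mat_adjoint S"
  have Rc: "R \<in> carrier_mat n n" and Pc: "P \<in> carrier_mat n n"
    unfolding R_def P_def by (rule spectral_carrier[OF S])+
  note dims = dims carrier_matD[OF Rc] carrier_matD[OF Pc] carrier_matD[OF Hc]
  have Ra: "mat_adjoint R = R"
    unfolding R_def spectral_adjoint[OF S] by (simp add: root_def)
  have root: "root (f i) * root (f i) = f i" "root (f i) \<noteq> 0" if "i < n" for i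
    using l[OF that] by (simp_all add: root_def flip: of_real_mult)
  have RP: "R * P = 1\<^sub>m n"
  proof -
    have "mat_diag n (\<lambda>i. 1 / root (f i) * root (f i)) = mat_diag n (\<lambda>_. 1)"
      using root by (intro diag_cong) simp
    then show ?thesis
      unfolding R_def P_def spectral_mult[OF S] by (simp only: spectral_one[OF S])
  qed
  have RHR: "R * (H * R) = 1\<^sub>m n"
  proof -
    have "R * (H * R) = S * mat_diag n (\<lambda>i. 1 / root (f i) * (f i * (1 / root (f i)))) * mat_adjoint S"
      unfolding R_def HS spectral_mult[OF S] ..
    also have "mat_diag n (\<lambda>i. 1 / root (f i) * (f i * (1 / root (f i)))) = mat_diag n (\<lambda>_. 1)"
    proof (rule diag_cong)
      have "1 / r * (x * (1 / r)) = 1" if "r * r = x" "r \<noteq> 0" for r x :: complex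
        using that by (auto simp: field_simps)
      then show "1 / root (f i) * (f i * (1 / root (f i))) = 1" if "i < n" for i
        using root[OF that] by blast
    qed
    finally show ?thesis
      by (simp only: spectral_one[OF S])
  qed
  define Q where "Q = Y * R"
  have Qc: "Q \<in> carrier_mat n n"
    unfolding Q_def by (simp only: mat_dims dims)
  have Q: "Q \<in> unitaries n"
  proof (rule unitariesI[OF Qc])
    have "mat_adjoint Q * Q = mat_adjoint R * (mat_adjoint Y * Y * R)"
      unfolding Q_def by (simp only: mat_normalize dims)
    then show "mat_adjoint Q * Q = 1\<^sub>m n"
      using RHR unfolding Ra H_def[symmetric] by simp
  qed
  have BR: "B * R = R * B"
    unfolding R_def by (rule spectral_commute_comp[OF S Bc]) (use BH HS in simp)
  have BQ: "B * Q = Q * B"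
  proof -
    have "B * (Y * R) = (B * Y) * R"
      by (simp only: mat_normalize dims)
    also have "\<dots> = Y * (B * R)"
      unfolding BY by (simp only: mat_normalize dims)
    finally show ?thesis
      unfolding Q_def BR by (simp only: mat_normalize dims)
  qed
  have QP: "Q * P = Y"
  proof -
    have "Q * P = Y * (R * P)"
      unfolding Q_def by (simp only: mat_normalize dims)
    then show ?thesis
      using RP Y by simp
  qed
  have "l2_norm_vec (Q *\<^sub>v v - X *\<^sub>v v)
      \<le> l2_norm_vec (v - mat_adjoint X *\<^sub>v (X *\<^sub>v v)) + \<tau> * l2_norm_vec v"
    if v: "v \<in> carrier_vec n" for v
  proof -
    note dims = dims carrier_vecD[OF v] carrier_matD[OF Qc]
    have cv: "X *\<^sub>v w \<in> carrier_vec n" "Y *\<^sub>v w \<in> carrier_vec n" "Q *\<^sub>v w \<in> carrier_vec n"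
      "P *\<^sub>v w \<in> carrier_vec n" "mat_adjoint X *\<^sub>v w \<in> carrier_vec n" "H *\<^sub>v w \<in> carrier_vec n" for w
      unfolding carrier_vec_def using dims by simp_all
    \<comment> \<open>As \<open>Q P = Y\<close> with \<open>Q\<close> unitary, \<open>Q v\<close> is
      as far from \<open>Y v\<close> as \<open>v\<close> is from \<open>P v\<close>. The inequality
      |1 - sqrt l| <= |1 - l| for l > 0 then replaces the square root \<open>P\<close> by
      \<open>H\<close>.\<close>
    have "Q *\<^sub>v v - Y *\<^sub>v v = Q *\<^sub>v (v - P *\<^sub>v v)"
      unfolding QP[symmetric]
      by (subst mult_minus_distrib_mat_vec[OF Qc v cv(4)])
        (simp only: assoc_mult_mat_vec_dim dims)
    moreover have "l2_norm_vec (Q *\<^sub>v (v - P *\<^sub>v v)) = l2_norm_vec (v - P *\<^sub>v v)"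
      by (rule l2_norm_unitary[OF Q minus_carrier_vec[OF v cv(4)]])
    ultimately have "l2_norm_vec (Q *\<^sub>v v - Y *\<^sub>v v) = l2_norm_vec (v - P *\<^sub>v v)"
      by simp
    also have "\<dots> \<le> l2_norm_vec (v - H *\<^sub>v v)"
      unfolding P_def HS l2_norm_spectral_diff[OF S v]
    proof (intro real_sqrt_le_mono sum_mono power_mono mult_right_mono)
      fix i assume "i \<in> {..<n}"
      then have i: "l i > 0" "f i = complex_of_real (l i)"
        using l by auto
      have "\<bar>1 - sqrt (l i)\<bar> \<le> \<bar>1 - sqrt (l i)\<bar> * (1 + sqrt (l i))"
        using mult_left_mono[of 1 "1 + sqrt (l i)" "\<bar>1 - sqrt (l i)\<bar>"] i by simp
      also have "\<dots> = \<bar>(1 - sqrt (l i)) * (1 + sqrt (l i))\<bar>"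
        using i by (simp add: abs_mult)
      also have "(1 - sqrt (l i)) * (1 + sqrt (l i)) = 1 - l i"
        using i by (simp add: algebra_simps)
      finally have "\<bar>1 - sqrt (l i)\<bar> \<le> \<bar>1 - l i\<bar>" .
      moreover have "1 - root (f i) = complex_of_real (1 - sqrt (l i))" "1 - f i = complex_of_real (1 - l i)"
        unfolding i root_def by simp_all
      ultimately show "cmod (1 - root (f i)) \<le> cmod (1 - f i)"
        by (simp only: norm_of_real)
    qed simp_all
    finally have 1: "l2_norm_vec (Q *\<^sub>v v - Y *\<^sub>v v) \<le> l2_norm_vec (v - H *\<^sub>v v)" .
    have Ya: "mat_adjoint Y = mat_adjoint X + ?t \<cdot>\<^sub>m 1\<^sub>m n"
      unfolding Y_def by (simp only: adjoint_add[OF X smult_carrier_mat[OF one_carrier_mat]] adjoint_smult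
          adjoint_one complex_cnj_complex_of_real)
    have Yav: "mat_adjoint Y *\<^sub>v w = mat_adjoint X *\<^sub>v w + ?t \<cdot>\<^sub>v w"
      if w: "w \<in> carrier_vec n" for w
    proof -
      have "mat_adjoint Y *\<^sub>v w = mat_adjoint X *\<^sub>v w + (?t \<cdot>\<^sub>m 1\<^sub>m n) *\<^sub>v w"
        unfolding Ya
        by (rule add_mult_distrib_mat_vec[OF iffD2[OF adjoint_carrier X] smult_carrier_mat[OF one_carrier_mat] w])
      also have "(?t \<cdot>\<^sub>m 1\<^sub>m n) *\<^sub>v w = ?t \<cdot>\<^sub>v w"
        by (rule smult_one_mult_mat_vec[OF w])
      finally show ?thesis .
    qed
    define a where "a = mat_adjoint X *\<^sub>v (X *\<^sub>v v)"
    define b where "b = mat_adjoint X *\<^sub>v v"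
    define c where "c = X *\<^sub>v v"
    have abc: "a \<in> carrier_vec n" "b \<in> carrier_vec n" "c \<in> carrier_vec n"
      unfolding a_def b_def c_def by (rule cv)+
    have "H *\<^sub>v v = mat_adjoint Y *\<^sub>v (c + ?t \<cdot>\<^sub>v v)"
      unfolding H_def c_def Yv[OF v, symmetric] by (rule assoc_mult_mat_vec_dim) (simp_all add: dims)
    also have "\<dots> = mat_adjoint X *\<^sub>v (c + ?t \<cdot>\<^sub>v v) + ?t \<cdot>\<^sub>v (c + ?t \<cdot>\<^sub>v v)"
      using abc v by (intro Yav) simp
    also have "mat_adjoint X *\<^sub>v (c + ?t \<cdot>\<^sub>v v) = a + ?t \<cdot>\<^sub>v b"
      unfolding a_def b_def c_def using X v cv
      by (subst mult_add_distrib_mat_vec[of _ n n]) (simp_all add: mult_mat_vec_smult_dim dims)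
    finally have Hv: "H *\<^sub>v v = a + ?t \<cdot>\<^sub>v b + ?t \<cdot>\<^sub>v (c + ?t \<cdot>\<^sub>v v)" .
    have eq1: "v - H *\<^sub>v v = (v - a) + (- ?t) \<cdot>\<^sub>v (b + (c + ?t \<cdot>\<^sub>v v))"
      unfolding Hv using abc v by (intro eq_vecI) (simp_all add: algebra_simps)
    have "l2_norm_vec (v - H *\<^sub>v v) \<le> l2_norm_vec (v - a)
        + l2_norm_vec ((- ?t) \<cdot>\<^sub>v (b + (c + ?t \<cdot>\<^sub>v v)))"
      unfolding eq1 by (rule l2_norm_vec_triangle[of _ n]) (use abc v in simp_all)
    also have "l2_norm_vec ((- ?t) \<cdot>\<^sub>v (b + (c + ?t \<cdot>\<^sub>v v)))
        = t * l2_norm_vec (b + (c + ?t \<cdot>\<^sub>v v))"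
      unfolding l2_norm_vec_smult using t by simp
    also have "l2_norm_vec (b + (c + ?t \<cdot>\<^sub>v v)) \<le> l2_norm_vec b + l2_norm_vec (c + ?t \<cdot>\<^sub>v v)"
      by (rule l2_norm_vec_triangle[of _ n]) (use abc v in simp_all)
    also have "l2_norm_vec (c + ?t \<cdot>\<^sub>v v) \<le> l2_norm_vec c + l2_norm_vec (?t \<cdot>\<^sub>v v)"
      by (rule l2_norm_vec_triangle[of _ n]) (use abc v in simp_all)
    also have "l2_norm_vec (?t \<cdot>\<^sub>v v) = t * l2_norm_vec v"
      unfolding l2_norm_vec_smult using t by simp
    finally have 2: "l2_norm_vec (v - H *\<^sub>v v)
        \<le> l2_norm_vec (v - a) + t * (l2_norm_vec b + (l2_norm_vec c + t * l2_norm_vec v))"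
      using t by simp
    have b1: "l2_norm_vec b \<le> l2_norm_vec v"
      unfolding b_def using l2_norm_le_op_norm[OF iffD2[OF adjoint_carrier X] v]
        mult_right_mono[OF X1 l2_norm_vec_nonneg[of v]] unfolding op_norm_adjoint by linarith
    have c1: "l2_norm_vec c \<le> l2_norm_vec v"
      unfolding c_def using l2_norm_le_op_norm[OF X v]
        mult_right_mono[OF X1 l2_norm_vec_nonneg[of v]] by linarith
    have tv: "t * l2_norm_vec v \<le> l2_norm_vec v"
      using t by (simp add: mult_left_le_one_le)
    \<comment> \<open>Expanding the shifted product leaves three terms of size at most
      \<open>t\<close> times the norm of \<open>v\<close>; returning from \<open>Y\<close> to
      \<open>X\<close> adds the fourth.\<close>
    have "t * (l2_norm_vec b + (l2_norm_vec c + t * l2_norm_vec v)) \<le> t * (3 * l2_norm_vec v)"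
      using b1 c1 tv t by (intro mult_left_mono) auto
    with 2 have 3: "l2_norm_vec (v - H *\<^sub>v v) \<le> l2_norm_vec (v - a) + t * (3 * l2_norm_vec v)"
      by simp
    have eq2: "Q *\<^sub>v v - X *\<^sub>v v = (Q *\<^sub>v v - Y *\<^sub>v v) + ?t \<cdot>\<^sub>v v"
    proof -
      have "p - q = (p - (q + r)) + r" if "p \<in> carrier_vec n" "q \<in> carrier_vec n" "r \<in> carrier_vec n"
        for p q r :: "complex vec"
        using that by (intro eq_vecI) simp_all
      from this[OF cv(3) cv(1) smult_carrier_vec[THEN iffD2, OF v]] show ?thesis
        unfolding Yv[OF v] .
    qed
    have "l2_norm_vec (Q *\<^sub>v v - X *\<^sub>v v) \<le> l2_norm_vec (Q *\<^sub>v v - Y *\<^sub>v v) + l2_norm_vec (?t \<cdot>\<^sub>v v)"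
      unfolding eq2 by (rule l2_norm_vec_triangle[of _ n]) (use cv v in simp_all)
    also have "\<dots> \<le> l2_norm_vec (v - a) + t * (3 * l2_norm_vec v) + t * l2_norm_vec v"
      using 1 3 t by (simp add: l2_norm_vec_smult)
    also have "\<dots> = l2_norm_vec (v - a) + (4 * t) * l2_norm_vec v"
      by simp
    also have "\<dots> \<le> l2_norm_vec (v - a) + \<tau> * l2_norm_vec v"
      using t by (intro add_left_mono mult_right_mono) auto
    finally show ?thesis
      unfolding a_def .
  qed
  with Q BQ show ?thesis
    by blast
qed

section \<open>Almost commutation and continuous functional calculus\<close>

text \<open>The commutator of \<open>f\<close> of a diagonal matrix with \<open>U\<close>. The
  entrywise form reduces sum and product rules to scalar identities.\<close>

definition comm_mat :: "nat \<Rightarrow> (nat \<Rightarrow> complex) \<Rightarrow> (complex \<Rightarrow> complex) \<Rightarrow> complex mat \<Rightarrow> complex mat" where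
  "comm_mat d D f U = mat d d (\<lambda>(i,j). (f (D i) - f (D j)) * U $$ (i,j))"

lemma comm_mat_carrier [simp]: "comm_mat d D f U \<in> carrier_mat d d"
  by (simp add: comm_mat_def)

lemma comm_mat_altdef:
  assumes "U \<in> carrier_mat d d"
  shows "comm_mat d D f U = mat_diag d (\<lambda>i. f (D i)) * U - U * mat_diag d (\<lambda>i. f (D i))"
  unfolding mat_diag_mult_left[OF assms] mat_diag_mult_right[OF assms] comm_mat_def
  by (intro eq_matI) (simp_all add: algebra_simps)

lemma op_norm_mat_diag_le:
  assumes c: "c \<ge> 0" and le: "\<And>i. i < n \<Longrightarrow> cmod (f i) \<le> c"
  shows "op_norm (mat_diag n f) \<le> c"
proof (rule op_norm_leI[OF mat_diag_dim c])
  fix v :: "complex vec" assume v: "v \<in> carrier_vec n"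
  have "mat_diag n f *\<^sub>v v = vec n (\<lambda>i. f i * v $ i)"
    using v by (intro eq_vecI) (auto simp: mat_diag_def scalar_prod_def if_distrib[of "\<lambda>x. x * _"] cong: if_cong)
  then have "l2_norm_vec (mat_diag n f *\<^sub>v v) = L2_set (\<lambda>i. cmod (f i) * cmod (v $ i)) {..<n}"
    by (simp add: l2_norm_vec_L2_set norm_mult L2_set_def)
  also have "\<dots> \<le> L2_set (\<lambda>i. c * cmod (v $ i)) {..<n}"
    using le by (intro L2_set_mono mult_right_mono) auto
  also have "\<dots> = c * l2_norm_vec v"
    using v c by (simp add: l2_norm_vec_L2_set L2_set_right_distrib)
  finally show "l2_norm_vec (mat_diag n f *\<^sub>v v) \<le> c * l2_norm_vec v" .
qed

text \<open>The quantifier over \<open>d\<close> is the point: one \<delta> serves matrices of every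
  size.\<close>

definition commutator_bound :: "(complex \<Rightarrow> complex) \<Rightarrow> real \<Rightarrow> real \<Rightarrow> bool" where
  "commutator_bound f \<delta> \<epsilon> \<longleftrightarrow> (\<forall>d U D. U \<in> carrier_mat d d \<longrightarrow> op_norm U \<le> 1 \<longrightarrow> (\<forall>i<d. cmod (D i) = 1) \<longrightarrow>
     op_norm (comm_mat d D (\<lambda>z. z) U) \<le> \<delta> \<longrightarrow> op_norm (comm_mat d D f U) \<le> \<epsilon>)"

lemma commutator_boundD:
  assumes "commutator_bound f \<delta> \<epsilon>" "U \<in> carrier_mat d d" "op_norm U \<le> 1" "\<forall>i<d. cmod (D i) = 1"
    "op_norm (comm_mat d D (\<lambda>z. z) U) \<le> \<delta>"
  shows "op_norm (comm_mat d D f U) \<le> \<epsilon>"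
  using assms unfolding commutator_bound_def by blast

text \<open>A class of functions closed under sums and products. Continuity is included because it
  bounds \<open>f\<close> on the circle, as the product rule demands.\<close>

definition asymp_commuting :: "(complex \<Rightarrow> complex) \<Rightarrow> bool" where
  "asymp_commuting f \<longleftrightarrow> continuous_on (sphere 0 1) f \<and>
    (\<forall>\<epsilon>>0. \<exists>\<delta>>0. commutator_bound f \<delta> \<epsilon>)"

lemma asymp_commutingE:
  assumes "asymp_commuting f" "\<epsilon> > 0"
  obtains \<delta> where "\<delta> > 0"
    "commutator_bound f \<delta> \<epsilon>"
  using assms unfolding asymp_commuting_def by blast

lemma asymp_commutingI:
  assumes "continuous_on (sphere 0 1) f"
    "\<And>\<epsilon>. \<epsilon> > 0 \<Longrightarrow> \<exists>\<delta>>0. commutator_bound f \<delta> \<epsilon>"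
  shows "asymp_commuting f"
  using assms unfolding asymp_commuting_def by blast

lemma asymp_commuting_bounded:
  assumes "asymp_commuting f"
  obtains M where "M > 0" "\<And>z. cmod z = 1 \<Longrightarrow> cmod (f z) \<le> M"
proof -
  have "bounded (f ` sphere 0 1)"
    using assms unfolding asymp_commuting_def
    by (intro compact_imp_bounded compact_continuous_image) auto
  then show thesis
    using that unfolding bounded_pos by auto
qed

lemma asymp_commuting_id: "asymp_commuting (\<lambda>z. z)"
  by (intro asymp_commutingI continuous_on_id) (auto simp: commutator_bound_def)

lemma asymp_commuting_const: "asymp_commuting (\<lambda>_. c)"
proof (intro asymp_commutingI continuous_on_const)
  fix \<epsilon> :: real assume e: "\<epsilon> > 0"
  have "op_norm (comm_mat d D (\<lambda>_. c) U) \<le> \<epsilon>" for d D U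
  proof -
    have "comm_mat d D (\<lambda>_. c) U = mat_diag d (\<lambda>_. 0)"
      by (intro eq_matI) (auto simp: comm_mat_def mat_diag_def)
    then show ?thesis
      using op_norm_mat_diag_le[of \<epsilon> d "\<lambda>_. 0"] e by simp
  qed
  with e show "\<exists>\<delta>>0. commutator_bound (\<lambda>_. c) \<delta> \<epsilon>"
    unfolding commutator_bound_def by blast
qed

text \<open>On the unit circle conjugation is inversion, and the commutator with an inverse is minus
  the commutator multiplied by the inverse on both sides. Hence \<delta> = \<epsilon> works.\<close>

lemma asymp_commuting_cnj: "asymp_commuting cnj"
proof (intro asymp_commutingI continuous_intros)
  fix \<epsilon> :: real assume e: "\<epsilon> > 0"
  have "op_norm (comm_mat d D cnj U) \<le> \<epsilon>"
    if D: "\<forall>i<d. cmod (D i) = 1" and le: "op_norm (comm_mat d D (\<lambda>z. z) U) \<le> \<epsilon>" for d D U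
  proof -
    let ?C = "comm_mat d D (\<lambda>z. z) U" and ?E = "mat_diag d (\<lambda>i. - cnj (D i))"
    and ?E' = "mat_diag d (\<lambda>i. cnj (D i))"
    have EC: "?E * ?C \<in> carrier_mat d d"
      by (rule mult_carrier_mat[OF mat_diag_dim comm_mat_carrier])
    have "comm_mat d D cnj U = ?E * ?C * ?E'"
      unfolding mat_diag_mult_right[OF EC] unfolding mat_diag_mult_left[OF comm_mat_carrier]
    proof (rule eq_matI)
      have *: "cnj z - cnj w = - cnj z * (z - w) * cnj w" if "cmod z = 1" "cmod w = 1" for z w
        using that complex_norm_square[of z] complex_norm_square[of w] by (simp add: algebra_simps)
      fix i j
      assume "i < dim_row (mat d d (\<lambda>(i,j). mat d d (\<lambda>(i,j). - cnj (D i) * ?C $$ (i,j)) $$ (i,j) * cnj (D j)))"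
        "j < dim_col (mat d d (\<lambda>(i,j). mat d d (\<lambda>(i,j). - cnj (D i) * ?C $$ (i,j)) $$ (i,j) * cnj (D j)))"
      then show "comm_mat d D cnj U $$ (i,j)
          = mat d d (\<lambda>(i,j). mat d d (\<lambda>(i,j). - cnj (D i) * ?C $$ (i,j)) $$ (i,j) * cnj (D j)) $$ (i,j)"
        using *[of "D i" "D j"] D by (simp add: comm_mat_def)
    qed (simp_all add: comm_mat_def)
    then have "op_norm (comm_mat d D cnj U) \<le> op_norm (?E * ?C) * op_norm ?E'"
      using op_norm_mult[OF EC mat_diag_dim] by simp
    also have "\<dots> \<le> op_norm (?E * ?C) * 1"
      using D by (intro mult_left_mono op_norm_mat_diag_le) auto
    also have "op_norm (?E * ?C) * 1 \<le> op_norm ?E * op_norm ?C"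
      using op_norm_mult[OF mat_diag_dim comm_mat_carrier] by simp
    also have "\<dots> \<le> 1 * op_norm ?C"
      using D by (intro mult_right_mono op_norm_mat_diag_le) auto
    finally show ?thesis
      using le by simp
  qed
  with e show "\<exists>\<delta>>0. commutator_bound cnj \<delta> \<epsilon>"
    unfolding commutator_bound_def by blast
qed

lemma asymp_commuting_add:
  assumes f: "asymp_commuting f" and g: "asymp_commuting g"
  shows "asymp_commuting (\<lambda>z. f z + g z)"
proof (rule asymp_commutingI)
  show "continuous_on (sphere 0 1) (\<lambda>z. f z + g z)"
    using f g unfolding asymp_commuting_def by (intro continuous_intros) auto
  fix \<epsilon> :: real assume "\<epsilon> > 0"
  then have e: "\<epsilon> / 2 > 0"
    by simp
  obtain \<delta>1 where 1: "\<delta>1 > 0"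
    "commutator_bound f \<delta>1 (\<epsilon> / 2)"
    using asymp_commutingE[OF f e] by blast
  obtain \<delta>2 where 2: "\<delta>2 > 0"
    "commutator_bound g \<delta>2 (\<epsilon> / 2)"
    using asymp_commutingE[OF g e] by blast
  have "op_norm (comm_mat d D (\<lambda>z. f z + g z) U) \<le> \<epsilon>"
    if "U \<in> carrier_mat d d" "op_norm U \<le> 1" "\<forall>i<d. cmod (D i) = 1"
      "op_norm (comm_mat d D (\<lambda>z. z) U) \<le> min \<delta>1 \<delta>2" for d U D
  proof -
    have "comm_mat d D (\<lambda>z. f z + g z) U = comm_mat d D f U + comm_mat d D g U"
      by (intro eq_matI) (simp_all add: comm_mat_def algebra_simps)
    then show ?thesis
      using op_norm_triangle[OF comm_mat_carrier comm_mat_carrier, of d D f U D g U]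
        commutator_boundD[OF 1(2), of U d D] commutator_boundD[OF 2(2), of U d D] that by simp
  qed
  with 1(1) 2(1) show "\<exists>\<delta>>0. commutator_bound (\<lambda>z. f z + g z) \<delta> \<epsilon>"
    unfolding commutator_bound_def by (intro exI[of _ "min \<delta>1 \<delta>2"]) simp
qed

text \<open>Leibniz rule: the commutator of \<open>f g\<close> is \<open>f\<close> times that of
  \<open>g\<close> plus that of \<open>f\<close> times \<open>g\<close>. Compactness of the circle
  bounds the multipliers independently of \<open>d\<close>.\<close>

lemma asymp_commuting_mult:
  assumes f: "asymp_commuting f" and g: "asymp_commuting g"
  shows "asymp_commuting (\<lambda>z. f z * g z)"
proof (rule asymp_commutingI)
  show "continuous_on (sphere 0 1) (\<lambda>z. f z * g z)"
    using f g unfolding asymp_commuting_def by (intro continuous_intros) auto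
  obtain Mf where Mf: "Mf > 0" "\<And>z. cmod z = 1 \<Longrightarrow> cmod (f z) \<le> Mf"
    using asymp_commuting_bounded[OF f] by blast
  obtain Mg where Mg: "Mg > 0" "\<And>z. cmod z = 1 \<Longrightarrow> cmod (g z) \<le> Mg"
    using asymp_commuting_bounded[OF g] by blast
  fix \<epsilon> :: real assume "\<epsilon> > 0"
  then have e: "\<epsilon> / 2 / Mg > 0" "\<epsilon> / 2 / Mf > 0"
    using Mf Mg by simp_all
  obtain \<delta>1 where 1: "\<delta>1 > 0"
    "commutator_bound f \<delta>1 (\<epsilon> / 2 / Mg)"
    using asymp_commutingE[OF f e(1)] by blast
  obtain \<delta>2 where 2: "\<delta>2 > 0"
    "commutator_bound g \<delta>2 (\<epsilon> / 2 / Mf)"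
    using asymp_commutingE[OF g e(2)] by blast
  have "op_norm (comm_mat d D (\<lambda>z. f z * g z) U) \<le> \<epsilon>"
    if U: "U \<in> carrier_mat d d" "op_norm U \<le> 1" "\<forall>i<d. cmod (D i) = 1"
      "op_norm (comm_mat d D (\<lambda>z. z) U) \<le> min \<delta>1 \<delta>2" for d U D
  proof -
    let ?F = "mat_diag d (\<lambda>i. f (D i))" and ?G = "mat_diag d (\<lambda>i. g (D i))"
    let ?cf = "comm_mat d D f U" and ?cg = "comm_mat d D g U"
    have eq: "comm_mat d D (\<lambda>z. f z * g z) U = ?F * ?cg + ?cf * ?G"
      unfolding mat_diag_mult_right[OF comm_mat_carrier] mat_diag_mult_left[OF comm_mat_carrier]
      by (intro eq_matI) (simp_all add: comm_mat_def algebra_simps)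
    have "op_norm (comm_mat d D (\<lambda>z. f z * g z) U) \<le> op_norm (?F * ?cg) + op_norm (?cf * ?G)"
      unfolding eq
      by (rule op_norm_triangle[OF mult_carrier_mat[OF mat_diag_dim comm_mat_carrier]
          mult_carrier_mat[OF comm_mat_carrier mat_diag_dim]])
    also have "\<dots> \<le> op_norm ?F * op_norm ?cg + op_norm ?cf * op_norm ?G"
      by (intro add_mono op_norm_mult[OF mat_diag_dim comm_mat_carrier]
          op_norm_mult[OF comm_mat_carrier mat_diag_dim])
    also have "\<dots> \<le> Mf * (\<epsilon> / 2 / Mf) + (\<epsilon> / 2 / Mg) * Mg"
      using commutator_boundD[OF 1(2), of U d D] commutator_boundD[OF 2(2), of U d D] U Mf Mg \<open>\<epsilon> > 0\<close>
      by (intro add_mono mult_mono op_norm_mat_diag_le) auto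
    also have "\<dots> = \<epsilon>"
      using Mf Mg by simp
    finally show ?thesis .
  qed
  with 1(1) 2(1) show "\<exists>\<delta>>0. commutator_bound (\<lambda>z. f z * g z) \<delta> \<epsilon>"
    unfolding commutator_bound_def by (intro exI[of _ "min \<delta>1 \<delta>2"]) simp
qed

text \<open>A real-linear functional on the plane is a complex combination of \<open>z\<close> and
  \<open>cnj z\<close>, with coefficients read off from its values at 1 and at the imaginary unit;
  closure under sums and products does the rest.\<close>

lemma asymp_commuting_real_polynomial:
  assumes "real_polynomial_function (p :: complex \<Rightarrow> real)"
  shows "asymp_commuting (\<lambda>z. complex_of_real (p z))"
  using assms
proof induction
  case (linear f)
  then have lin: "linear f"
    by (rule bounded_linear.linear)
  have "complex_of_real (f z) = (of_real (f 1) / 2) * (z + cnj z) + (of_real (f \<i>) / (2 * \<i>)) * (z + (- 1) * cnj z)" for z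
  proof -
    have "f z = f (Re z *\<^sub>R 1 + Im z *\<^sub>R \<i>)"
      by (rule arg_cong[of _ _ f]) (simp add: complex_eq_iff)
    also have "\<dots> = Re z * f 1 + Im z * f \<i>"
      by (simp only: linear_add[OF lin] linear_cmul[OF lin] real_scaleR_def)
    finally show ?thesis
      by (simp add: complex_eq_iff)
  qed
  then have "(\<lambda>z. complex_of_real (f z))
    = (\<lambda>z. (of_real (f 1) / 2) * (z + cnj z) + (of_real (f \<i>) / (2 * \<i>)) * (z + (- 1) * cnj z))"
    by (rule ext)
  then show ?case
    by (simp only:)
      (intro asymp_commuting_add asymp_commuting_mult asymp_commuting_const asymp_commuting_id
        asymp_commuting_cnj)
qed (simp_all add: asymp_commuting_const asymp_commuting_add asymp_commuting_mult)

text \<open>Stone-Weierstrass approximates uniformly on the circle, and a diagonal matrix has norm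
  at most the largest modulus of its entries, so the approximation error is the same in every
  dimension.\<close>

theorem asymp_commuting_continuous:
  fixes f :: "complex \<Rightarrow> real"
  assumes f: "continuous_on (sphere 0 1) f"
  shows "asymp_commuting (\<lambda>z. complex_of_real (f z))"
proof (rule asymp_commutingI)
  show "continuous_on (sphere 0 1) (\<lambda>z. complex_of_real (f z))"
    using f by (intro continuous_intros)
  fix \<epsilon> :: real assume e: "\<epsilon> > 0"
  obtain p where p: "real_polynomial_function p" "\<And>z. z \<in> sphere 0 1 \<Longrightarrow> \<bar>f z - p z\<bar> < \<epsilon> / 4"
    using Stone_Weierstrass_real_polynomial_function[OF compact_sphere f, of "\<epsilon> / 4"] e by auto
  obtain \<delta> where \<delta>: "\<delta> > 0"
    "commutator_bound (\<lambda>z. complex_of_real (p z)) \<delta> (\<epsilon> / 2)"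
    using asymp_commutingE[OF asymp_commuting_real_polynomial[OF p(1)], of "\<epsilon> / 2"] e by auto
  have "op_norm (comm_mat d D (\<lambda>z. complex_of_real (f z)) U) \<le> \<epsilon>"
    if U: "U \<in> carrier_mat d d" "op_norm U \<le> 1" "\<forall>i<d. cmod (D i) = 1"
      "op_norm (comm_mat d D (\<lambda>z. z) U) \<le> \<delta>" for d U D
  proof -
    \<comment> \<open>The remainder enters the commutator twice, to the left and to the right of
      \<open>U\<close>; hence \<epsilon> / 4.\<close>
    let ?G = "mat_diag d (\<lambda>i. complex_of_real (f (D i) - p (D i)))"
    have G: "op_norm ?G \<le> \<epsilon> / 4"
    proof (rule op_norm_mat_diag_le)
      show "cmod (complex_of_real (f (D i) - p (D i))) \<le> \<epsilon> / 4" if "i < d" for i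
        unfolding norm_of_real using p(2)[of "D i"] U(3) that by simp
    qed (use e in simp)
    have eq: "comm_mat d D (\<lambda>z. complex_of_real (f z)) U
        = comm_mat d D (\<lambda>z. complex_of_real (p z)) U + comm_mat d D (\<lambda>z. complex_of_real (f z - p z)) U"
      by (intro eq_matI) (simp_all add: comm_mat_def algebra_simps)
    have "op_norm (comm_mat d D (\<lambda>z. complex_of_real (f z - p z)) U) \<le> op_norm (?G * U) + op_norm (U * ?G)"
      unfolding comm_mat_altdef[OF U(1)]
      by (rule op_norm_triangle_minus[OF mult_carrier_mat[OF mat_diag_dim U(1)]
          mult_carrier_mat[OF U(1) mat_diag_dim]])
    also have "\<dots> \<le> op_norm ?G * op_norm U + op_norm U * op_norm ?G"
      by (intro add_mono op_norm_mult[OF mat_diag_dim U(1)] op_norm_mult[OF U(1) mat_diag_dim])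
    also have "\<dots> \<le> (\<epsilon> / 4) * 1 + 1 * (\<epsilon> / 4)"
      using U G e by (intro add_mono mult_mono) auto
    finally have "op_norm (comm_mat d D (\<lambda>z. complex_of_real (f z - p z)) U) \<le> \<epsilon> / 2"
      by simp
    moreover have "op_norm (comm_mat d D (\<lambda>z. complex_of_real (p z)) U) \<le> \<epsilon> / 2"
      using commutator_boundD[OF \<delta>(2)] U by blast
    ultimately show ?thesis
      unfolding eq using op_norm_triangle[OF comm_mat_carrier comm_mat_carrier,
          of d D "\<lambda>z. complex_of_real (p z)" U D "\<lambda>z. complex_of_real (f z - p z)" U] by linarith
  qed
  with \<delta>(1) show "\<exists>\<delta>>0. commutator_bound (\<lambda>z. complex_of_real (f z)) \<delta> \<epsilon>"
    unfolding commutator_bound_def by blast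
qed

section \<open>Dilation along a partition of unity\<close>

text \<open>\<open>e\<close> lists the pairs of an arc \<open>j\<close> and an index
  \<open>i\<close> whose eigenvalue has nonzero weight on it. These pairs index a basis of the
  direct sum of the spectral subspaces; an eigenvector seen by several arcs occurs once for each of
  them.\<close>

locale partition_dilation =
  fixes d m k :: nat and D :: "nat \<Rightarrow> complex" and \<chi> :: "nat \<Rightarrow> complex \<Rightarrow> real"
    and e :: "nat \<Rightarrow> nat \<times> nat"
  assumes partition: "i < d \<Longrightarrow> (\<Sum>j<m. (\<chi> j (D i))\<^sup>2) = 1"
    and e_bij: "bij_betw e {..<k} (SIGMA j:{..<m}. {i. i < d \<and> \<chi> j (D i) \<noteq> 0})"
begin

text \<open>Meaningful only on pairs in the range of \<open>e\<close>, which explains the guards on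
  \<chi> wherever it is applied.\<close>

definition idx :: "nat \<times> nat \<Rightarrow> nat" where
  "idx = the_inv_into {..<k} e"

lemma e_range:
  assumes "a < k"
  shows "fst (e a) < m" "snd (e a) < d" "\<chi> (fst (e a)) (D (snd (e a))) \<noteq> 0"
  using bij_betwE[OF e_bij, rule_format, of a] assms by (cases "e a"; simp)+

lemma idx_e: "a < k \<Longrightarrow> idx (e a) = a"
  unfolding idx_def using e_bij by (intro the_inv_into_f_f) (auto simp: bij_betw_def)

lemma e_idx: "j < m \<Longrightarrow> i < d \<Longrightarrow> \<chi> j (D i) \<noteq> 0 \<Longrightarrow> e (idx (j,i)) = (j,i)"
  unfolding idx_def by (rule f_the_inv_into_f_bij_betw[OF e_bij]) auto

lemma idx_less: "j < m \<Longrightarrow> i < d \<Longrightarrow> \<chi> j (D i) \<noteq> 0 \<Longrightarrow> idx (j,i) < k"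
  unfolding idx_def using bij_betwE[OF bij_betw_the_inv_into[OF e_bij]] by auto

text \<open>Coordinates of the direct sum are summed over the full rectangle of pairs, absent pairs
  contributing 0, so that the two summations become independent.\<close>

lemma sum_e:
  fixes h :: "nat \<Rightarrow> 'a :: comm_monoid_add"
  shows "(\<Sum>a<k. h a) = (\<Sum>j<m. \<Sum>i<d. if \<chi> j (D i) \<noteq> 0 then h (idx (j,i)) else 0)"
proof -
  have "(\<Sum>a<k. h a) = (\<Sum>a<k. h (idx (e a)))"
    by (intro sum.cong) (simp_all add: idx_e)
  also have "\<dots> = (\<Sum>s\<in>(SIGMA j:{..<m}. {i. i < d \<and> \<chi> j (D i) \<noteq> 0}). h (idx s))"
    by (rule sum.reindex_bij_betw[OF e_bij])
  also have "\<dots> = (\<Sum>j<m. \<Sum>i | i < d \<and> \<chi> j (D i) \<noteq> 0. h (idx (j,i)))"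
    by (subst sum.Sigma) (auto simp: case_prod_unfold)
  also have "\<dots> = (\<Sum>j<m. \<Sum>i<d. if \<chi> j (D i) \<noteq> 0 then h (idx (j,i)) else 0)"
  proof (rule sum.cong[OF refl])
    fix j
    have "{i. i < d \<and> \<chi> j (D i) \<noteq> 0} = {i \<in> {..<d}. \<chi> j (D i) \<noteq> 0}"
      by auto
    then show "(\<Sum>i | i < d \<and> \<chi> j (D i) \<noteq> 0. h (idx (j,i))) = (\<Sum>i<d. if \<chi> j (D i) \<noteq> 0 then h (idx (j,i)) else 0)"
      by (simp only: sum.inter_filter[OF finite_lessThan])
  qed
  finally show ?thesis .
qed

abbreviation chi_diag :: "nat \<Rightarrow> complex mat" where
  "chi_diag j \<equiv> mat_diag d (\<lambda>i. complex_of_real (\<chi> j (D i)))"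

text \<open>The \<open>j\<close>-th summand, padded with zeros to length \<open>d\<close> so that
  matrices of size \<open>d\<close> act on it.\<close>

definition slice :: "complex vec \<Rightarrow> nat \<Rightarrow> complex vec" where
  "slice v j = vec d (\<lambda>i. if \<chi> j (D i) \<noteq> 0 then v $ idx (j,i) else 0)"

text \<open>Sends \<open>v\<close> to the family of all \<open>chi_diag j\<close> applied to
  \<open>v\<close>; the partition of unity makes it isometric.\<close>

definition W :: "complex mat" where
  "W = mat k d (\<lambda>(a,i). if snd (e a) = i then complex_of_real (\<chi> (fst (e a)) (D i)) else 0)"

text \<open>The direct sum over \<open>j\<close> of the compressions of \<open>M\<close> to the
  spectral subspaces.\<close>

definition block :: "complex mat \<Rightarrow> complex mat" where
  "block M = mat k k (\<lambda>(a,b). if fst (e a) = fst (e b) then M $$ (snd (e a), snd (e b)) else 0)"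

lemma slice_carrier [simp]: "slice v j \<in> carrier_vec d"
  by (simp add: slice_def)

lemma W_carrier [simp]: "W \<in> carrier_mat k d"
  by (simp add: W_def)

lemma block_carrier [simp]: "block M \<in> carrier_mat k k"
  by (simp add: block_def)

lemma W_apply:
  assumes v: "v \<in> carrier_vec d" and a: "a < k"
  shows "(W *\<^sub>v v) $ a = complex_of_real (\<chi> (fst (e a)) (D (snd (e a)))) * v $ snd (e a)"
proof -
  have "(W *\<^sub>v v) $ a = (\<Sum>i<d. (if snd (e a) = i then complex_of_real (\<chi> (fst (e a)) (D i)) else 0) * v $ i)"
    using v a by (simp add: W_def scalar_prod_def atLeast0LessThan)
  also have "\<dots> = (\<Sum>i<d. if i = snd (e a) then complex_of_real (\<chi> (fst (e a)) (D i)) * v $ i else 0)"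
    by (intro sum.cong) auto
  also have "\<dots> = complex_of_real (\<chi> (fst (e a)) (D (snd (e a)))) * v $ snd (e a)"
    using e_range[OF a] by simp
  finally show ?thesis .
qed

lemma block_apply:
  assumes M: "M \<in> carrier_mat d d" and v: "v \<in> carrier_vec k" and a: "a < k"
  shows "(block M *\<^sub>v v) $ a = (M *\<^sub>v slice v (fst (e a))) $ snd (e a)"
proof -
  have "(block M *\<^sub>v v) $ a
      = (\<Sum>b<k. (if fst (e a) = fst (e b) then M $$ (snd (e a), snd (e b)) else 0) * v $ b)"
    using v a by (simp add: block_def scalar_prod_def atLeast0LessThan)
  also have "\<dots> = (\<Sum>j<m. \<Sum>i<d. if j = fst (e a) then
      (if \<chi> j (D i) \<noteq> 0 then M $$ (snd (e a), i) * v $ idx (j,i) else 0) else 0)"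
    unfolding sum_e by (intro sum.cong refl) (auto simp: e_idx)
  also have "\<dots> = (\<Sum>j<m. if j = fst (e a) then
      (\<Sum>i<d. if \<chi> j (D i) \<noteq> 0 then M $$ (snd (e a), i) * v $ idx (j,i) else 0) else 0)"
    by (intro sum.cong refl) auto
  also have "\<dots> = (\<Sum>i<d. if \<chi> (fst (e a)) (D i) \<noteq> 0 then M $$ (snd (e a), i) * v $ idx (fst (e a),i) else 0)"
    using e_range[OF a] by simp
  also have "\<dots> = (M *\<^sub>v slice v (fst (e a))) $ snd (e a)"
    using M e_range[OF a] by (auto simp: slice_def scalar_prod_def atLeast0LessThan intro!: sum.cong)
  finally show ?thesis .
qed

text \<open>The zero padding loses nothing here, because \<chi> vanishes at exactly the padded
  positions.\<close>

lemma slice_W: "v \<in> carrier_vec d \<Longrightarrow> j < m \<Longrightarrow>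
  slice (W *\<^sub>v v) j = chi_diag j *\<^sub>v v"
proof (rule eq_vecI)
  fix i assume v: "v \<in> carrier_vec d" and j: "j < m"
    and "i < dim_vec (chi_diag j *\<^sub>v v)"
  then have i: "i < d"
    by (simp add: mat_diag_def)
  have "(chi_diag j *\<^sub>v v) $ i = complex_of_real (\<chi> j (D i)) * v $ i"
    using v i by (simp add: mat_diag_def scalar_prod_def if_distrib[of "\<lambda>x. x * _"] cong: if_cong)
  then show "slice (W *\<^sub>v v) j $ i = (chi_diag j *\<^sub>v v) $ i"
    using i j v by (simp add: slice_def W_apply idx_less e_idx del: index_mult_mat_vec)
qed (simp add: slice_def mat_diag_def)

text \<open>Only an inequality can hold: \<open>z j\<close> may have entries outside the
  \<open>j\<close>-th spectral subspace, which no coordinate of \<open>y\<close> sees.\<close>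

lemma l2_norm_le_slices:
  assumes y: "y \<in> carrier_vec k" and z: "\<And>j. j < m \<Longrightarrow> z j \<in> carrier_vec d"
    and yz: "\<And>a. a < k \<Longrightarrow> cmod (y $ a) \<le> cmod (z (fst (e a)) $ snd (e a))"
  shows "(l2_norm_vec y)\<^sup>2 \<le> (\<Sum>j<m. (l2_norm_vec (z j))\<^sup>2)"
proof -
  have "(l2_norm_vec y)\<^sup>2 \<le> (\<Sum>a<k. (cmod (z (fst (e a)) $ snd (e a)))\<^sup>2)"
    unfolding l2_norm_vec_power2 using y yz by (auto intro!: sum_mono power_mono)
  also have "\<dots> \<le> (\<Sum>j<m. \<Sum>i<d. (cmod (z j $ i))\<^sup>2)"
    unfolding sum_e by (intro sum_mono) (auto simp: e_idx)
  also have "\<dots> = (\<Sum>j<m. (l2_norm_vec (z j))\<^sup>2)"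
    unfolding l2_norm_vec_power2 by (intro sum.cong refl) (simp_all add: carrier_vecD[OF z])
  finally show ?thesis .
qed

lemma l2_norm_slices:
  assumes v: "v \<in> carrier_vec k"
  shows "(\<Sum>j<m. (l2_norm_vec (slice v j))\<^sup>2) = (l2_norm_vec v)\<^sup>2"
proof -
  have "(l2_norm_vec v)\<^sup>2 = (\<Sum>a<k. (cmod (v $ a))\<^sup>2)"
    unfolding l2_norm_vec_power2 using v by simp
  also have "\<dots> = (\<Sum>j<m. (l2_norm_vec (slice v j))\<^sup>2)"
    unfolding sum_e l2_norm_vec_power2 by (intro sum.cong refl) (auto simp: slice_def)
  finally show ?thesis ..
qed

lemma sum_chi_power2:
  assumes v: "v \<in> carrier_vec d"
  shows "(\<Sum>j<m. (l2_norm_vec (chi_diag j *\<^sub>v v))\<^sup>2) = (l2_norm_vec v)\<^sup>2"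
proof -
  have "(\<Sum>j<m. (l2_norm_vec (chi_diag j *\<^sub>v v))\<^sup>2)
      = (\<Sum>j<m. \<Sum>i<d. (\<chi> j (D i))\<^sup>2 * (cmod (v $ i))\<^sup>2)"
  proof (intro sum.cong refl)
    fix j
    have "chi_diag j *\<^sub>v v = vec d (\<lambda>i. complex_of_real (\<chi> j (D i)) * v $ i)"
      using v by (intro eq_vecI) (auto simp: mat_diag_def scalar_prod_def if_distrib[of "\<lambda>x. x * _"] cong: if_cong)
    then show "(l2_norm_vec (chi_diag j *\<^sub>v v))\<^sup>2
        = (\<Sum>i<d. (\<chi> j (D i))\<^sup>2 * (cmod (v $ i))\<^sup>2)"
      by (simp add: l2_norm_vec_power2 norm_mult power_mult_distrib)
  qed
  also have "\<dots> = (\<Sum>i<d. (\<Sum>j<m. (\<chi> j (D i))\<^sup>2) * (cmod (v $ i))\<^sup>2)"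
    by (subst sum.swap) (simp add: sum_distrib_right)
  also have "\<dots> = (l2_norm_vec v)\<^sup>2"
    unfolding l2_norm_vec_power2 using v partition by simp
  finally show ?thesis .
qed

lemma W_isometry: "W \<in> isometry_mat k d"
proof -
  have "mat_adjoint W * W = 1\<^sub>m d"
  proof (rule eq_matI)
    fix i i' assume "i < dim_row (1\<^sub>m d :: complex mat)" "i' < dim_col (1\<^sub>m d :: complex mat)"
    then have i: "i < d" "i' < d"
      by auto
    have "(mat_adjoint W * W) $$ (i,i') = (\<Sum>a<k. cnj (W $$ (a,i)) * W $$ (a,i'))"
      using i by (simp add: W_def scalar_prod_def atLeast0LessThan)
    also have "\<dots> = (\<Sum>a<k. if snd (e a) = i \<and> i = i' then complex_of_real ((\<chi> (fst (e a)) (D i))\<^sup>2) else 0)"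
      using i by (intro sum.cong refl) (auto simp: W_def power2_eq_square)
    also have "\<dots> = (\<Sum>j<m. \<Sum>i''<d. if i'' = i then (if i = i' then complex_of_real ((\<chi> j (D i))\<^sup>2) else 0) else 0)"
      unfolding sum_e by (intro sum.cong refl) (auto simp: e_idx)
    also have "\<dots> = (\<Sum>j<m. if i = i' then complex_of_real ((\<chi> j (D i))\<^sup>2) else 0)"
      using i by simp
    also have "\<dots> = (if i = i' then complex_of_real (\<Sum>j<m. (\<chi> j (D i))\<^sup>2) else 0)"
      by simp
    also have "\<dots> = 1\<^sub>m d $$ (i,i')"
      using i partition[OF i(1)] partition[OF i(2)] by (simp del: of_real_sum)
    finally show "(mat_adjoint W * W) $$ (i,i') = 1\<^sub>m d $$ (i,i')" .
  qed (simp_all add: W_def)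
  then show ?thesis
    by (simp add: isometry_mat_def)
qed

lemma l2_norm_W: "v \<in> carrier_vec d \<Longrightarrow> l2_norm_vec (W *\<^sub>v v) = l2_norm_vec v"
  by (rule l2_norm_isometry[OF W_carrier]) (use W_isometry in \<open>simp_all add: isometry_mat_def\<close>)

lemma block_adjoint: "M \<in> carrier_mat d d \<Longrightarrow> mat_adjoint (block M) = block (mat_adjoint M)"
  by (intro eq_matI) (auto simp: block_def e_range)

lemma op_norm_block_le:
  assumes M: "M \<in> carrier_mat d d" "op_norm M \<le> 1"
  shows "op_norm (block M) \<le> 1"
proof (rule op_norm_leI[OF block_carrier])
  fix v :: "complex vec" assume v: "v \<in> carrier_vec k"
  have "(l2_norm_vec (block M *\<^sub>v v))\<^sup>2 \<le> (\<Sum>j<m. (l2_norm_vec (M *\<^sub>v slice v j))\<^sup>2)"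
    by (rule l2_norm_le_slices)
      (simp_all only: block_apply[OF M(1) v] mult_mat_vec_carrier[OF M(1) slice_carrier]
        mult_mat_vec_carrier[OF block_carrier v] order_refl)
  also have "\<dots> \<le> (\<Sum>j<m. (l2_norm_vec (slice v j))\<^sup>2)"
  proof (intro sum_mono power_mono l2_norm_vec_nonneg)
    show "l2_norm_vec (M *\<^sub>v slice v j) \<le> l2_norm_vec (slice v j)" for j
      using l2_norm_le_op_norm[OF M(1) slice_carrier, of v j]
        mult_right_mono[OF M(2) l2_norm_vec_nonneg[of "slice v j"]] by linarith
  qed
  also have "\<dots> = (l2_norm_vec v)\<^sup>2"
    by (rule l2_norm_slices[OF v])
  finally show "l2_norm_vec (block M *\<^sub>v v) \<le> 1 * l2_norm_vec v"
    unfolding mult_1_left by (rule power2_le_imp_le) (rule l2_norm_vec_nonneg)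
qed simp

text \<open>Since \<open>chi_diag j\<close> maps into the \<open>j\<close>-th subspace, compressing
  on that side costs nothing. The \<open>j\<close>-th component of the difference is thus a
  truncation of minus the commutator of \<open>chi_diag j\<close> with \<open>M\<close>, applied to
  \<open>v\<close>; adding \<open>m\<close> squares gives the factor sqrt m.\<close>

lemma block_intertwine:
  assumes M: "M \<in> carrier_mat d d" and v: "v \<in> carrier_vec d" and \<eta>: "\<eta> \<ge> 0"
    and comm: "\<And>j. j < m \<Longrightarrow> op_norm (comm_mat d D (\<lambda>z. complex_of_real (\<chi> j z)) M) \<le> \<eta>"
  shows "l2_norm_vec (block M *\<^sub>v (W *\<^sub>v v) - W *\<^sub>v (M *\<^sub>v v)) \<le> sqrt m * \<eta> * l2_norm_vec v"
proof -
  let ?C = "\<lambda>j. comm_mat d D (\<lambda>z. complex_of_real (\<chi> j z)) M"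
  have Wv: "W *\<^sub>v v \<in> carrier_vec k" and Mv: "M *\<^sub>v v \<in> carrier_vec d"
    by (rule mult_mat_vec_carrier[OF W_carrier v] mult_mat_vec_carrier[OF M v])+
  have WMv: "W *\<^sub>v (M *\<^sub>v v) \<in> carrier_vec k" and BWv: "block M *\<^sub>v (W *\<^sub>v v) \<in> carrier_vec k"
    by (rule mult_mat_vec_carrier[OF W_carrier Mv] mult_mat_vec_carrier[OF block_carrier Wv])+
  have Cv: "?C j *\<^sub>v v = chi_diag j *\<^sub>v (M *\<^sub>v v)
      - M *\<^sub>v (chi_diag j *\<^sub>v v)" for j
  proof -
    let ?E = "chi_diag j"
    have "?C j *\<^sub>v v = (?E * M) *\<^sub>v v - (M * ?E) *\<^sub>v v"
      unfolding comm_mat_altdef[OF M]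
      by (rule minus_mult_distrib_mat_vec[OF mult_carrier_mat[OF mat_diag_dim M] mult_carrier_mat[OF M mat_diag_dim] v])
    then show ?thesis
      by (simp only: assoc_mult_mat_vec[OF mat_diag_dim M v] assoc_mult_mat_vec[OF M mat_diag_dim v])
  qed
  have "(l2_norm_vec (block M *\<^sub>v (W *\<^sub>v v) - W *\<^sub>v (M *\<^sub>v v)))\<^sup>2 \<le> (\<Sum>j<m. (l2_norm_vec (?C j *\<^sub>v v))\<^sup>2)"
  proof (rule l2_norm_le_slices)
    show "block M *\<^sub>v (W *\<^sub>v v) - W *\<^sub>v (M *\<^sub>v v) \<in> carrier_vec k"
      by (rule minus_carrier_vec[OF BWv WMv])
    show "?C j *\<^sub>v v \<in> carrier_vec d" for j
      by (rule mult_mat_vec_carrier[OF comm_mat_carrier v])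
    fix a assume a: "a < k"
    note er = e_range[OF a]
    let ?j = "fst (e a)" and ?i = "snd (e a)"
    let ?E = "mat_diag d (\<lambda>i. complex_of_real (\<chi> ?j (D i)))"
    have "(block M *\<^sub>v (W *\<^sub>v v) - W *\<^sub>v (M *\<^sub>v v)) $ a
        = (M *\<^sub>v (?E *\<^sub>v v)) $ ?i - complex_of_real (\<chi> ?j (D ?i)) * (M *\<^sub>v v) $ ?i"
      using a carrier_vecD[OF WMv]
      by (simp only: index_minus_vec block_apply[OF M Wv a] slice_W[OF v er(1)] W_apply[OF Mv a])
    also have "complex_of_real (\<chi> ?j (D ?i)) * (M *\<^sub>v v) $ ?i = (?E *\<^sub>v (M *\<^sub>v v)) $ ?i"
      using er carrier_vecD[OF Mv] by (simp add: mat_diag_def scalar_prod_def if_distrib[of "\<lambda>x. x * _"]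
        del: index_mult_mat_vec cong: if_cong)
        (simp add: mat_diag_def scalar_prod_def if_distrib[of "\<lambda>x. x * _"] cong: if_cong)
    also have "(M *\<^sub>v (?E *\<^sub>v v)) $ ?i - (?E *\<^sub>v (M *\<^sub>v v)) $ ?i = - ((?C ?j *\<^sub>v v) $ ?i)"
      unfolding Cv using er M by (simp del: index_mult_mat_vec)
    finally show "cmod ((block M *\<^sub>v (W *\<^sub>v v) - W *\<^sub>v (M *\<^sub>v v)) $ a) \<le> cmod ((?C ?j *\<^sub>v v) $ ?i)"
      by (simp del: index_mult_mat_vec)
  qed
  also have "\<dots> \<le> (\<Sum>j<m. (\<eta> * l2_norm_vec v)\<^sup>2)"
  proof (intro sum_mono power_mono l2_norm_vec_nonneg)
    fix j assume "j \<in> {..<m}"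
    then show "l2_norm_vec (?C j *\<^sub>v v) \<le> \<eta> * l2_norm_vec v"
      using l2_norm_le_op_norm[OF comm_mat_carrier v, of D "\<lambda>z. complex_of_real (\<chi> j z)" M]
        mult_right_mono[OF comm[of j] l2_norm_vec_nonneg[of v]] by auto
  qed
  also have "\<dots> = (sqrt m * \<eta> * l2_norm_vec v)\<^sup>2"
    by (simp add: power_mult_distrib)
  finally show ?thesis
    by (rule power2_le_imp_le) (use \<eta> in simp)
qed

text \<open>\<open>B\<close> is the scalar \<open>c j\<close> on the \<open>j\<close>-th summand and
  so commutes exactly with \<open>block U\<close>; \<open>A\<close> approximates
  \<open>block U\<close> as its perturbed polar part and inherits the commutation.\<close>

theorem commuting_unitary_dilation:
  assumes U: "U \<in> unitaries d" and \<epsilon>: "\<epsilon> \<ge> 0" and \<eta>: "\<eta> > 0"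
    and c: "\<And>j. j < m \<Longrightarrow> cmod (c j) = 1"
    and close: "\<And>j i. j < m \<Longrightarrow> i < d \<Longrightarrow> \<chi> j (D i) \<noteq> 0 \<Longrightarrow> cmod (c j - D i) \<le> \<epsilon>"
    and comm: "\<And>j. j < m \<Longrightarrow> op_norm (comm_mat d D (\<lambda>z. complex_of_real (\<chi> j z)) U) \<le> \<eta>"
  shows "\<exists>A\<in>unitaries k. \<exists>B\<in>unitaries k. A * B = B * A \<and>
    op_norm (A * W - W * U) \<le> (3 * sqrt m + 1) * \<eta> \<and> op_norm (B * W - W * mat_diag d D) \<le> \<epsilon>"
proof -
  note Uc = unitaries_carrier[OF U]
  define B where "B = mat_diag k (\<lambda>a. c (fst (e a)))"
  have cc: "cnj (c (fst (e a))) * c (fst (e a)) = 1" if "a < k" for a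
    using c[OF e_range(1)[OF that]] complex_norm_square[of "c (fst (e a))"] by (simp add: mult.commute)
  have B: "B \<in> unitaries k"
  proof (rule unitariesI)
    show "mat_adjoint B * B = 1\<^sub>m k"
      unfolding B_def adjoint_mat_diag mat_diag_diag using cc
      by (intro eq_matI) (auto simp: mat_diag_def)
  qed (simp add: B_def)
  have BX: "B * block U = block U * B"
    unfolding B_def mat_diag_mult_left[OF block_carrier] mat_diag_mult_right[OF block_carrier]
    by (intro eq_matI) (auto simp: block_def)
  obtain A where A: "A \<in> unitaries k" and BA: "B * A = A * B"
    and near: "\<And>v. v \<in> carrier_vec k \<Longrightarrow> l2_norm_vec (A *\<^sub>v v - block U *\<^sub>v v)
       \<le> l2_norm_vec (v - mat_adjoint (block U) *\<^sub>v (block U *\<^sub>v v)) + \<eta> * l2_norm_vec v"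
    using exists_commuting_polar_part[OF block_carrier op_norm_block_le[OF Uc op_norm_unitary_le[OF U]] B BX \<eta>]
    by blast
  have Ac: "A \<in> carrier_mat k k" and Bc: "B \<in> carrier_mat k k" and Uac: "mat_adjoint U \<in> carrier_mat d d"
    using A B U by (simp_all add: unitaries_iff)
  \<comment> \<open>The functions \<chi> are real, so the commutator with the adjoint of
    \<open>U\<close> is minus the adjoint of the commutator with \<open>U\<close>.\<close>
  have comm': "op_norm (comm_mat d D (\<lambda>z. complex_of_real (\<chi> j z)) (mat_adjoint U)) \<le> \<eta>" if j: "j < m" for j
  proof -
    have "comm_mat d D (\<lambda>z. complex_of_real (\<chi> j z)) (mat_adjoint U)
        = - mat_adjoint (comm_mat d D (\<lambda>z. complex_of_real (\<chi> j z)) U)"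
      using Uc by (intro eq_matI) (simp_all add: comm_mat_def algebra_simps)
    then show ?thesis
      using comm[OF j] by (simp only: op_norm_uminus op_norm_adjoint)
  qed
  \<comment> \<open>One sqrt m is the defect between \<open>block U\<close> and \<open>U\<close>.
    Two more bound how far \<open>block U\<close> is from isometric at \<open>W v\<close>, estimated
    by going forth with \<open>U\<close> and back with its adjoint. The summand 1 is the tolerance
    of the polar part.\<close>
  have "op_norm (A * W - W * U) \<le> (3 * sqrt m + 1) * \<eta>"
  proof (rule op_norm_leI)
    show "A * W - W * U \<in> carrier_mat k d"
      by (rule minus_carrier_mat[OF mult_carrier_mat[OF W_carrier Uc]])
    show "0 \<le> (3 * sqrt m + 1) * \<eta>"
      using \<eta> by simp
    fix v :: "complex vec" assume v: "v \<in> carrier_vec d"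
    define w where "w = W *\<^sub>v v"
    define u where "u = U *\<^sub>v v"
    define x where "x = block U *\<^sub>v w"
    define y where "y = W *\<^sub>v u"
    define z where "z = block (mat_adjoint U) *\<^sub>v y"
    define p where "p = block (mat_adjoint U) *\<^sub>v x"
    define q where "q = A *\<^sub>v w"
    have car: "w \<in> carrier_vec k" "u \<in> carrier_vec d" "x \<in> carrier_vec k" "y \<in> carrier_vec k"
      "z \<in> carrier_vec k" "p \<in> carrier_vec k" "q \<in> carrier_vec k"
      unfolding w_def u_def x_def y_def z_def p_def q_def
      by (intro mult_mat_vec_carrier[OF W_carrier] mult_mat_vec_carrier[OF block_carrier]
          mult_mat_vec_carrier[OF Uc] mult_mat_vec_carrier[OF Ac] v)+
    have wv: "l2_norm_vec w = l2_norm_vec v" and uv: "l2_norm_vec u = l2_norm_vec v"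
      unfolding w_def u_def by (rule l2_norm_W[OF v] l2_norm_unitary[OF U v])+
    have xy: "l2_norm_vec (x - y) \<le> sqrt m * \<eta> * l2_norm_vec v"
      unfolding x_def y_def w_def u_def using \<eta> by (intro block_intertwine[OF Uc v _ comm]) auto
    have "mat_adjoint U *\<^sub>v u = v"
    proof -
      have "mat_adjoint U *\<^sub>v u = (mat_adjoint U * U) *\<^sub>v v"
        unfolding u_def by (rule assoc_mult_mat_vec[OF Uac Uc v, symmetric])
      then show ?thesis
        using U v by (simp add: unitaries_iff)
    qed
    then have zw: "l2_norm_vec (z - w) \<le> sqrt m * \<eta> * l2_norm_vec v"
      using block_intertwine[OF Uac car(2) _ comm'] \<eta> unfolding z_def y_def w_def uv by simp
    have pz: "l2_norm_vec (p - z) \<le> l2_norm_vec (x - y)"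
    proof -
      have xyc: "x - y \<in> carrier_vec k"
        by (rule minus_carrier_vec[OF car(3,4)])
      have "p - z = block (mat_adjoint U) *\<^sub>v (x - y)"
        unfolding p_def z_def by (rule mult_minus_distrib_mat_vec[OF block_carrier car(3,4), symmetric])
      moreover have "op_norm (block (mat_adjoint U)) \<le> 1"
        by (rule op_norm_block_le[OF Uac op_norm_unitary_le[OF unitaries_adjoint[OF U]]])
      ultimately show ?thesis
        using l2_norm_le_op_norm[OF block_carrier xyc, of "mat_adjoint U"]
          mult_right_mono[of "op_norm (block (mat_adjoint U))" 1 "l2_norm_vec (x - y)"] by simp
    qed
    have eq: "w - p = - ((p - z) + (z - w))" "q - y = (q - x) + (x - y)"
      using car by (intro eq_vecI; simp)+
    have uminus: "l2_norm_vec (- r) = l2_norm_vec r" for r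
      by (simp add: l2_norm_vec_def)
    have pw: "l2_norm_vec (w - p) \<le> l2_norm_vec (p - z) + l2_norm_vec (z - w)"
      unfolding eq(1) uminus by (rule l2_norm_vec_triangle[of _ k]) (use car in simp_all)
    have qx: "l2_norm_vec (q - x) \<le> l2_norm_vec (w - p) + \<eta> * l2_norm_vec v"
      using near[OF car(1)] unfolding wv block_adjoint[OF Uc] q_def x_def p_def .
    have "(A * W - W * U) *\<^sub>v v = q - y"
    proof -
      have "(A * W - W * U) *\<^sub>v v = (A * W) *\<^sub>v v - (W * U) *\<^sub>v v"
        by (rule minus_mult_distrib_mat_vec[OF mult_carrier_mat[OF Ac W_carrier] mult_carrier_mat[OF W_carrier Uc] v])
      then show ?thesis
        by (simp only: assoc_mult_mat_vec[OF Ac W_carrier v] assoc_mult_mat_vec[OF W_carrier Uc v]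
            q_def y_def u_def w_def)
    qed
    moreover have "l2_norm_vec (q - y) \<le> l2_norm_vec (q - x) + l2_norm_vec (x - y)"
      unfolding eq(2) by (rule l2_norm_vec_triangle[of _ k]) (use car in simp_all)
    ultimately show "l2_norm_vec ((A * W - W * U) *\<^sub>v v) \<le> (3 * sqrt m + 1) * \<eta> * l2_norm_vec v"
      using qx pw pz zw xy by (simp add: algebra_simps)
  qed
  moreover have "op_norm (B * W - W * mat_diag d D) \<le> \<epsilon>"
  proof (rule op_norm_leI)
    show "B * W - W * mat_diag d D \<in> carrier_mat k d"
      by (rule minus_carrier_mat[OF mult_carrier_mat[OF W_carrier mat_diag_dim]])
    show "0 \<le> \<epsilon>"
      by fact
    fix v :: "complex vec" assume v: "v \<in> carrier_vec d"
    let ?E = "\<lambda>j. chi_diag j"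
    \<comment> \<open>The error only replaces eigenvalues by \<open>c j\<close> inside the weighted
      sum. As the squared weights add up to 1, no factor depending on \<open>m\<close>
      arises.\<close>
    have eq: "B * W - W * mat_diag d D
        = mat k d (\<lambda>(a,i). if snd (e a) = i then (c (fst (e a)) - D i) * complex_of_real (\<chi> (fst (e a)) (D i)) else 0)"
      unfolding B_def mat_diag_mult_left[OF W_carrier] mat_diag_mult_right[OF W_carrier]
      by (intro eq_matI) (auto simp: W_def algebra_simps)
    have Ev: "?E j *\<^sub>v v = vec d (\<lambda>i. complex_of_real (\<chi> j (D i)) * v $ i)" for j
      using v by (intro eq_vecI) (auto simp: mat_diag_def scalar_prod_def if_distrib[of "\<lambda>x. x * _"] cong: if_cong)
    have "(l2_norm_vec ((B * W - W * mat_diag d D) *\<^sub>v v))\<^sup>2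
        \<le> (\<Sum>j<m. (l2_norm_vec (complex_of_real \<epsilon> \<cdot>\<^sub>v (?E j *\<^sub>v v)))\<^sup>2)"
    proof (rule l2_norm_le_slices)
      show "(B * W - W * mat_diag d D) *\<^sub>v v \<in> carrier_vec k"
        unfolding eq by (rule mult_mat_vec_carrier[OF mat_carrier v])
      show "complex_of_real \<epsilon> \<cdot>\<^sub>v (?E j *\<^sub>v v) \<in> carrier_vec d" for j
        unfolding Ev by simp
      fix a assume a: "a < k"
      let ?j = "fst (e a)" and ?i = "snd (e a)"
      note er = e_range[OF a]
      have "((B * W - W * mat_diag d D) *\<^sub>v v) $ a
          = (\<Sum>i<d. (if ?i = i then (c ?j - D i) * complex_of_real (\<chi> ?j (D i)) else 0) * v $ i)"
        unfolding eq using v a by (simp add: scalar_prod_def atLeast0LessThan)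
      also have "\<dots> = (\<Sum>i<d. if i = ?i then (c ?j - D i) * complex_of_real (\<chi> ?j (D i)) * v $ i else 0)"
        by (intro sum.cong) auto
      also have "\<dots> = (c ?j - D ?i) * (complex_of_real (\<chi> ?j (D ?i)) * v $ ?i)"
        using er by simp
      finally show "cmod (((B * W - W * mat_diag d D) *\<^sub>v v) $ a)
          \<le> cmod ((complex_of_real \<epsilon> \<cdot>\<^sub>v (?E ?j *\<^sub>v v)) $ ?i)"
        using close[OF er] er \<epsilon> unfolding Ev
        by (simp add: norm_mult mult_right_mono del: index_mult_mat_vec)
    qed
    also have "\<dots> = \<epsilon>\<^sup>2 * (\<Sum>j<m. (l2_norm_vec (?E j *\<^sub>v v))\<^sup>2)"
      unfolding l2_norm_vec_smult by (simp add: power_mult_distrib sum_distrib_left)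
    also have "\<dots> = (\<epsilon> * l2_norm_vec v)\<^sup>2"
      unfolding sum_chi_power2[OF v] by (simp add: power_mult_distrib)
    finally show "l2_norm_vec ((B * W - W * mat_diag d D) *\<^sub>v v) \<le> \<epsilon> * l2_norm_vec v"
      by (rule power2_le_imp_le) (use \<epsilon> in simp)
  qed
  ultimately show ?thesis
    using A B BA by metis
qed

end

section \<open>Arcs on the circle\<close>

lemma near_multiple_2pi:
  fixes x :: real
  obtains l :: int where "\<bar>x - 2 * pi * of_int l\<bar> \<le> pi"
proof -
  define l where "l = round (x / (2 * pi))"
  have "\<bar>of_int l - x / (2 * pi)\<bar> \<le> 1 / 2"
    unfolding l_def by (rule of_int_round_abs_le)
  then have "\<bar>of_int l - x / (2 * pi)\<bar> * (2 * pi) \<le> 1 / 2 * (2 * pi)"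
    by (intro mult_right_mono) auto
  also have "\<bar>of_int l - x / (2 * pi)\<bar> * (2 * pi) = \<bar>(of_int l - x / (2 * pi)) * (2 * pi)\<bar>"
    by (simp add: abs_mult)
  also have "(of_int l - x / (2 * pi)) * (2 * pi) = - (x - 2 * pi * of_int l)"
    by (simp add: field_simps)
  finally show thesis
    by (intro that[of l]) simp
qed

lemma cos_periodic_int: "cos (x - 2 * pi * of_int l) = cos x"
  unfolding cos_diff cos_int_2pin sin_int_2pin by simp

text \<open>Translates the arc condition, which is stated by a cosine and so avoids a choice of
  angle, back to angles modulo 2 pi; cosine decreases between 0 and pi.\<close>

lemma cos_greater_imp_near:
  assumes "cos x > cos r" "0 \<le> r" "r \<le> pi"
  obtains l :: int where "\<bar>x - 2 * pi * of_int l\<bar> < r"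
proof -
  obtain l :: int where l: "\<bar>x - 2 * pi * of_int l\<bar> \<le> pi"
    using near_multiple_2pi by blast
  have "\<bar>x - 2 * pi * of_int l\<bar> < r"
  proof (rule ccontr)
    assume "\<not> ?thesis"
    then have "cos \<bar>x - 2 * pi * of_int l\<bar> \<le> cos r"
      using l assms by (intro cos_monotone_0_pi_le) auto
    then show False
      using assms(1) by (simp add: cos_periodic_int)
  qed
  then show thesis
    by (rule that)
qed

text \<open>Openness matters: a closed interval of this length can contain one integer more.\<close>

lemma card_int_open_interval_le:
  fixes y :: real
  shows "card {u :: int. y < of_int u \<and> of_int u < y + real (Suc n)} \<le> Suc n"
proof -
  have "{u :: int. y < of_int u \<and> of_int u < y + real (Suc n)} \<subseteq> {\<lfloor>y\<rfloor> + 1..\<lfloor>y\<rfloor> + 1 + int n}"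
  proof
    fix u :: int assume "u \<in> {u. y < of_int u \<and> of_int u < y + real (Suc n)}"
    then have u: "y < of_int u" "of_int u < y + real (Suc n)"
      by auto
    have "\<lfloor>y\<rfloor> < u"
      using u(1) by (simp add: floor_less_iff)
    moreover have "real_of_int u < real_of_int (\<lfloor>y\<rfloor> + 1 + int n + 1)"
    proof -
      have "real_of_int (\<lfloor>y\<rfloor> + 1 + int n + 1) = real_of_int \<lfloor>y\<rfloor> + 1 + real (Suc n)"
        by simp
      then show ?thesis
        using u(2) real_of_int_floor_add_one_gt[of y] by linarith
    qed
    then have "u < \<lfloor>y\<rfloor> + 1 + int n + 1"
      by (simp only: of_int_less_iff)
    ultimately show "u \<in> {\<lfloor>y\<rfloor> + 1..\<lfloor>y\<rfloor> + 1 + int n}"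
      by simp
  qed
  from card_mono[OF _ this] show ?thesis
    by simp
qed

text \<open>Double counting of the pairs \<open>(t,i)\<close>.\<close>

lemma sum_card_swap:
  "(\<Sum>t<(n :: nat). card {i. i < (d :: nat) \<and> P t i}) = (\<Sum>i<d. card {t. t < n \<and> P t i})"
proof -
  have card: "card {i. i < b \<and> Q i} = (\<Sum>i<b. if Q i then 1 else 0)" for b :: nat and Q
  proof -
    have "{i. i < b \<and> Q i} = {i \<in> {..<b}. Q i}"
      by auto
    then show ?thesis
      by (simp add: sum.inter_filter[symmetric])
  qed
  show ?thesis
    unfolding card by (rule sum.swap)
qed

text \<open>The arc \<open>t\<close> is centred at the \<open>t\<close>-th of \<open>m * N\<close> equidistant points; its half-width is
  \<open>(N + 1) / 2\<close> steps. The arcs \<open>j * N + s\<close> with \<open>j < m\<close> cover the circle for every fixed \<open>s < N\<close>, while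
  a point lies in at most \<open>N + 1\<close> of all arcs, that is, in \<open>(N + 1) / N\<close> arcs of an average cover.\<close>

locale arcs =
  fixes m N :: nat
  assumes m: "m \<ge> 3" and N: "N \<ge> 1"
begin

definition step :: real where "step = 2 * pi / (real m * real N)"

definition radius :: real where "radius = step * (real N + 1) / 2"

definition centre :: "nat \<Rightarrow> complex" where "centre t = cis (step * real t)"

text \<open>On the circle the real part is the cosine of the angular distance to the centre, so this
  is positive exactly on the open arc. The formula is continuous and needs no choice of
  argument.\<close>

definition bump :: "nat \<Rightarrow> complex \<Rightarrow> real" where
  "bump t z = max 0 (Re (z * cnj (centre t)) - cos radius)"

lemma step_pos: "step > 0"
  using m N by (simp add: step_def)

lemma step_mN: "step * (real m * real N) = 2 * pi"
  using m N by (simp add: step_def)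

lemma norm_centre [simp]: "cmod (centre t) = 1"
  by (simp add: centre_def)

lemma radius_bounds: "0 < radius" "radius \<le> pi" "step * real N / 2 < radius" "radius \<le> 2 * pi / real m"
proof -
  show "0 < radius" "step * real N / 2 < radius"
    using step_pos by (simp_all add: radius_def field_simps add_pos_nonneg)
  have "radius \<le> step * (real N + real N) / 2"
    unfolding radius_def using step_pos N by (intro divide_right_mono mult_left_mono) auto
  also have "\<dots> = 2 * pi / real m"
    using m N by (simp add: step_def field_simps)
  finally show "radius \<le> 2 * pi / real m" .
  also have "2 * pi / real m \<le> 2 * pi / 3"
    using m by (intro divide_left_mono) auto
  also have "\<dots> \<le> pi"
    by simp
  finally show "radius \<le> pi" .
qed

lemma bump_nonneg: "bump t z \<ge> 0"
  by (simp add: bump_def)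

lemma bump_cis: "bump t (cis a) = max 0 (cos (a - step * real t) - cos radius)"
  by (simp add: bump_def centre_def cis_cnj cis_mult)

lemma continuous_bump: "continuous_on A (bump t)"
  unfolding bump_def by (intro continuous_intros)

text \<open>The squared chord is 2 minus twice the cosine of the angle, and a chord is at most as
  long as its arc.\<close>

lemma bump_pos_close:
  assumes z: "cmod z = 1" and pos: "bump t z > 0"
  shows "cmod (centre t - z) \<le> radius"
proof -
  have "(cmod (centre t - z))\<^sup>2 = (Re (centre t) - Re z)\<^sup>2 + (Im (centre t) - Im z)\<^sup>2"
    by (simp add: cmod_power2)
  also have "\<dots> = 2 - 2 * Re (z * cnj (centre t))"
    using z norm_centre[of t] cmod_power2[of z] cmod_power2[of "centre t"]
    by (simp add: power2_eq_square algebra_simps)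
  also have "\<dots> \<le> 2 - 2 * cos radius"
    using pos by (simp add: bump_def)
  also have "cos radius = 1 - 2 * (sin (radius / 2))\<^sup>2"
    using cos_double_sin[of "radius / 2"] by simp
  also have "2 - 2 * (1 - 2 * (sin (radius / 2))\<^sup>2) = (2 * \<bar>sin (radius / 2)\<bar>)\<^sup>2"
    by (simp add: power_mult_distrib)
  also have "\<dots> \<le> radius\<^sup>2"
  proof (rule power_mono)
    show "2 * \<bar>sin (radius / 2)\<bar> \<le> radius"
      using abs_sin_x_le_abs_x[of "radius / 2"] radius_bounds(1) by linarith
  qed simp
  finally show ?thesis
    by (rule power2_le_imp_le) (rule less_imp_le[OF radius_bounds(1)])
qed

text \<open>The centres with indices \<open>j * N + s\<close> are \<open>N\<close> steps apart, so
  the nearest one is within N / 2 steps, which is less than \<open>radius\<close>.\<close>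

lemma bump_cover:
  assumes z: "cmod z = 1"
  shows "\<exists>j<m. bump (j * N + s) z > 0"
proof -
  obtain a where a: "z = cis a"
    using complex_norm_eq_1_exp z by (metis cis_conv_exp)
  \<comment> \<open>Rounding picks the nearest centre on the line that covers the circle; reduction
    modulo \<open>m\<close> brings its index back, a full turn being \<open>m * N\<close>
    steps.\<close>
  define j' where "j' = round ((a / step - real s) / real N)"
  define j where "j = nat (j' mod int m)"
  have j: "j < m" "int j = j' mod int m"
    using m by (simp_all add: j_def nat_less_iff)
  have "\<bar>of_int j' - (a / step - real s) / real N\<bar> \<le> 1 / 2"
    unfolding j'_def by (rule of_int_round_abs_le)
  then have "\<bar>of_int j' - (a / step - real s) / real N\<bar> * (step * real N) \<le> 1 / 2 * (step * real N)"
    using step_pos by (intro mult_right_mono) auto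
  also have "\<bar>of_int j' - (a / step - real s) / real N\<bar> * (step * real N)
      = \<bar>(of_int j' - (a / step - real s) / real N) * (step * real N)\<bar>"
    using step_pos by (simp add: abs_mult)
  also have "(of_int j' - (a / step - real s) / real N) * (step * real N)
      = - (a - step * (of_int j' * real N + real s))"
    using step_pos N by (simp add: field_simps)
  finally have near: "\<bar>a - step * (of_int j' * real N + real s)\<bar> \<le> step * real N / 2"
    unfolding abs_minus_cancel by simp
  have "int m * (j' div int m) + int j = j'"
    unfolding j(2) by simp
  then have "real_of_int j' = real m * real_of_int (j' div int m) + real j"
    by (metis of_int_add of_int_mult of_int_of_nat_eq)
  then have "a - step * (of_int j' * real N + real s)
      = a - step * real (j * N + s) - (step * (real m * real N)) * of_int (j' div int m)"
    by (simp add: algebra_simps)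
  also have "\<dots> = a - step * real (j * N + s) - 2 * pi * of_int (j' div int m)"
    unfolding step_mN ..
  finally have "cos (a - step * real (j * N + s)) = cos \<bar>a - step * (of_int j' * real N + real s)\<bar>"
    by (simp only: cos_periodic_int cos_abs_real)
  also have "\<dots> > cos radius"
    using near radius_bounds by (intro cos_monotone_0_pi) auto
  finally have "bump (j * N + s) z > 0"
    unfolding a bump_cis by simp
  with j show ?thesis
    by blast
qed

text \<open>Each arc containing \<open>z\<close> lifts to an integer \<open>u\<close> in an open
  interval of length \<open>N + 1\<close> around the angle of \<open>z\<close>, measured in steps.
  The arc is recovered as the residue of \<open>u\<close> modulo \<open>m * N\<close>.\<close>

lemma card_bump_le:
  assumes z: "cmod z = 1"
  shows "card {t. t < m * N \<and> bump t z > 0} \<le> Suc N"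
proof -
  obtain a where a: "z = cis a"
    using complex_norm_eq_1_exp z by (metis cis_conv_exp)
  define y where "y = a / step - (real N + 1) / 2"
  let ?U = "{u :: int. y < of_int u \<and> of_int u < y + real (Suc N)}"
  have "{t. t < m * N \<and> bump t z > 0} \<subseteq> (\<lambda>u. nat (u mod int (m * N))) ` ?U"
  proof
    fix t assume "t \<in> {t. t < m * N \<and> bump t z > 0}"
    then have t: "t < m * N" "cos (a - step * real t) > cos radius"
      unfolding a bump_cis by auto
    obtain l :: int where l: "\<bar>a - step * real t - 2 * pi * of_int l\<bar> < radius"
      using cos_greater_imp_near[OF t(2)] radius_bounds by auto
    define u where "u = int t + int (m * N) * l"
    have "a - step * real t - 2 * pi * of_int l = step * (a / step - of_int u)"
      unfolding step_mN[symmetric] u_def using step_pos by (simp add: algebra_simps)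
    with l have "step * \<bar>a / step - of_int u\<bar> < step * ((real N + 1) / 2)"
      using step_pos by (simp add: radius_def abs_mult)
    then have "\<bar>a / step - of_int u\<bar> < (real N + 1) / 2"
      using step_pos by (simp only: mult_less_cancel_left_pos)
    then have "a / step - of_int u < (real N + 1) / 2" "- (a / step - of_int u) < (real N + 1) / 2"
      by (simp_all only: abs_less_iff)
    then have "u \<in> ?U"
    proof -
      have "q - h / 2 < x \<and> x < q - h / 2 + h" if "q - x < h / 2" "- (q - x) < h / 2" for q h x :: real
        using that by linarith
      from this[OF \<open>a / step - of_int u < _\<close> \<open>- (a / step - of_int u) < _\<close>] show ?thesis
        unfolding y_def mem_Collect_eq of_nat_Suc add.commute[of 1 "real N"] .
    qed
    moreover have "u mod int (m * N) = int t mod int (m * N)"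
      unfolding u_def by (rule mod_mult_self2)
    then have "nat (u mod int (m * N)) = t"
      by (simp only: zmod_int[symmetric] mod_less[OF t(1)] nat_int)
    ultimately show "t \<in> (\<lambda>u. nat (u mod int (m * N))) ` ?U"
      by (intro image_eqI[of _ _ u]) simp_all
  qed
  moreover have fin: "finite ?U"
    by (rule finite_subset[of _ "{\<lfloor>y\<rfloor>..\<lceil>y + real (Suc N)\<rceil>}"])
      (auto intro: less_imp_le simp: floor_le_iff le_ceiling_iff)
  ultimately have "card {t. t < m * N \<and> bump t z > 0} \<le> card ((\<lambda>u. nat (u mod int (m * N))) ` ?U)"
    by (intro card_mono) auto
  also have "\<dots> \<le> card ?U"
    by (rule card_image_le[OF fin])
  also have "\<dots> \<le> Suc N"
    by (rule card_int_open_interval_le)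
  finally show ?thesis .
qed

text \<open>Over all \<open>s\<close> and \<open>j\<close> every arc occurs once, so by double
  counting the \<open>N\<close> totals add up to at most \<open>d * Suc N\<close>, and some shift
  does not exceed the average. The factor \<open>N\<close> avoids division of naturals.\<close>

lemma exists_good_shift:
  assumes D: "\<And>i. i < d \<Longrightarrow> cmod (D i) = 1"
  shows "\<exists>s<N. N * (\<Sum>j<m. card {i. i < d \<and> bump (j * N + s) (D i) > 0}) \<le> d * Suc N"
proof (rule ccontr)
  define K where "K s = (\<Sum>j<m. card {i. i < d \<and> bump (j * N + s) (D i) > 0})" for s
  assume "\<not> ?thesis"
  then have *: "d * Suc N < N * K s" if "s < N" for s
    using that unfolding K_def by (meson not_le)
  have "(\<Sum>s<N. d * Suc N) < (\<Sum>s<N. N * K s)"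
    using * N by (intro sum_strict_mono) (auto simp: lessThan_empty_iff)
  then have "N * (d * Suc N) < N * (\<Sum>s<N. K s)"
    by (simp only: sum_constant card_lessThan sum_distrib_left of_nat_id)
  then have "d * Suc N < (\<Sum>s<N. K s)"
    by (simp only: mult_less_cancel1)
  also have "(\<Sum>s<N. K s) = (\<Sum>j<m. \<Sum>s<N. card {i. i < d \<and> bump (j * N + s) (D i) > 0})"
    unfolding K_def by (rule sum.swap)
  also have "\<dots> = (\<Sum>j<m. \<Sum>t = j * N..<j * N + N. card {i. i < d \<and> bump t (D i) > 0})"
  proof (rule sum.cong[OF refl])
    fix j
    show "(\<Sum>s<N. card {i. i < d \<and> bump (j * N + s) (D i) > 0})
        = (\<Sum>t = j * N..<j * N + N. card {i. i < d \<and> bump t (D i) > 0})"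
      using sum.shift_bounds_nat_ivl[of "\<lambda>t. card {i. i < d \<and> bump t (D i) > 0}" 0 "j * N" N]
      by (simp add: atLeast0LessThan add.commute)
  qed
  also have "\<dots> = (\<Sum>t<m * N. card {i. i < d \<and> bump t (D i) > 0})"
    by (rule sum.nat_group)
  also have "\<dots> = (\<Sum>i<d. card {t. t < m * N \<and> bump t (D i) > 0})"
    by (rule sum_card_swap)
  also have "\<dots> \<le> (\<Sum>i<d. Suc N)"
    using D by (intro sum_mono card_bump_le) auto
  finally show False
    by simp
qed

text \<open>The root is there because the squares of these functions have to sum to 1.\<close>

definition chi :: "nat \<Rightarrow> nat \<Rightarrow> complex \<Rightarrow> real" where
  "chi s j z = sqrt (bump (j * N + s) z / (\<Sum>i<m. bump (i * N + s) z))"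

lemma sum_bump_pos:
  assumes "cmod z = 1"
  shows "(\<Sum>i<m. bump (i * N + s) z) > 0"
proof -
  obtain j where "j < m" "bump (j * N + s) z > 0"
    using bump_cover[OF assms] by blast
  then show ?thesis
    by (intro sum_pos2[of _ j]) (auto simp: bump_nonneg)
qed

lemma chi_partition:
  assumes "cmod z = 1"
  shows "(\<Sum>j<m. (chi s j z)\<^sup>2) = 1"
proof -
  have "(\<Sum>j<m. (chi s j z)\<^sup>2) = (\<Sum>j<m. bump (j * N + s) z / (\<Sum>i<m. bump (i * N + s) z))"
    using sum_bump_pos[OF assms, of s] by (simp add: chi_def bump_nonneg)
  also have "\<dots> = 1"
    using sum_bump_pos[OF assms, of s] by (simp flip: sum_divide_distrib)
  finally show ?thesis .
qed

lemma chi_nonzero_iff: "cmod z = 1 \<Longrightarrow> chi s j z \<noteq> 0 \<longleftrightarrow> bump (j * N + s) z > 0"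
  using sum_bump_pos[of z s] bump_nonneg[of "j * N + s" z] by (auto simp: chi_def)

text \<open>Covering makes the denominator positive on the circle, which is why continuity is
  claimed there only.\<close>

lemma continuous_chi: "continuous_on (sphere 0 1) (chi s j)"
  unfolding chi_def
proof (intro continuous_intros continuous_bump ballI)
  fix z :: complex assume "z \<in> sphere 0 1"
  then show "(\<Sum>i<m. bump (i * N + s) z) \<noteq> 0"
    using sum_bump_pos[of z s] by simp
qed

end

text \<open>Stated by intertwining defects rather than by compressions, since the former pass from
  the generators to all of the group.\<close>

definition near_commuting_compression :: "real \<Rightarrow> nat \<Rightarrow> complex mat \<Rightarrow> complex mat \<Rightarrow> nat \<Rightarrow> bool" where
  "near_commuting_compression \<epsilon> d U V k \<longleftrightarrow> d \<le> k \<and> real k \<le> (1 + \<epsilon>) * real d \<and>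
    (\<exists>W\<in>isometry_mat k d. \<exists>A\<in>unitaries k. \<exists>B\<in>unitaries k. A * B = B * A \<and>
      op_norm (A * W - W * U) \<le> \<epsilon> \<and> op_norm (B * W - W * V) \<le> \<epsilon>)"

text \<open>The good shift depends on the eigenvalues \<open>D\<close>, so \<delta> has to serve
  every \<open>chi s j\<close>. There are finitely many of them, because \<open>N\<close> and
  \<open>m\<close> depend on \<epsilon> alone.\<close>

lemma exists_near_commuting_compression_diag:
  assumes \<epsilon>: "\<epsilon> > 0"
  shows "\<exists>\<delta>>0. \<forall>d U D. U \<in> unitaries d \<longrightarrow> (\<forall>i<d. cmod (D i) = 1) \<longrightarrow>
    op_norm (comm_mat d D (\<lambda>z. z) U) \<le> \<delta> \<longrightarrow> (\<exists>k. near_commuting_compression \<epsilon> d U (mat_diag d D) k)"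
proof -
  \<comment> \<open>\<open>N\<close> brings the dimension overhead 1 / N below \<epsilon>, and
    \<open>m0\<close> does the same for the half-width of the arcs.\<close>
  obtain N :: nat where N0: "1 / \<epsilon> < real N"
    using reals_Archimedean2 by blast
  obtain m0 :: nat where m0: "2 * pi / \<epsilon> < real m0"
    using reals_Archimedean2 by blast
  define m where "m = max 3 m0"
  have "real N > 0"
    using N0 \<epsilon> by (intro less_trans[OF _ N0]) simp
  then have N: "N \<ge> 1"
    by simp
  interpret arcs m N
    by unfold_locales (use N in \<open>simp_all add: m_def\<close>)
  have rad: "radius \<le> \<epsilon>"
  proof -
    have "2 * pi / \<epsilon> < real m"
      using m0 by (simp add: m_def)
    then have "2 * pi / real m \<le> \<epsilon>"
      using \<epsilon> m by (simp add: field_simps)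
    then show ?thesis
      using radius_bounds(4) by linarith
  qed
  \<comment> \<open>Absorbs the constant of \<open>commuting_unitary_dilation\<close>.\<close>
  define \<eta> where "\<eta> = \<epsilon> / (3 * sqrt m + 1)"
  have "3 * sqrt (real m) + 1 > 0"
    by (simp add: add_nonneg_pos)
  then have \<eta>: "\<eta> > 0" "(3 * sqrt m + 1) * \<eta> = \<epsilon>"
    using \<epsilon> by (simp_all add: \<eta>_def)
  have "\<exists>\<delta>>0. commutator_bound (\<lambda>z. complex_of_real (chi s j z)) \<delta> \<eta>" for s j
    using asymp_commuting_continuous[OF continuous_chi[of s j]] \<eta>(1) unfolding asymp_commuting_def by blast
  then obtain \<Delta> where \<Delta>: "\<And>s j. \<Delta> s j > 0"
    "\<And>s j. commutator_bound (\<lambda>z. complex_of_real (chi s j z)) (\<Delta> s j) \<eta>"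
    by metis
  define \<delta> where "\<delta> = Min ((\<lambda>(s,j). \<Delta> s j) ` ({..<N} \<times> {..<m}))"
  have ne: "{..<N} \<times> {..<m} \<noteq> {}"
    using N m by (auto simp: lessThan_empty_iff)
  have \<delta>: "\<delta> > 0"
    unfolding \<delta>_def using ne \<Delta>(1) by (subst Min_gr_iff) auto
  have \<delta>_le: "\<delta> \<le> \<Delta> s j" if "s < N" "j < m" for s j
    unfolding \<delta>_def using that by (intro Min_le) auto
  have "\<exists>k. near_commuting_compression \<epsilon> d U (mat_diag d D) k"
    if U: "U \<in> unitaries d" and D: "\<forall>i<d. cmod (D i) = 1" and comm: "op_norm (comm_mat d D (\<lambda>z. z) U) \<le> \<delta>"
    for d U D
  proof -
    obtain s where s: "s < N" "N * (\<Sum>j<m. card {i. i < d \<and> bump (j * N + s) (D i) > 0}) \<le> d * Suc N"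
      using exists_good_shift[of d D] D by blast
    define k where "k = (\<Sum>j<m. card {i. i < d \<and> bump (j * N + s) (D i) > 0})"
    have sets: "{i. i < d \<and> chi s j (D i) \<noteq> 0} = {i. i < d \<and> bump (j * N + s) (D i) > 0}" for j
      using D chi_nonzero_iff by blast
    define Idx where "Idx = (SIGMA j:{..<m}. {i. i < d \<and> chi s j (D i) \<noteq> 0})"
    have "finite Idx" "card Idx = k"
      unfolding Idx_def k_def by (simp_all add: sets)
    then obtain e where e: "bij_betw e {..<k} Idx"
      using ex_bij_betw_nat_finite[of Idx] by (auto simp: atLeast0LessThan)
    interpret partition_dilation d m k D "chi s" e
      by unfold_locales (use D e chi_partition in \<open>auto simp: Idx_def\<close>)
    obtain A B where AB: "A \<in> unitaries k" "B \<in> unitaries k" "A * B = B * A"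
      "op_norm (A * W - W * U) \<le> (3 * sqrt m + 1) * \<eta>" "op_norm (B * W - W * mat_diag d D) \<le> \<epsilon>"
    proof -
      have "\<exists>A\<in>unitaries k. \<exists>B\<in>unitaries k. A * B = B * A \<and>
        op_norm (A * W - W * U) \<le> (3 * sqrt m + 1) * \<eta> \<and> op_norm (B * W - W * mat_diag d D) \<le> \<epsilon>"
      proof (rule commuting_unitary_dilation[OF U less_imp_le[OF \<epsilon>] \<eta>(1), of "\<lambda>j. centre (j * N + s)"])
        fix j i assume "j < m" "i < d" "chi s j (D i) \<noteq> 0"
        then have "bump (j * N + s) (D i) > 0" "cmod (D i) = 1"
          using D chi_nonzero_iff by auto
        then show "cmod (centre (j * N + s) - D i) \<le> \<epsilon>"
          using bump_pos_close[of "D i" "j * N + s"] rad by linarith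
      next
        fix j assume "j < m"
        then show "op_norm (comm_mat d D (\<lambda>z. complex_of_real (chi s j z)) U) \<le> \<eta>"
          by (intro commutator_boundD[OF \<Delta>(2) unitaries_carrier[OF U] op_norm_unitary_le[OF U] D]
              order_trans[OF comm \<delta>_le[OF s(1)]])
      qed simp
      then show thesis
        using that by blast
    qed
    have "d \<le> k"
    proof -
      have "(\<Sum>i<d. 1) \<le> (\<Sum>i<d. card {j. j < m \<and> bump (j * N + s) (D i) > 0})"
      proof (rule sum_mono)
        fix i assume "i \<in> {..<d}"
        then obtain j where "j < m" "bump (j * N + s) (D i) > 0"
          using bump_cover[of "D i" s] D by auto
        then have "{j} \<subseteq> {j. j < m \<and> bump (j * N + s) (D i) > 0}"
          by auto
        from card_mono[OF _ this] show "1 \<le> card {j. j < m \<and> bump (j * N + s) (D i) > 0}"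
          by simp
      qed
      also have "\<dots> = k"
        unfolding k_def by (rule sum_card_swap[symmetric])
      finally show ?thesis
        by simp
    qed
    moreover have "real k \<le> (1 + \<epsilon>) * real d"
    proof -
      have "real (N * k) \<le> real (d * Suc N)"
        using s(2) unfolding k_def[symmetric] of_nat_le_iff .
      then have "real k \<le> (1 + 1 / real N) * real d"
        using N by (simp add: field_simps)
      also have "\<dots> \<le> (1 + \<epsilon>) * real d"
        using N0 \<epsilon> N by (intro mult_right_mono) (auto simp: field_simps)
      finally show ?thesis .
    qed
    ultimately show ?thesis
      unfolding near_commuting_compression_def using AB \<eta>(2) W_isometry
      by (intro exI[of _ k] conjI bexI[of _ W] bexI[of _ A] bexI[of _ B]) auto
  qed
  with \<delta> show ?thesis
    by blast
qed

text \<open>A unitary that diagonalises \<open>V\<close> reduces this to the diagonal case: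
  conjugation does not increase the commutator norm, and multiplying the isometry by the adjoint of
  that unitary carries the intertwining estimates back.\<close>

theorem exists_near_commuting_compression:
  assumes \<epsilon>: "\<epsilon> > 0"
  shows "\<exists>\<delta>>0. \<forall>d. \<forall>U\<in>unitaries d. \<forall>V\<in>unitaries d. op_norm (U * V - V * U) \<le> \<delta> \<longrightarrow>
    (\<exists>k. near_commuting_compression \<epsilon> d U V k)"
proof -
  obtain \<delta> where \<delta>: "\<delta> > 0" and diag: "\<And>d U D. U \<in> unitaries d \<Longrightarrow> (\<forall>i<d. cmod (D i) = 1) \<Longrightarrow>
    op_norm (comm_mat d D (\<lambda>z. z) U) \<le> \<delta> \<Longrightarrow> \<exists>k. near_commuting_compression \<epsilon> d U (mat_diag d D) k"
    using exists_near_commuting_compression_diag[OF \<epsilon>] by blast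
  have "\<exists>k. near_commuting_compression \<epsilon> d U V k"
    if U: "U \<in> unitaries d" and V: "V \<in> unitaries d" and comm: "op_norm (U * V - V * U) \<le> \<delta>" for d U V
  proof -
    have "mat_adjoint V * V = V * mat_adjoint V"
      using V by (simp add: unitaries_iff)
    then obtain S D where S: "S \<in> unitaries d" and VS: "V = S * mat_diag d D * mat_adjoint S"
      using normal_mat_diagonalizable[OF unitaries_carrier[OF V]] by blast
    define U' where "U' = mat_adjoint S * U * S"
    have U': "U' \<in> unitaries d"
      unfolding U'_def by (intro unitaries_mult unitaries_adjoint S U)
    note dims = carrier_matD[OF unitaries_carrier[OF S]] carrier_matD[OF unitaries_carrier[OF U]]
      carrier_matD[OF unitaries_carrier[OF V]] carrier_matD[OF unitaries_carrier[OF U']]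
      carrier_matD[OF mat_diag_dim]
    have SVS: "mat_adjoint S * V * S = mat_diag d D"
      using unitary_conj_inverse[OF unitaries_adjoint[OF S] mat_diag_dim[of d D]]
      unfolding adjoint_adjoint VS .
    have D: "\<forall>i<d. cmod (D i) = 1"
    proof (intro allI impI)
      fix i assume i: "i < d"
      have "mat_diag d D \<in> unitaries d"
        unfolding SVS[symmetric] by (intro unitaries_mult unitaries_adjoint S V)
      then have "mat_diag d (\<lambda>i. cnj (D i) * D i) = 1\<^sub>m d"
        by (simp add: unitaries_iff adjoint_mat_diag)
      from arg_cong[OF this, of "\<lambda>M. M $$ (i,i)"] have "cnj (D i) * D i = 1"
        using i by (simp add: mat_diag_def)
      then have "complex_of_real ((cmod (D i))\<^sup>2) = 1"
        unfolding complex_norm_square by (simp add: mult.commute)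
      then show "cmod (D i) = 1"
        using norm_ge_zero[of "D i"] unfolding of_real_eq_1_iff power2_eq_1_iff by linarith
    qed
    have "comm_mat d D (\<lambda>z. z) U' = mat_adjoint S * (V * U - U * V) * S"
    proof -
      have "comm_mat d D (\<lambda>z. z) U' = mat_diag d D * U' - U' * mat_diag d D"
        by (rule comm_mat_altdef[OF unitaries_carrier[OF U']])
      also have "\<dots> = mat_adjoint S * (V * U) * S - mat_adjoint S * (U * V) * S"
        unfolding SVS[symmetric] U'_def
        by (simp only: unitary_conj_mult[OF S unitaries_carrier[OF V] unitaries_carrier[OF U]]
            unitary_conj_mult[OF S unitaries_carrier[OF U] unitaries_carrier[OF V]])
      also have "\<dots> = (mat_adjoint S * (V * U) - mat_adjoint S * (U * V)) * S"
        by (rule minus_mult_distrib_mat[symmetric, of _ d d _ _ d])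
          (simp_all only: mat_dims dims)
      also have "mat_adjoint S * (V * U) - mat_adjoint S * (U * V) = mat_adjoint S * (V * U - U * V)"
        by (rule mult_minus_distrib_mat[symmetric, of _ d d _ d])
          (simp_all only: mat_dims dims)
      finally show ?thesis .
    qed
    moreover have "op_norm (mat_adjoint S * (V * U - U * V) * S) \<le> op_norm (V * U - U * V)"
    proof -
      have c: "mat_adjoint S \<in> carrier_mat d d" "S \<in> carrier_mat d d" "V * U - U * V \<in> carrier_mat d d"
        "V * U \<in> carrier_mat d d" "U * V \<in> carrier_mat d d"
        by (simp_all only: mat_dims dims)
      have "op_norm (mat_adjoint S * (V * U - U * V) * S) \<le> op_norm (mat_adjoint S * (V * U - U * V)) * op_norm S"
        by (rule op_norm_mult[OF mult_carrier_mat[OF c(1,3)] c(2)])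
      also have "\<dots> \<le> op_norm (mat_adjoint S * (V * U - U * V)) * 1"
        by (intro mult_left_mono op_norm_unitary_le[OF S] op_norm_nonneg)
      also have "\<dots> \<le> (op_norm (mat_adjoint S) * op_norm (V * U - U * V)) * 1"
        by (intro mult_right_mono op_norm_mult[OF c(1,3)]) simp
      also have "\<dots> \<le> (1 * op_norm (V * U - U * V)) * 1"
        by (intro mult_right_mono op_norm_unitary_le[OF unitaries_adjoint[OF S]] op_norm_nonneg) simp
      finally show ?thesis
        by simp
    qed
    moreover have "op_norm (V * U - U * V) = op_norm (U * V - V * U)"
      by (rule op_norm_minus_commute[of _ d d]) (simp_all only: mat_dims dims)
    ultimately have "op_norm (comm_mat d D (\<lambda>z. z) U') \<le> \<delta>"
      using comm by simp
    then obtain k where k: "near_commuting_compression \<epsilon> d U' (mat_diag d D) k"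
      using diag[OF U' D] by blast
    then obtain W A B where W: "W \<in> isometry_mat k d" and A: "A \<in> unitaries k" and B: "B \<in> unitaries k"
      and AB: "A * B = B * A"
      and le: "op_norm (A * W - W * U') \<le> \<epsilon>" "op_norm (B * W - W * mat_diag d D) \<le> \<epsilon>"
      unfolding near_commuting_compression_def by blast
    have Wc: "W \<in> carrier_mat k d" and WW: "mat_adjoint W * W = 1\<^sub>m d"
      using W by (simp_all add: isometry_mat_def)
    define W' where "W' = W * mat_adjoint S"
    note dims = dims carrier_matD[OF Wc]
    have W': "W' \<in> isometry_mat k d"
    proof -
      have "mat_adjoint W' * W' = S * (mat_adjoint W * W) * mat_adjoint S"
        unfolding W'_def by (simp only: mat_normalize dims)
      also have "\<dots> = S * mat_adjoint S"
        unfolding WW right_mult_one_mat[OF unitaries_carrier[OF S]] ..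
      also have "\<dots> = 1\<^sub>m d"
        using S by (simp add: unitaries_iff)
      finally show ?thesis
        unfolding isometry_mat_def W'_def by (simp only: mem_Collect_eq mat_dims dims simp_thms)
    qed
    have transfer: "op_norm (Y * W' - W' * Z) \<le> \<epsilon>"
      if Y: "Y \<in> unitaries k" and Z: "Z \<in> carrier_mat d d" and Z': "Z' = mat_adjoint S * Z * S"
        and le: "op_norm (Y * W - W * Z') \<le> \<epsilon>" for Y Z Z'
    proof -
      note dims = dims carrier_matD[OF unitaries_carrier[OF Y]] carrier_matD[OF Z]
      have Z'c: "Z' \<in> carrier_mat d d"
        unfolding Z' by (simp only: mat_dims dims)
      note dims = dims carrier_matD[OF Z'c]
      have "Z' * mat_adjoint S = mat_adjoint S * Z"
      proof -
        have "mat_adjoint S * Z \<in> carrier_mat d d"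
          by (simp only: mat_dims dims)
        then show ?thesis
          unfolding Z' by (rule adjoint_cancel_right(2)[OF S])
      qed
      then have "W' * Z = W * Z' * mat_adjoint S"
        unfolding W'_def by (simp only: mat_normalize dims)
      moreover have "Y * W' = Y * W * mat_adjoint S"
        unfolding W'_def by (simp only: mat_normalize dims)
      ultimately have "Y * W' - W' * Z = Y * W * mat_adjoint S - W * Z' * mat_adjoint S"
        by simp
      also have "\<dots> = (Y * W - W * Z') * mat_adjoint S"
        by (rule minus_mult_distrib_mat[symmetric, of _ k d _ _ d])
          (simp_all only: mat_dims dims)
      finally have eq: "Y * W' - W' * Z = (Y * W - W * Z') * mat_adjoint S" .
      have "op_norm (Y * W' - W' * Z) \<le> op_norm (Y * W - W * Z') * op_norm (mat_adjoint S)"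
        unfolding eq by (rule op_norm_mult[of _ k d _ d])
          (simp_all only: mat_dims dims)
      also have "\<dots> \<le> op_norm (Y * W - W * Z') * 1"
        by (intro mult_left_mono op_norm_unitary_le[OF unitaries_adjoint[OF S]] op_norm_nonneg)
      finally show ?thesis
        using le by simp
    qed
    have "op_norm (A * W' - W' * U) \<le> \<epsilon>"
      by (rule transfer[OF A unitaries_carrier[OF U] U'_def le(1)])
    moreover have "op_norm (B * W' - W' * V) \<le> \<epsilon>"
      by (rule transfer[OF B unitaries_carrier[OF V] SVS[symmetric] le(2)])
    ultimately show ?thesis
      using k W' A B AB unfolding near_commuting_compression_def by blast
  qed
  with \<delta> show ?thesis
    by blast
qed

section \<open>Almost intertwining representations\<close>

lemma mult_unitary_group [simp]: "x \<otimes>\<^bsub>unitary_group n\<^esub> y = x * y"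
  by (simp add: unitary_group_def)

lemma one_unitary_group [simp]: "\<one>\<^bsub>unitary_group n\<^esub> = 1\<^sub>m n"
  by (simp add: unitary_group_def)

lemma group_unitary_group: "group (unitary_group n)"
proof (rule groupI; unfold mult_unitary_group one_unitary_group)
  fix x y z assume x: "x \<in> unitaries n" and y: "y \<in> unitaries n" and z: "z \<in> unitaries n"
  show "x * y * z = x * (y * z)"
    by (rule assoc_mult_mat[OF x[THEN unitaries_carrier] y[THEN unitaries_carrier] z[THEN unitaries_carrier]])
next
  show "1\<^sub>m n \<in> unitaries n"
    by (rule unitaries_one)
  fix x assume x: "x \<in> unitaries n"
  show "1\<^sub>m n * x = x"
    by (rule left_mult_one_mat[OF unitaries_carrier[OF x]])
  show "\<exists>y\<in>unitaries n. y * x = 1\<^sub>m n"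
    by (rule bexI[where x = "mat_adjoint x"]) (rule unitariesD(1)[OF x], rule unitaries_adjoint[OF x])
  fix y assume y: "y \<in> unitaries n"
  show "x * y \<in> unitaries n"
    by (rule unitaries_mult[OF x y])
qed

text \<open>For a negative exponent the relation is multiplied by the inverse on both sides.\<close>

lemma (in group) commute_int_pow:
  fixes c :: int
  assumes x: "x \<in> carrier G" and y: "y \<in> carrier G" and xy: "x \<otimes> y = y \<otimes> x"
  shows "x [^] c \<otimes> y = y \<otimes> x [^] c"
proof (cases c rule: int_cases2)
  case (nonneg k)
  show ?thesis
    unfolding nonneg int_pow_int by (rule group_commutes_pow[OF xy x y])
next
  case (nonpos k)
  define z where "z = x [^] k"
  have z: "z \<in> carrier G" "z \<otimes> y = y \<otimes> z"
    unfolding z_def by (rule nat_pow_closed[OF x] group_commutes_pow[OF xy x y])+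
  have "inv z \<otimes> y = inv z \<otimes> (y \<otimes> z) \<otimes> inv z"
    using z(1) y by (simp add: m_assoc)
  also have "\<dots> = y \<otimes> inv z"
    unfolding z(2)[symmetric] using z(1) y by (simp add: m_assoc[symmetric])
  finally show ?thesis
    unfolding nonpos int_pow_neg_int[OF x] z_def .
qed

lemma (in group) hom_integer_group_prod:
  assumes x: "x \<in> carrier G" and y: "y \<in> carrier G" and xy: "x \<otimes> y = y \<otimes> x"
  shows "(\<lambda>(a,b). x [^] a \<otimes> y [^] b) \<in> hom (integer_group \<times>\<times> integer_group) G"
proof (rule homI)
  fix g :: "int \<times> int"
  show "(case g of (a,b) \<Rightarrow> x [^] a \<otimes> y [^] b) \<in> carrier G"
    using x y by (cases g) simp
  fix h :: "int \<times> int"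
  obtain a b c e where gh: "g = (a,b)" "h = (c,e)"
    by (cases g; cases h)
  have comm: "x [^] c \<otimes> y [^] b = y [^] b \<otimes> x [^] c"
  proof -
    have "y [^] b \<otimes> x = x \<otimes> y [^] b"
      by (rule commute_int_pow[OF y x xy[symmetric]])
    then show ?thesis
      using x y by (intro commute_int_pow) simp_all
  qed
  have "x [^] (a + c) \<otimes> y [^] (b + e) = x [^] a \<otimes> (x [^] c \<otimes> y [^] b) \<otimes> y [^] e"
    using x y by (simp add: int_pow_mult m_assoc)
  also have "\<dots> = (x [^] a \<otimes> y [^] b) \<otimes> (x [^] c \<otimes> y [^] e)"
    unfolding comm using x y by (simp add: m_assoc)
  finally show "(case g \<otimes>\<^bsub>integer_group \<times>\<times> integer_group\<^esub> h of (a,b) \<Rightarrow> x [^] a \<otimes> y [^] b)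
      = (case g of (a,b) \<Rightarrow> x [^] a \<otimes> y [^] b) \<otimes> (case h of (a,b) \<Rightarrow> x [^] a \<otimes> y [^] b)"
    unfolding gh by simp
qed

text \<open>Turns a property that holds eventually for each fixed tolerance into a single sequence
  of tolerances tending to 0; the coarse tolerance \<open>c\<close> takes care of the early
  indices.\<close>

lemma exists_diagonal_sequence:
  fixes Q :: "real \<Rightarrow> nat \<Rightarrow> bool"
  assumes c: "c > 0" "\<And>n. Q c n" and ev: "\<And>\<epsilon>. \<epsilon> > 0 \<Longrightarrow> eventually (Q \<epsilon>) sequentially"
  obtains e where "\<And>n. Q (e n) n" "e \<longlonglongrightarrow> 0" "\<And>n. e n > 0"
proof -
  \<comment> \<open>At index \<open>n\<close> the best tolerance c / (N + 1) with \<open>N\<close>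
    at most \<open>n\<close> is used. The bound by \<open>n\<close> keeps the set finite, and
    \<open>N = 0\<close> always belongs to it.\<close>
  define S where "S n = {N. N \<le> n \<and> Q (c / real (Suc N)) n}" for n
  define e where "e n = c / real (Suc (Max (S n)))" for n
  have S: "finite (S n)" "S n \<noteq> {}" for n
    using c(2)[of n] by (auto simp: S_def intro!: exI[of _ 0])
  have "Q (e n) n" for n
    using Max_in[OF S, of n] by (simp add: e_def S_def)
  moreover have "e \<longlonglongrightarrow> 0"
  proof (rule LIMSEQ_I)
    fix r :: real assume r: "r > 0"
    obtain N :: nat where N: "c / r < real N"
      using reals_Archimedean2 by blast
    have "eventually (Q (c / real (Suc N))) sequentially"
      using c(1) by (intro ev) simp
    then obtain n0 where n0: "\<And>n. n \<ge> n0 \<Longrightarrow> Q (c / real (Suc N)) n"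
      by (auto simp: eventually_sequentially)
    have "norm (e n - 0) < r" if n: "n \<ge> max n0 N" for n
    proof -
      have "N \<in> S n"
        using n n0[of n] by (simp add: S_def)
      then have "N \<le> Max (S n)"
        using S by simp
      then have "c / r < real (Suc (Max (S n)))"
        using N by linarith
      then have "e n < r"
        unfolding e_def using r by (simp add: field_simps)
      moreover have "e n > 0"
        unfolding e_def using c(1) by simp
      ultimately show ?thesis
        by simp
    qed
    then show "\<exists>n0. \<forall>n\<ge>n0. norm (e n - 0) < r"
      by blast
  qed
  moreover have "e n > 0" for n
    unfolding e_def using c(1) by simp
  ultimately show thesis
    by (rule that)
qed

section \<open>Estimates for almost intertwining isometries\<close>

lemma mult_minus_distrib_mat_dim:
  fixes A :: "complex mat"
  assumes "dim_col A = dim_row B" "dim_row C = dim_row B" "dim_col C = dim_col B"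
  shows "A * (B - C) = A * B - A * C"
  by (rule mult_minus_distrib_mat[OF carrier_matI carrier_matI carrier_matI]) (use assms in auto)

lemma minus_mult_distrib_mat_dim:
  fixes A :: "complex mat"
  assumes "dim_col A = dim_row C" "dim_row B = dim_row A" "dim_col B = dim_col A"
  shows "(A - B) * C = A * C - B * C"
  by (rule minus_mult_distrib_mat[OF carrier_matI carrier_matI carrier_matI]) (use assms in auto)

lemma op_norm_mult_le:
  assumes "dim_col A = dim_row B"
  shows "op_norm (A * B) \<le> op_norm A * op_norm B"
  using op_norm_mult[OF carrier_matI[OF refl refl] carrier_matI[OF assms[symmetric] refl]] .

lemma op_norm_mult_le_snd:
  assumes "dim_col A = dim_row B" "op_norm A \<le> 1"
  shows "op_norm (A * B) \<le> op_norm B"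
  using op_norm_mult_le[OF assms(1)] mult_right_mono[OF assms(2) op_norm_nonneg[of B]] by linarith

lemma op_norm_mult_le_fst:
  assumes "dim_col A = dim_row B" "op_norm B \<le> 1"
  shows "op_norm (A * B) \<le> op_norm A"
  using op_norm_mult_le[OF assms(1)] mult_left_mono[OF assms(2) op_norm_nonneg[of A]] by linarith

lemma isometry_matD:
  assumes "W \<in> isometry_mat k d"
  shows "W \<in> carrier_mat k d" "mat_adjoint W * W = 1\<^sub>m d" "op_norm W \<le> 1" "op_norm (mat_adjoint W) \<le> 1"
  using assms op_norm_isometry_le[of W k d] by (simp_all add: isometry_mat_def op_norm_adjoint)

text \<open>Along the chain \<open>P Q W\<close>, \<open>P W H\<close>, \<open>W F H\<close>,
  \<open>W K\<close> each step is one of the defects multiplied by contractions.\<close>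

lemma intertwiner_mult:
  assumes W: "W \<in> isometry_mat k d" and P: "P \<in> unitaries k" and Q: "Q \<in> unitaries k"
    and F: "F \<in> unitaries d" and H: "H \<in> unitaries d" and K: "K \<in> unitaries d"
  shows "op_norm (P * Q * W - W * K)
    \<le> op_norm (Q * W - W * H) + op_norm (P * W - W * F) + op_norm (K - F * H)"
proof -
  note dims = carrier_matD[OF isometry_matD(1)[OF W]] carrier_matD[OF unitaries_carrier[OF P]]
    carrier_matD[OF unitaries_carrier[OF Q]] carrier_matD[OF unitaries_carrier[OF F]]
    carrier_matD[OF unitaries_carrier[OF H]] carrier_matD[OF unitaries_carrier[OF K]]
  have "op_norm (P * Q * W - W * K) \<le> op_norm (P * Q * W - P * W * H) + op_norm (P * W * H - W * K)"
    by (rule op_norm_triangle_dist[of _ k d]) (simp_all only: mat_dims dims)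
  also have "op_norm (P * W * H - W * K) \<le> op_norm (P * W * H - W * F * H) + op_norm (W * F * H - W * K)"
    by (rule op_norm_triangle_dist[of _ k d]) (simp_all only: mat_dims dims)
  also have "op_norm (P * Q * W - P * W * H) \<le> op_norm (Q * W - W * H)"
  proof -
    have "P * Q * W - P * W * H = P * (Q * W - W * H)"
      by (simp only: mult_minus_distrib_mat_dim mat_normalize dims)
    then show ?thesis
      by (simp only: op_norm_mult_le_snd op_norm_unitary_le[OF P] mat_normalize dims)
  qed
  also have "op_norm (P * W * H - W * F * H) \<le> op_norm (P * W - W * F)"
  proof -
    have "P * W * H - W * F * H = (P * W - W * F) * H"
      by (simp only: minus_mult_distrib_mat_dim mat_normalize dims)
    then show ?thesis
      by (simp only: op_norm_mult_le_fst op_norm_unitary_le[OF H] mat_normalize dims)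
  qed
  also have "op_norm (W * F * H - W * K) \<le> op_norm (F * H - K)"
  proof -
    have "W * F * H - W * K = W * (F * H - K)"
      by (simp only: mult_minus_distrib_mat_dim mat_normalize dims)
    then show ?thesis
      by (simp only: op_norm_mult_le_snd isometry_matD(3)[OF W] mat_normalize dims)
  qed
  also have "op_norm (F * H - K) = op_norm (K - F * H)"
    by (rule op_norm_minus_commute[of _ d d]) (simp_all only: mat_dims dims)
  finally show ?thesis
    by simp
qed

text \<open>\<open>F\<close>, \<open>H\<close> and \<open>E\<close> stand for the values of an
  asymptotic representation at an element, its inverse and the identity. The chain is
  \<open>Q W\<close>, \<open>Q W F H\<close>, \<open>Q P W H\<close>. As \<open>E\<close> need not
  be 1, its distance from 1 is read off from \<open>E - E * E\<close> by cancelling the unitary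
  \<open>E\<close>.\<close>

lemma intertwiner_inverse:
  assumes W: "W \<in> isometry_mat k d" and P: "P \<in> unitaries k" and Q: "Q \<in> unitaries k"
    and F: "F \<in> unitaries d" and H: "H \<in> unitaries d" and E: "E \<in> unitaries d" and QP: "Q * P = 1\<^sub>m k"
  shows "op_norm (Q * W - W * H)
    \<le> op_norm (P * W - W * F) + op_norm (E - F * H) + op_norm (E - E * E)"
proof -
  note dims = carrier_matD[OF isometry_matD(1)[OF W]] carrier_matD[OF unitaries_carrier[OF P]]
    carrier_matD[OF unitaries_carrier[OF Q]] carrier_matD[OF unitaries_carrier[OF F]]
    carrier_matD[OF unitaries_carrier[OF H]] carrier_matD[OF unitaries_carrier[OF E]]
    index_one_mat(2,3)
  have "op_norm (Q * W - W * H) \<le> op_norm (Q * W - Q * W * (F * H)) + op_norm (Q * W * (F * H) - W * H)"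
    by (rule op_norm_triangle_dist[of _ k d]) (simp_all only: mat_dims dims)
  also have "op_norm (Q * W * (F * H) - W * H) \<le> op_norm (W * F - P * W)"
  proof -
    have "Q * (P * (W * H)) = W * H"
    proof -
      have "Q * (P * (W * H)) = Q * P * (W * H)"
        by (simp only: mat_normalize dims)
      then show ?thesis
        unfolding QP by (simp add: dims)
    qed
    then have "Q * W * (F * H) - W * H = Q * ((W * F - P * W) * H)"
      by (simp only: mult_minus_distrib_mat_dim minus_mult_distrib_mat_dim mat_normalize dims)
    moreover have "op_norm (Q * ((W * F - P * W) * H)) \<le> op_norm ((W * F - P * W) * H)"
      by (simp only: op_norm_mult_le_snd op_norm_unitary_le[OF Q] mat_normalize dims)
    moreover have "op_norm ((W * F - P * W) * H) \<le> op_norm (W * F - P * W)"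
      by (simp only: op_norm_mult_le_fst op_norm_unitary_le[OF H] mat_normalize dims)
    ultimately show ?thesis
      by simp
  qed
  also have "op_norm (W * F - P * W) = op_norm (P * W - W * F)"
    by (rule op_norm_minus_commute[of _ k d]) (simp_all only: mat_dims dims)
  also have "op_norm (Q * W - Q * W * (F * H)) \<le> op_norm (1\<^sub>m d - F * H)"
  proof -
    have "Q * W * 1\<^sub>m d = Q * W"
      by (rule right_mult_one_mat[of _ k d]) (simp only: mat_dims dims)
    then have "Q * W - Q * W * (F * H) = Q * W * (1\<^sub>m d - F * H)"
      by (simp only: mult_minus_distrib_mat_dim index_mult_mat(2,3) dims)
    moreover have "op_norm (Q * W) \<le> 1"
      using op_norm_mult_le_snd[of Q W] op_norm_unitary_le[OF Q] isometry_matD(3)[OF W] by (simp add: dims)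
    ultimately show ?thesis
      by (simp only: op_norm_mult_le_snd index_mult_mat(2,3) dims index_minus_mat(2,3))
  qed
  also have "op_norm (1\<^sub>m d - F * H) \<le> op_norm (1\<^sub>m d - E) + op_norm (E - F * H)"
    by (rule op_norm_triangle_dist[of _ d d]) (simp_all only: mat_dims dims)
  also have "op_norm (1\<^sub>m d - E) \<le> op_norm (E - E * E)"
  proof -
    have "mat_adjoint E * (E * E) = E" "mat_adjoint E * E = 1\<^sub>m d"
      using adjoint_cancel[OF E unitaries_carrier[OF E]] E by (simp_all add: unitaries_iff)
    then have "1\<^sub>m d - E = mat_adjoint E * (E - E * E)"
      by (simp only: mult_minus_distrib_mat_dim index_mult_mat(2,3) adjoint_dim dims)
    then show ?thesis
      by (simp only: op_norm_mult_le_snd op_norm_unitary_le[OF unitaries_adjoint[OF E]]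
          index_mult_mat(2,3) adjoint_dim dims index_minus_mat(2,3))
  qed
  finally show ?thesis
    by simp
qed

text \<open>The adjoint of \<open>W\<close> is a contraction that cancels \<open>W\<close>, so
  applying it to the intertwining defect leaves the compression error.\<close>

lemma op_norm_compression_le:
  assumes W: "W \<in> isometry_mat k d" and P: "P \<in> unitaries k" and F: "F \<in> unitaries d"
  shows "op_norm (mat_adjoint W * P * W - F) \<le> op_norm (P * W - W * F)"
proof -
  note dims = carrier_matD[OF isometry_matD(1)[OF W]] carrier_matD[OF unitaries_carrier[OF P]]
    carrier_matD[OF unitaries_carrier[OF F]]
  have "mat_adjoint W * (W * F) = F"
  proof -
    have "mat_adjoint W * (W * F) = mat_adjoint W * W * F"
      by (simp only: mat_normalize dims)
    then show ?thesis
      unfolding isometry_matD(2)[OF W] by (simp add: dims)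
  qed
  then have "mat_adjoint W * P * W - F = mat_adjoint W * (P * W - W * F)"
    by (simp only: mult_minus_distrib_mat_dim mat_normalize dims)
  then show ?thesis
    by (simp only: op_norm_mult_le_snd isometry_matD(4)[OF W] mat_normalize dims)
qed

section \<open>Flexible stability\<close>

abbreviation Z2 :: "(int \<times> int) monoid" where
  "Z2 \<equiv> integer_group \<times>\<times> integer_group"

text \<open>The fallback where the commutator is not yet small: \<open>W\<close>, \<open>A\<close>
  and \<open>B\<close> are the identity, at distance at most 2 from any unitary.\<close>

lemma near_commuting_compression_trivial:
  assumes U: "U \<in> unitaries d" and V: "V \<in> unitaries d"
  shows "near_commuting_compression 2 d U V d"
proof -
  have W: "1\<^sub>m d \<in> isometry_mat d d"
    by (simp add: isometry_mat_def)
  have "op_norm (1\<^sub>m d * 1\<^sub>m d - 1\<^sub>m d * X) \<le> 2" if X: "X \<in> unitaries d" for X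
  proof -
    have "op_norm (1\<^sub>m d * 1\<^sub>m d - 1\<^sub>m d * X) = op_norm (1\<^sub>m d - X)"
      by (simp only: left_mult_one_mat[OF one_carrier_mat] left_mult_one_mat[OF unitaries_carrier[OF X]])
    also have "\<dots> \<le> op_norm (1\<^sub>m d) + op_norm X"
      by (rule op_norm_triangle_minus[OF one_carrier_mat unitaries_carrier[OF X]])
    also have "\<dots> \<le> 1 + 1"
      by (intro add_mono op_norm_unitary_le[OF unitaries_one] op_norm_unitary_le[OF X])
    finally show ?thesis
      by simp
  qed
  with U V W show ?thesis
    unfolding near_commuting_compression_def
    by (intro conjI bexI[of _ "1\<^sub>m d"] unitaries_one) auto
qed

locale asymptotic_pair =
  fixes d :: "nat \<Rightarrow> nat" and \<phi> :: "nat \<Rightarrow> int \<times> int \<Rightarrow> complex mat"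
  assumes asymp: "asymptotic_representation Z2 d \<phi>"
begin

lemma d_pos: "d n > 0"
  using asymp by (simp add: asymptotic_representation_def)

lemma phi_unitary: "\<phi> n g \<in> unitaries (d n)"
proof -
  have "\<phi> n \<in> carrier Z2 \<rightarrow> unitaries (d n)"
    using asymp by (simp add: asymptotic_representation_def)
  moreover have "g \<in> carrier Z2"
    by (cases g) simp
  ultimately show ?thesis
    by (rule Pi_mem)
qed

lemma phi_mult: "(\<lambda>n. op_norm (\<phi> n (a + c, b + e) - \<phi> n (a,b) * \<phi> n (c,e))) \<longlonglongrightarrow> 0"
proof -
  have "(a,b) \<in> carrier Z2" "(c,e) \<in> carrier Z2"
    by simp_all
  then have "(\<lambda>n. op_norm (\<phi> n ((a,b) \<otimes>\<^bsub>Z2\<^esub> (c,e)) - \<phi> n (a,b) * \<phi> n (c,e))) \<longlonglongrightarrow> 0"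
    using asymp unfolding asymptotic_representation_def by blast
  then show ?thesis
    by simp
qed

definition U :: "nat \<Rightarrow> complex mat" where "U n = \<phi> n (1,0)"

definition V :: "nat \<Rightarrow> complex mat" where "V n = \<phi> n (0,1)"

lemma UV_unitary: "U n \<in> unitaries (d n)" "V n \<in> unitaries (d n)"
  unfolding U_def V_def by (rule phi_unitary)+

lemma UV_carrier: "U n * V n \<in> carrier_mat (d n) (d n)" "V n * U n \<in> carrier_mat (d n) (d n)"
  using unitaries_carrier[OF unitaries_mult] UV_unitary by blast+

text \<open>Both products approximate the value of \<phi> at \<open>(1,1)\<close>.\<close>

lemma commutator_tendsto: "(\<lambda>n. op_norm (U n * V n - V n * U n)) \<longlonglongrightarrow> 0"
proof (rule Lim_null_comparison)
  let ?f = "\<lambda>n. op_norm (\<phi> n (1,1) - U n * V n)" and ?g = "\<lambda>n. op_norm (\<phi> n (1,1) - V n * U n)"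
  have "?f \<longlonglongrightarrow> 0" "?g \<longlonglongrightarrow> 0"
    using phi_mult[of 1 0 0 1] phi_mult[of 0 1 1 0] by (simp_all add: U_def V_def)
  then show "(\<lambda>n. ?f n + ?g n) \<longlonglongrightarrow> 0"
    using tendsto_add[of ?f 0 sequentially ?g 0] by simp
  have "op_norm (U n * V n - V n * U n) \<le> ?f n + ?g n" for n
    using op_norm_triangle_dist[OF UV_carrier(1) unitaries_carrier[OF phi_unitary] UV_carrier(2), of n "(1,1)"]
      op_norm_minus_commute[OF UV_carrier(1) unitaries_carrier[OF phi_unitary], of n "(1,1)"] by simp
  then show "\<forall>\<^sub>F n in sequentially. norm (op_norm (U n * V n - V n * U n)) \<le> ?f n + ?g n"
    by (simp add: always_eventually)
qed

theorem flexible_approximation: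
  "\<exists>k. approx_by_compressions Z2 d \<phi> k \<and> (\<lambda>n. real (k n) / real (d n)) \<longlonglongrightarrow> 1"
proof -
  define Q where "Q \<epsilon> n \<longleftrightarrow> (\<exists>k. near_commuting_compression \<epsilon> (d n) (U n) (V n) k)" for \<epsilon> n
  have "eventually (Q \<epsilon>) sequentially" if \<epsilon>: "\<epsilon> > 0" for \<epsilon>
  proof -
    obtain \<delta> where \<delta>: "\<delta> > 0" "\<And>n. op_norm (U n * V n - V n * U n) \<le> \<delta> \<Longrightarrow> Q \<epsilon> n"
      using exists_near_commuting_compression[OF \<epsilon>] UV_unitary unfolding Q_def by metis
    have "eventually (\<lambda>n. op_norm (U n * V n - V n * U n) < \<delta>) sequentially"
      using commutator_tendsto \<delta>(1) by (rule order_tendstoD)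
    then show ?thesis
      by (rule eventually_mono) (use \<delta>(2) in auto)
  qed
  moreover have "Q 2 n" for n
    unfolding Q_def using near_commuting_compression_trivial[OF UV_unitary] by blast
  ultimately obtain e where e: "\<And>n. Q (e n) n" "e \<longlonglongrightarrow> 0" "\<And>n. e n > 0"
    using exists_diagonal_sequence[of 2 Q] by auto
  obtain k where k: "\<And>n. near_commuting_compression (e n) (d n) (U n) (V n) (k n)"
    using e(1) unfolding Q_def by metis
  then have dk: "d n \<le> k n" and kd: "real (k n) \<le> (1 + e n) * real (d n)" for n
    unfolding near_commuting_compression_def by blast+
  have "\<forall>n. \<exists>W A B. W \<in> isometry_mat (k n) (d n) \<and> A \<in> unitaries (k n) \<and> B \<in> unitaries (k n) \<and>
      A * B = B * A \<and> op_norm (A * W - W * U n) \<le> e n \<and> op_norm (B * W - W * V n) \<le> e n"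
    using k unfolding near_commuting_compression_def by blast
  then obtain W A B where W: "\<And>n. W n \<in> isometry_mat (k n) (d n)"
    and A: "\<And>n. A n \<in> unitaries (k n)" and B: "\<And>n. B n \<in> unitaries (k n)"
    and AB: "\<And>n. A n * B n = B n * A n"
    and AW: "\<And>n. op_norm (A n * W n - W n * U n) \<le> e n"
    and BW: "\<And>n. op_norm (B n * W n - W n * V n) \<le> e n"
    by metis
  define \<pi> where "\<pi> n = (\<lambda>(a :: int, b :: int). A n [^]\<^bsub>unitary_group (k n)\<^esub> a \<otimes>\<^bsub>unitary_group (k n)\<^esub>
      B n [^]\<^bsub>unitary_group (k n)\<^esub> b)" for n
  have hom: "\<pi> n \<in> hom Z2 (unitary_group (k n))" for n
    unfolding \<pi>_def using group.hom_integer_group_prod[OF group_unitary_group A B] AB[of n] by simp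
  have \<pi>: "\<pi> n g \<in> unitaries (k n)" for n g
  proof -
    have "g \<in> carrier Z2"
      by (cases g) simp
    then show ?thesis
      by (rule hom_in_carrier[OF hom])
  qed
  have \<pi>_mult: "\<pi> n (a + c, b + f) = \<pi> n (a,b) * \<pi> n (c,f)" for n a b c f
    using hom_mult[OF hom[of n], of "(a,b)" "(c,f)"] by simp
  have \<pi>_gen: "\<pi> n (1,0) = A n" "\<pi> n (0,1) = B n" for n
    using group.int_pow_1[OF group_unitary_group A[of n]] group.int_pow_1[OF group_unitary_group B[of n]]
      unitaries_carrier[OF A[of n]] unitaries_carrier[OF B[of n]]
    unfolding \<pi>_def by simp_all
  have \<pi>_zero: "\<pi> n (0,0) = 1\<^sub>m (k n)" for n
    unfolding \<pi>_def by simp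
  \<comment> \<open>The elements at which this defect tends to 0 are closed under sums and negation,
    so it is enough to control the two generators.\<close>
  define E where "E g n = op_norm (\<pi> n g * W n - W n * \<phi> n g)" for g n
  have E_mult: "E (a + c, b + f) \<longlonglongrightarrow> 0" if "E (a,b) \<longlonglongrightarrow> 0" "E (c,f) \<longlonglongrightarrow> 0" for a b c f
  proof (rule Lim_null_comparison)
    let ?M = "\<lambda>n. op_norm (\<phi> n (a + c, b + f) - \<phi> n (a,b) * \<phi> n (c,f))"
    show "(\<lambda>n. E (c,f) n + E (a,b) n + ?M n) \<longlonglongrightarrow> 0"
      using tendsto_add[OF tendsto_add[OF that(2,1)] phi_mult[of a c b f]] by simp
    have "E (a + c, b + f) n \<le> E (c,f) n + E (a,b) n + ?M n" for n
      unfolding E_def \<pi>_mult by (rule intertwiner_mult[OF W \<pi> \<pi> phi_unitary phi_unitary phi_unitary])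
    then show "\<forall>\<^sub>F n in sequentially. norm (E (a + c, b + f) n) \<le> E (c,f) n + E (a,b) n + ?M n"
      by (simp add: always_eventually E_def)
  qed
  have E_inv: "E (- a, - b) \<longlonglongrightarrow> 0" if "E (a,b) \<longlonglongrightarrow> 0" for a b
  proof (rule Lim_null_comparison)
    let ?M = "\<lambda>n. op_norm (\<phi> n (0,0) - \<phi> n (a,b) * \<phi> n (- a, - b))"
    and ?N = "\<lambda>n. op_norm (\<phi> n (0,0) - \<phi> n (0,0) * \<phi> n (0,0))"
    have "?M \<longlonglongrightarrow> 0" "?N \<longlonglongrightarrow> 0"
      using phi_mult[of a "- a" b "- b"] phi_mult[of 0 0 0 0] by simp_all
    from tendsto_add[OF tendsto_add[OF that this(1)] this(2)]
    show "(\<lambda>n. E (a,b) n + ?M n + ?N n) \<longlonglongrightarrow> 0"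
      by simp
    have "E (- a, - b) n \<le> E (a,b) n + ?M n + ?N n" for n
    proof -
      have "\<pi> n (- a, - b) * \<pi> n (a,b) = 1\<^sub>m (k n)"
        using \<pi>_mult[of n "- a" a "- b" b] \<pi>_zero[of n] by simp
      then show ?thesis
        unfolding E_def by (rule intertwiner_inverse[OF W \<pi> \<pi> phi_unitary phi_unitary phi_unitary])
    qed
    then show "\<forall>\<^sub>F n in sequentially. norm (E (- a, - b) n) \<le> E (a,b) n + ?M n + ?N n"
      by (simp add: always_eventually E_def)
  qed
  have E10: "E (1,0) \<longlonglongrightarrow> 0" and E01: "E (0,1) \<longlonglongrightarrow> 0"
    using AW BW e(2) by (auto simp: E_def \<pi>_gen U_def V_def intro!: Lim_null_comparison[OF _ e(2)] always_eventually)
  have E00: "E (0,0) \<longlonglongrightarrow> 0"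
    using E_mult[OF E10 E_inv[OF E10]] by simp
  have Em0: "E (- 1, 0) \<longlonglongrightarrow> 0" and E0m: "E (0, - 1) \<longlonglongrightarrow> 0"
    using E_inv[OF E10] E_inv[OF E01] by simp_all
  have Ea: "E (a, 0) \<longlonglongrightarrow> 0" for a
  proof (induction a rule: int_induct[of _ 0])
    case base
    show ?case by (rule E00)
  next
    case (step1 i)
    then show ?case using E_mult[OF _ E10] by fastforce
  next
    case (step2 i)
    then show ?case using E_mult[OF _ Em0] by fastforce
  qed
  have Eb: "E (0, b) \<longlonglongrightarrow> 0" for b
  proof (induction b rule: int_induct[of _ 0])
    case base
    show ?case by (rule E00)
  next
    case (step1 i)
    then show ?case using E_mult[OF _ E01] by fastforce
  next
    case (step2 i)
    then show ?case using E_mult[OF _ E0m] by fastforce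
  qed
  have Eg: "E g \<longlonglongrightarrow> 0" for g
    using E_mult[OF Ea[of "fst g"] Eb[of "snd g"]] by simp
  have "(\<lambda>n. op_norm (mat_adjoint (W n) * \<pi> n g * W n - \<phi> n g)) \<longlonglongrightarrow> 0" for g
  proof (rule Lim_null_comparison[OF _ Eg[of g]])
    show "\<forall>\<^sub>F n in sequentially. norm (op_norm (mat_adjoint (W n) * \<pi> n g * W n - \<phi> n g)) \<le> E g n"
      using op_norm_compression_le[OF W \<pi> phi_unitary] by (simp add: always_eventually E_def)
  qed
  then have "approx_by_compressions Z2 d \<phi> k"
    unfolding approx_by_compressions_def using dk W hom by blast
  moreover have "(\<lambda>n. real (k n) / real (d n)) \<longlonglongrightarrow> 1"
  proof (rule tendsto_sandwich[of "\<lambda>_. 1" _ _ "\<lambda>n. 1 + e n"])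
    show "\<forall>\<^sub>F n in sequentially. 1 \<le> real (k n) / real (d n)"
      using dk d_pos by (simp add: always_eventually)
    show "\<forall>\<^sub>F n in sequentially. real (k n) / real (d n) \<le> 1 + e n"
      using kd d_pos by (simp add: always_eventually pos_divide_le_eq)
    show "(\<lambda>n. 1 + e n) \<longlonglongrightarrow> 1"
      using tendsto_add[OF tendsto_const[of 1] e(2)] by simp
  qed simp
  ultimately show ?thesis
    by blast
qed

end

theorem flexibly_stable_Z2: "flexibly_stable_op_norm Z2"
  unfolding flexibly_stable_op_norm_def
  using asymptotic_pair.flexible_approximation asymptotic_pair.intro by blast

section \<open>A winding number obstruction\<close>

lemma continuous_on_det:
  fixes M :: "'a :: topological_space \<Rightarrow> complex mat"
  assumes M: "\<And>x. M x \<in> carrier_mat n n"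
    and cont: "\<And>i j. i < n \<Longrightarrow> j < n \<Longrightarrow> continuous_on S (\<lambda>x. M x $$ (i,j))"
  shows "continuous_on S (\<lambda>x. det (M x))"
  unfolding det_def'[OF M]
proof (intro continuous_on_sum continuous_on_mult continuous_on_const continuous_on_prod)
  fix p i assume "p \<in> {p. p permutes {0..<n}}" "i \<in> {0..<n}"
  then have "p i \<in> {0..<n}"
    using permutes_in_image[of p "{0..<n}" i] by blast
  with \<open>i \<in> {0..<n}\<close> show "continuous_on S (\<lambda>x. M x $$ (i, p i))"
    by (intro cont) simp_all
qed

lemma continuous_on_mat_mult_entry:
  fixes A B :: "'a :: topological_space \<Rightarrow> complex mat"
  assumes A: "\<And>x. A x \<in> carrier_mat n n" and B: "\<And>x. B x \<in> carrier_mat n n"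
    and contA: "\<And>i j. i < n \<Longrightarrow> j < n \<Longrightarrow> continuous_on S (\<lambda>x. A x $$ (i,j))"
    and contB: "\<And>i j. i < n \<Longrightarrow> j < n \<Longrightarrow> continuous_on S (\<lambda>x. B x $$ (i,j))"
    and ij: "i < n" "j < n"
  shows "continuous_on S (\<lambda>x. (A x * B x) $$ (i,j))"
proof -
  have "(A x * B x) $$ (i,j) = (\<Sum>k = 0..<n. A x $$ (i,k) * B x $$ (k,j))" for x
    using carrier_matD[OF A[of x]] carrier_matD[OF B[of x]] ij by (simp add: scalar_prod_def)
  then show ?thesis
    using ij by (simp only:) (intro continuous_on_sum continuous_on_mult contA contB; simp)
qed

text \<open>Segments leave the unitary group but stay in every norm ball that contains their ends,
  which is all that invertibility needs.\<close>

definition lerp_mat :: "real \<Rightarrow> complex mat \<Rightarrow> complex mat \<Rightarrow> complex mat" where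
  "lerp_mat s A B = complex_of_real (1 - s) \<cdot>\<^sub>m A + complex_of_real s \<cdot>\<^sub>m B"

lemma lerp_mat_carrier: "B \<in> carrier_mat n m \<Longrightarrow> lerp_mat s A B \<in> carrier_mat n m"
  unfolding lerp_mat_def by (intro add_carrier_mat smult_carrier_mat)

lemma lerp_mat_index:
  assumes "A \<in> carrier_mat n m" "B \<in> carrier_mat n m" "i < n" "j < m"
  shows "lerp_mat s A B $$ (i,j) = complex_of_real (1 - s) * A $$ (i,j) + complex_of_real s * B $$ (i,j)"
  unfolding lerp_mat_def using assms carrier_matD[OF assms(1)] carrier_matD[OF assms(2)] by simp

lemma lerp_mat_ends:
  assumes A: "A \<in> carrier_mat n m" and B: "B \<in> carrier_mat n m"
  shows "lerp_mat 0 A B = A" "lerp_mat 1 A B = B"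
proof -
  note dims = carrier_matD[OF lerp_mat_carrier[OF B]] carrier_matD[OF A] carrier_matD[OF B]
  show "lerp_mat 0 A B = A" "lerp_mat 1 A B = B"
    by (rule eq_matI; simp add: dims lerp_mat_index[OF A B])+
qed

lemma lerp_mat_same:
  assumes A: "A \<in> carrier_mat n m"
  shows "lerp_mat s A A = A"
proof -
  note dims = carrier_matD[OF lerp_mat_carrier[OF A]] carrier_matD[OF A]
  show ?thesis
    by (rule eq_matI) (simp_all add: dims lerp_mat_index[OF A A] algebra_simps)
qed

lemma op_norm_lerp_mat:
  assumes A: "A \<in> carrier_mat n m" and B: "B \<in> carrier_mat n m" and s: "0 \<le> s" "s \<le> 1"
    and le: "op_norm A \<le> c" "op_norm B \<le> c"
  shows "op_norm (lerp_mat s A B) \<le> c"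
proof -
  have "op_norm (lerp_mat s A B) \<le> op_norm (complex_of_real (1 - s) \<cdot>\<^sub>m A) + op_norm (complex_of_real s \<cdot>\<^sub>m B)"
    unfolding lerp_mat_def by (rule op_norm_triangle[OF smult_carrier_mat[OF A] smult_carrier_mat[OF B]])
  also have "\<dots> \<le> cmod (complex_of_real (1 - s)) * op_norm A + cmod (complex_of_real s) * op_norm B"
    by (intro add_mono op_norm_smult)
  also have "\<dots> = (1 - s) * op_norm A + s * op_norm B"
    unfolding norm_of_real using s by simp
  also have "\<dots> \<le> (1 - s) * c + s * c"
    using s le by (intro add_mono mult_left_mono) auto
  finally show ?thesis
    by (simp add: algebra_simps)
qed

lemma lerp_mat_minus:
  assumes A: "A \<in> carrier_mat n m" and B: "B \<in> carrier_mat n m" and C: "C \<in> carrier_mat n m"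
  shows "lerp_mat s A B - C = lerp_mat s (A - C) (B - C)"
proof -
  note AC = minus_carrier_mat[OF C, of A] and BC = minus_carrier_mat[OF C, of B]
  note dims = carrier_matD[OF lerp_mat_carrier[OF B]] carrier_matD[OF lerp_mat_carrier[OF BC]]
    carrier_matD[OF A] carrier_matD[OF B] carrier_matD[OF C]
  show ?thesis
    by (rule eq_matI) (simp_all add: dims lerp_mat_index[OF A B] lerp_mat_index[OF AC BC] algebra_simps)
qed

lemma op_norm_lerp_mat_diff:
  assumes "A \<in> carrier_mat n m" "B \<in> carrier_mat n m" "C \<in> carrier_mat n m" "0 \<le> s" "s \<le> 1"
    "op_norm (A - C) \<le> c" "op_norm (B - C) \<le> c"
  shows "op_norm (lerp_mat s A B - C) \<le> c"
  unfolding lerp_mat_minus[OF assms(1-3)]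
  using assms by (intro op_norm_lerp_mat[OF minus_carrier_mat minus_carrier_mat])

lemma op_norm_mult_diff:
  assumes U: "U \<in> carrier_mat n n" and V: "V \<in> carrier_mat n n"
    and U': "U' \<in> carrier_mat n n" and V': "V' \<in> carrier_mat n n"
    and "op_norm U \<le> 1" "op_norm V' \<le> 1"
  shows "op_norm (U' * V' - U * V) \<le> op_norm (U' - U) + op_norm (V' - V)"
proof -
  note dims = carrier_matD[OF U] carrier_matD[OF V] carrier_matD[OF U'] carrier_matD[OF V']
  have "op_norm (U' * V' - U * V) \<le> op_norm (U' * V' - U * V') + op_norm (U * V' - U * V)"
    by (rule op_norm_triangle_dist[of _ n n]) (simp_all only: mat_dims dims)
  also have "U' * V' - U * V' = (U' - U) * V'"
    by (simp only: minus_mult_distrib_mat_dim dims)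
  also have "U * V' - U * V = U * (V' - V)"
    by (simp only: mult_minus_distrib_mat_dim dims)
  also have "op_norm ((U' - U) * V') + op_norm (U * (V' - V)) \<le> op_norm (U' - U) + op_norm (V' - V)"
    using assms(5,6)
    by (intro add_mono op_norm_mult_le_snd op_norm_mult_le_fst)
      (simp_all only: index_minus_mat(2,3) dims)
  finally show ?thesis .
qed

text \<open>On a kernel vector of \<open>M\<close> the difference \<open>M - U\<close> acts as
  \<open>- U\<close> and preserves the norm, against the bound below 1.\<close>

lemma det_nonzero_near_unitary:
  assumes U: "U \<in> unitaries n" and M: "M \<in> carrier_mat n n" and close: "op_norm (M - U) < 1"
  shows "det M \<noteq> 0"
proof
  assume "det M = 0"
  then obtain v where v: "v \<in> carrier_vec n" "v \<noteq> 0\<^sub>v n" "M *\<^sub>v v = 0\<^sub>v n"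
    unfolding det_0_iff_vec_prod_zero_field[OF M] by blast
  note Uc = unitaries_carrier[OF U]
  have Uv: "U *\<^sub>v v \<in> carrier_vec n"
    by (rule mult_mat_vec_carrier[OF Uc v(1)])
  have "(M - U) *\<^sub>v v = - (U *\<^sub>v v)"
    unfolding minus_mult_distrib_mat_vec[OF M Uc v(1)] v(3)
    using carrier_vecD[OF Uv] by (intro eq_vecI) (simp_all del: index_mult_mat_vec)
  then have "l2_norm_vec ((M - U) *\<^sub>v v) = l2_norm_vec (U *\<^sub>v v)"
    by (simp add: l2_norm_vec_def del: index_mult_mat_vec)
  then have "l2_norm_vec v \<le> op_norm (M - U) * l2_norm_vec v"
    using l2_norm_le_op_norm[OF minus_carrier_mat[OF Uc] v(1), of M] unfolding l2_norm_unitary[OF U v(1)] by linarith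
  moreover have "l2_norm_vec v > 0"
    using l2_norm_vec_eq_0[OF v(1)] v(2) l2_norm_vec_nonneg[of v] by linarith
  ultimately show False
    using close mult_strict_right_mono[OF close, of "l2_norm_vec v"] by linarith
qed

text \<open>Logarithms of \<open>c\<close> differ by multiples of 2 pi i, so \<open>f\<close> has
  discrete range on a connected interval.\<close>

lemma constant_if_exp_constant:
  fixes f :: "real \<Rightarrow> complex"
  assumes cont: "continuous_on {0..1} f" and const: "\<And>t. t \<in> {0..1} \<Longrightarrow> exp (f t) = c"
  shows "f 0 = f 1"
proof -
  have "f constant_on {0..1}"
  proof (rule continuous_discrete_range_constant[OF connected_Icc cont])
    fix x :: real assume x: "x \<in> {0..1}"
    have "2 * pi \<le> norm (f y - f x)" if y: "y \<in> {0..1}" "f y \<noteq> f x" for y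
    proof -
      obtain n :: int where n: "f y = f x + (of_int (2 * n) * pi) * \<i>"
        using const[OF x] const[OF y(1)] exp_eq[of "f y" "f x"] by auto
      with y(2) have "n \<noteq> 0"
        by auto
      then have "\<bar>real_of_int n\<bar> \<ge> 1"
        by linarith
      then have "2 * pi * 1 \<le> 2 * pi * \<bar>real_of_int n\<bar>"
        by (intro mult_left_mono) auto
      also have "\<dots> = norm (f y - f x)"
        unfolding n by (simp add: norm_mult)
      finally show ?thesis
        by simp
    qed
    then show "\<exists>e>0. \<forall>y. y \<in> {0..1} \<and> f y \<noteq> f x \<longrightarrow> e \<le> norm (f y - f x)"
      by (intro exI[of _ "2 * pi"]) auto
  qed
  then show ?thesis
    unfolding constant_on_def by force
qed

text \<open>For a pair close to \<open>U, V\<close>, the loop \<open>t \<mapsto> det ((1 - t) U V + t V U)\<close> avoids \<open>0\<close>, and it is closed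
  because \<open>U V\<close> and \<open>V U\<close> have the same determinant. Its winding number is a homotopy invariant that vanishes
  for commuting pairs, whereas \<open>V U = \<omega> U V\<close> turns the loop into \<open>(1 - t + t \<omega>) ^ n\<close> up to a constant.\<close>

theorem twisted_pair_far_from_commuting:
  assumes U: "U \<in> unitaries n" and V: "V \<in> unitaries n" and n: "n > 0"
    and A: "A \<in> unitaries n" and B: "B \<in> unitaries n" and AB: "A * B = B * A"
    and VU: "V * U = \<omega> \<cdot>\<^sub>m (U * V)"
    and close: "op_norm (A - U) + op_norm (B - V) + cmod (\<omega> - 1) < 1"
  shows "\<omega> = 1"
proof -
  note Uc = unitaries_carrier[OF U] and Vc = unitaries_carrier[OF V]
    and Ac = unitaries_carrier[OF A] and Bc = unitaries_carrier[OF B]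
  define r where "r = op_norm (A - U) + op_norm (B - V) + cmod (\<omega> - 1)"
  define Us where "Us s = lerp_mat s U A" for s
  define Vs where "Vs s = lerp_mat s V B" for s
  \<comment> \<open>\<open>fst x\<close> deforms the pair \<open>U\<close>, \<open>V\<close> at 0
    into the commuting pair \<open>A\<close>, \<open>B\<close> at 1; \<open>snd x\<close> runs along
    the loop.\<close>
  define M where "M x = lerp_mat (snd x) (Us (fst x) * Vs (fst x)) (Vs (fst x) * Us (fst x))" for x :: "real \<times> real"
  have Usc: "Us s \<in> carrier_mat n n" and Vsc: "Vs s \<in> carrier_mat n n" for s
    unfolding Us_def Vs_def by (rule lerp_mat_carrier[OF Ac] lerp_mat_carrier[OF Bc])+
  note UVc = mult_carrier_mat[OF Usc Vsc] and VUc = mult_carrier_mat[OF Vsc Usc]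
  have Mc: "M x \<in> carrier_mat n n" for x
    unfolding M_def by (rule lerp_mat_carrier[OF VUc])
  note UV = unitaries_mult[OF U V] and UV0c = mult_carrier_mat[OF Uc Vc] and VU0c = mult_carrier_mat[OF Vc Uc]
  have close_M: "op_norm (M (s,t) - U * V) < 1" if s: "0 \<le> s" "s \<le> 1" and t: "0 \<le> t" "t \<le> 1" for s t
  proof -
    have zero: "op_norm (X - X) = 0" if X: "X \<in> carrier_mat n n" for X
    proof -
      have "X - X = 0 \<cdot>\<^sub>m X"
        by (intro eq_matI) simp_all
      moreover have "op_norm (0 \<cdot>\<^sub>m X) = 0"
        using op_norm_smult[of 0 X] op_norm_nonneg[of "0 \<cdot>\<^sub>m X"] unfolding norm_zero mult_zero_left by linarith
      ultimately show ?thesis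
        by (simp only:)
    qed
    have U1: "op_norm (Us s - U) \<le> op_norm (A - U)"
      unfolding Us_def using s by (intro op_norm_lerp_mat_diff[OF Uc Ac Uc]) (simp_all add: zero[OF Uc])
    have V1: "op_norm (Vs s - V) \<le> op_norm (B - V)"
      unfolding Vs_def using s by (intro op_norm_lerp_mat_diff[OF Vc Bc Vc]) (simp_all add: zero[OF Vc])
    have U2: "op_norm (Us s) \<le> 1"
      unfolding Us_def by (rule op_norm_lerp_mat[OF Uc Ac s op_norm_unitary_le[OF U] op_norm_unitary_le[OF A]])
    have V2: "op_norm (Vs s) \<le> 1"
      unfolding Vs_def by (rule op_norm_lerp_mat[OF Vc Bc s op_norm_unitary_le[OF V] op_norm_unitary_le[OF B]])
    have 1: "op_norm (Us s * Vs s - U * V) \<le> r"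
      using op_norm_mult_diff[OF Uc Vc Usc[of s] Vsc[of s] op_norm_unitary_le[OF U] V2] U1 V1 norm_ge_zero[of "\<omega> - 1"]
      unfolding r_def by linarith
    have "V * U - U * V = (\<omega> - 1) \<cdot>\<^sub>m (U * V)"
      unfolding VU by (intro eq_matI) (simp_all add: algebra_simps)
    then have "op_norm (V * U - U * V) \<le> cmod (\<omega> - 1) * op_norm (U * V)"
      using op_norm_smult[of "\<omega> - 1" "U * V"] by simp
    also have "\<dots> \<le> cmod (\<omega> - 1) * 1"
      by (rule mult_left_mono[OF op_norm_unitary_le[OF UV] norm_ge_zero])
    finally have "op_norm (V * U - U * V) \<le> cmod (\<omega> - 1)"
      by simp
    then have 2: "op_norm (Vs s * Us s - U * V) \<le> r"
      using op_norm_mult_diff[OF Vc Uc Vsc[of s] Usc[of s] op_norm_unitary_le[OF V] U2] U1 V1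
        op_norm_triangle_dist[OF VUc[of s s] VU0c UV0c]
      unfolding r_def by linarith
    have "op_norm (M (s,t) - U * V) \<le> r"
      unfolding M_def fst_conv snd_conv by (rule op_norm_lerp_mat_diff[OF UVc VUc UV0c t 1 2])
    with close show ?thesis
      unfolding r_def by linarith
  qed
  define S where "S = {0..1::real} \<times> {0..1::real}"
  have "continuous_on S (\<lambda>x. det (M x))"
  proof (rule continuous_on_det[OF Mc])
    have U_cont: "continuous_on S (\<lambda>x. Us (fst x) $$ (i,j))" and V_cont: "continuous_on S (\<lambda>x. Vs (fst x) $$ (i,j))"
      if "i < n" "j < n" for i j
      unfolding Us_def Vs_def lerp_mat_index[OF Uc Ac that] lerp_mat_index[OF Vc Bc that]
      by (intro continuous_intros)+
    fix i j assume ij: "i < n" "j < n"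
    have "continuous_on S (\<lambda>x. (Us (fst x) * Vs (fst x)) $$ (i,j))"
      by (rule continuous_on_mat_mult_entry[OF Usc Vsc U_cont V_cont ij])
    moreover have "continuous_on S (\<lambda>x. (Vs (fst x) * Us (fst x)) $$ (i,j))"
      by (rule continuous_on_mat_mult_entry[OF Vsc Usc V_cont U_cont ij])
    ultimately show "continuous_on S (\<lambda>x. M x $$ (i,j))"
      unfolding M_def lerp_mat_index[OF UVc VUc ij] by (intro continuous_intros)
  qed
  moreover have "contractible S"
    unfolding S_def by (intro convex_imp_contractible convex_Times convex_real_interval)
  moreover have "det (M x) \<noteq> 0" if "x \<in> S" for x
    using det_nonzero_near_unitary[OF UV Mc close_M, of "fst x" "snd x"] that by (auto simp: S_def)
  \<comment> \<open>Contractibility of the square gives a continuous logarithm of the nonvanishing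
    determinant. Its increment along the loop at \<open>s\<close> is 2 pi i times the winding
    number.\<close>
  ultimately obtain L where L: "continuous_on S L" "\<And>x. x \<in> S \<Longrightarrow> det (M x) = exp (L x)"
    using continuous_logarithm_on_contractible by blast
  have cont: "continuous_on {0..1} (\<lambda>s. L (f s))"
    if "continuous_on {0..1} f" "f ` {0..1} \<subseteq> S" for f :: "real \<Rightarrow> real \<times> real"
    by (rule continuous_on_compose2[OF L(1) that])
  have ends: "M (s,0) = Us s * Vs s" "M (s,1) = Vs s * Us s" for s
    unfolding M_def fst_conv snd_conv by (rule lerp_mat_ends[OF UVc VUc])+
  have det_ends: "det (M (s,1)) = det (M (s,0))" for s
    unfolding ends det_mult[OF Usc Vsc] det_mult[OF Vsc Usc] by (rule mult.commute)
  \<comment> \<open>The loops are closed, so the increment is always a logarithm of 1 and cannot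
    vary with \<open>s\<close>. At \<open>s = 1\<close> the loop is a constant matrix and the
    increment vanishes.\<close>
  have "L (0,1) - L (0,0) = L (1,1) - L (1,0)"
  proof (rule constant_if_exp_constant[of "\<lambda>s. L (s,1) - L (s,0)" 1])
    show "continuous_on {0..1} (\<lambda>s. L (s,1) - L (s,0))"
      by (intro continuous_on_diff cont continuous_intros) (auto simp: S_def)
    show "exp (L (s,1) - L (s,0)) = 1" if "s \<in> {0..1}" for s
    proof -
      have "exp (L (s,1)) = exp (L (s,0))"
        using L(2)[of "(s,1)"] L(2)[of "(s,0)"] det_ends[of s] that by (simp add: S_def)
      then show ?thesis
        by (simp add: exp_diff)
    qed
  qed
  moreover have "L (1,0) = L (1,1)"
  proof (rule constant_if_exp_constant[of "\<lambda>t. L (1,t)" "det (A * B)"])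
    show "continuous_on {0..1} (\<lambda>t. L (1,t))"
      by (intro cont continuous_intros) (auto simp: S_def)
    have "M (1,t) = A * B" for t
      unfolding M_def fst_conv snd_conv Us_def Vs_def lerp_mat_ends[OF Uc Ac] lerp_mat_ends[OF Vc Bc] AB[symmetric]
      by (rule lerp_mat_same[OF mult_carrier_mat[OF Ac Bc]])
    then show "exp (L (1,t)) = det (A * B)" if "t \<in> {0..1}" for t
      using L(2)[of "(1,t)"] that by (simp add: S_def)
  qed
  ultimately have loop: "L (0,1) = L (0,0)"
    by simp
  \<comment> \<open>At \<open>s = 0\<close> the loop is \<open>p t\<close> times \<open>U V\<close>.
    As \<open>p\<close> stays in the right half-plane, the principal logarithm is continuous along
    it, and the increment of \<open>L\<close> is also \<open>n\<close> times
    \<open>Ln \<omega>\<close>; its vanishing forces \<omega> = 1.\<close>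
  define p where "p t = 1 + complex_of_real t * (\<omega> - 1)" for t
  have p_pos: "Re (p t) > 0" if "t \<in> {0..1}" for t
  proof -
    have "\<bar>Re (complex_of_real t * (\<omega> - 1))\<bar> \<le> cmod (complex_of_real t * (\<omega> - 1))"
      by (rule abs_Re_le_cmod)
    also have "\<dots> \<le> 1 * cmod (\<omega> - 1)"
      unfolding norm_mult norm_of_real using that by (intro mult_right_mono) auto
    also have "\<dots> < 1"
      using close op_norm_nonneg[of "A - U"] op_norm_nonneg[of "B - V"] by linarith
    finally show ?thesis
      unfolding p_def by simp
  qed
  have "L (0,0) - of_nat n * Ln (p 0) = L (0,1) - of_nat n * Ln (p 1)"
  proof (rule constant_if_exp_constant[of "\<lambda>t. L (0,t) - of_nat n * Ln (p t)" "det (U * V)"])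
    have Ln_cont: "continuous_on {0..1} (\<lambda>t. Ln (p t))"
    proof (rule continuous_on_Ln')
      show "continuous_on {0..1} p"
        unfolding p_def by (intro continuous_intros)
      show "p t \<notin> \<real>\<^sub>\<le>\<^sub>0" if "t \<in> {0..1}" for t
        using p_pos[OF that] by (auto simp: complex_nonpos_Reals_iff)
    qed
    have "continuous_on {0..1} (\<lambda>t. L (0,t))"
      by (intro cont continuous_intros) (auto simp: S_def)
    then show "continuous_on {0..1} (\<lambda>t. L (0,t) - of_nat n * Ln (p t))"
      by (intro continuous_on_diff continuous_on_mult continuous_on_const Ln_cont)
    fix t :: real assume t: "t \<in> {0..1}"
    have "M (0,t) = p t \<cdot>\<^sub>m (U * V)"
    proof -
      have "M (0,t) = lerp_mat t (U * V) (\<omega> \<cdot>\<^sub>m (U * V))"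
        unfolding M_def fst_conv snd_conv Us_def Vs_def lerp_mat_ends[OF Uc Ac] lerp_mat_ends[OF Vc Bc] VU ..
      also have "\<dots> = p t \<cdot>\<^sub>m (U * V)"
      proof (rule eq_matI)
        note dims = carrier_matD[OF lerp_mat_carrier[OF smult_carrier_mat[OF UV0c]]] carrier_matD[OF UV0c]
        fix i j assume "i < dim_row (p t \<cdot>\<^sub>m (U * V))" "j < dim_col (p t \<cdot>\<^sub>m (U * V))"
        then have ij: "i < n" "j < n"
          unfolding index_smult_mat dims .
        show "lerp_mat t (U * V) (\<omega> \<cdot>\<^sub>m (U * V)) $$ (i,j) = (p t \<cdot>\<^sub>m (U * V)) $$ (i,j)"
          using ij unfolding lerp_mat_index[OF UV0c smult_carrier_mat[OF UV0c] ij] p_def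
          by (simp only: index_smult_mat(1) dims) (simp add: algebra_simps)
      qed (simp_all only: carrier_matD[OF lerp_mat_carrier[OF smult_carrier_mat[OF UV0c]]] carrier_matD[OF UV0c]
          index_smult_mat(2,3))
      finally show ?thesis .
    qed
    then have "det (M (0,t)) = p t ^ n * det (U * V)"
      by (simp only: det_smult carrier_matD[OF UV0c])
    moreover have p0: "p t \<noteq> 0"
      using p_pos[OF t] by auto
    moreover have "exp (of_nat n * Ln (p t)) = p t ^ n"
      unfolding exp_of_nat_mult exp_Ln[OF p0] ..
    moreover have "det (M (0,t)) = exp (L (0,t))"
      using L(2)[of "(0,t)"] t by (simp add: S_def)
    ultimately show "exp (L (0,t) - of_nat n * Ln (p t)) = det (U * V)"
      by (simp add: exp_diff)
  qed
  with loop have "of_nat n * Ln (p 1) = 0"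
    by (simp add: p_def)
  then have "Ln \<omega> = 0"
    using n by (simp add: p_def)
  moreover have "\<omega> \<noteq> 0"
    using p_pos[of 1] by (auto simp: p_def)
  ultimately show "\<omega> = 1"
    using exp_Ln[of \<omega>] by simp
qed

section \<open>Voiculescu's unitaries\<close>

definition unit_root :: "nat \<Rightarrow> int \<Rightarrow> complex" where
  "unit_root N x = cis (2 * pi * (of_int x / real N))"

lemma unit_root_add: "unit_root N (x + y) = unit_root N x * unit_root N y"
  by (simp add: unit_root_def cis_mult add_divide_distrib distrib_left)

lemma norm_unit_root [simp]: "cmod (unit_root N x) = 1"
  by (simp add: unit_root_def)

lemma unit_root_0 [simp]: "unit_root N 0 = 1"
  by (simp add: unit_root_def)

lemma cnj_unit_root: "cnj (unit_root N x) * unit_root N x = 1"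
  by (simp add: unit_root_def cis_cnj cis_mult)

lemma unit_root_cong:
  assumes "N > 0" "int N dvd x - y"
  shows "unit_root N x = unit_root N y"
proof -
  obtain l where "x - y = int N * l"
    using assms(2) by (auto elim: dvdE)
  then have "unit_root N x = unit_root N (y + int N * l)"
    by (simp add: algebra_simps)
  also have "\<dots> = unit_root N y * unit_root N (int N * l)"
    by (rule unit_root_add)
  also have "unit_root N (int N * l) = 1"
    using assms(1) by (simp add: unit_root_def cis_multiple_2pi)
  finally show ?thesis
    by simp
qed

lemma sum_residue_class:
  assumes N: "N > 0"
  shows "(\<Sum>k<N. if int N dvd int k - x then f k else 0) = f (nat (x mod int N))"
proof -
  have "int N dvd int k - x \<longleftrightarrow> k = nat (x mod int N)" if k: "k < N" for k
  proof -
    have "int N dvd int k - x \<longleftrightarrow> int k mod int N = x mod int N"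
      by (rule mod_eq_dvd_iff[symmetric])
    also have "int k mod int N = int k"
      using k by (simp add: zmod_int[symmetric])
    also have "int k = x mod int N \<longleftrightarrow> k = nat (x mod int N)"
      using N by auto
    finally show ?thesis .
  qed
  then have "(\<Sum>k<N. if int N dvd int k - x then f k else 0) = (\<Sum>k<N. if k = nat (x mod int N) then f k else 0)"
    by (intro sum.cong) auto
  also have "\<dots> = f (nat (x mod int N))"
    using N by (simp add: nat_less_iff)
  finally show ?thesis .
qed

text \<open>Voiculescu's matrices \<open>S^a D^b\<close>, where \<open>S\<close> is the cyclic shift and \<open>D\<close> the diagonal clock matrix.\<close>

definition voiculescu :: "nat \<Rightarrow> int \<times> int \<Rightarrow> complex mat" where
  "voiculescu N g = mat N N (\<lambda>(i,j). if int N dvd int i - (int j + fst g) then unit_root N (snd g * int j) else 0)"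

lemma voiculescu_carrier: "voiculescu N g \<in> carrier_mat N N"
  by (simp add: voiculescu_def)

lemma voiculescu_index:
  "i < N \<Longrightarrow> j < N \<Longrightarrow> voiculescu N (a,b) $$ (i,j)
    = (if int N dvd int i - (int j + a) then unit_root N (b * int j) else 0)"
  by (simp add: voiculescu_def)

text \<open>Moving the clock power \<open>b\<close> past the shift power \<open>c\<close> costs the
  factor \<open>unit_root N (b * c)\<close>: a projective representation.\<close>

lemma voiculescu_mult:
  assumes N: "N > 0"
  shows "voiculescu N (a,b) * voiculescu N (c,e) = unit_root N (b * c) \<cdot>\<^sub>m voiculescu N (a + c, b + e)"
proof (rule eq_matI)
  note dims = carrier_matD[OF voiculescu_carrier]
  fix i j assume "i < dim_row (unit_root N (b * c) \<cdot>\<^sub>m voiculescu N (a + c, b + e))"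
    "j < dim_col (unit_root N (b * c) \<cdot>\<^sub>m voiculescu N (a + c, b + e))"
  then have ij: "i < N" "j < N"
    by (simp_all only: index_smult_mat(2,3) dims)
  \<comment> \<open>The only row in which column \<open>j\<close> of the second factor is
    nonzero.\<close>
  define k where "k = nat ((int j + c) mod int N)"
  have k: "k < N" "int k = (int j + c) mod int N"
    using N by (simp_all add: k_def nat_less_iff)
  have kj: "int N dvd int k - (int j + c)"
    unfolding mod_eq_dvd_iff[symmetric] k(2) by simp
  have "(voiculescu N (a,b) * voiculescu N (c,e)) $$ (i,j)
      = (\<Sum>k<N. voiculescu N (a,b) $$ (i,k) * voiculescu N (c,e) $$ (k,j))"
    using ij by (simp add: dims scalar_prod_def atLeast0LessThan)
  also have "\<dots> = (\<Sum>k<N. if int N dvd int k - (int j + c)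
      then voiculescu N (a,b) $$ (i,k) * unit_root N (e * int j) else 0)"
    using ij by (intro sum.cong refl) (simp add: voiculescu_index)
  also have "\<dots> = voiculescu N (a,b) $$ (i,k) * unit_root N (e * int j)"
    unfolding sum_residue_class[OF N] k_def ..
  also have "voiculescu N (a,b) $$ (i,k) = (if int N dvd int i - (int j + (a + c)) then unit_root N (b * (int j + c)) else 0)"
  proof -
    have "int i - (int k + a) = int i - (int j + (a + c)) - (int k - (int j + c))"
      by simp
    then have "int N dvd int i - (int k + a) \<longleftrightarrow> int N dvd int i - (int j + (a + c))"
      using kj by (metis dvd_diff_left_iff)
    moreover have "unit_root N (b * int k) = unit_root N (b * (int j + c))"
      using N kj by (intro unit_root_cong) (simp_all add: right_diff_distrib[symmetric])
    ultimately show ?thesis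
      using ij k by (simp add: voiculescu_index)
  qed
  also have "\<dots> * unit_root N (e * int j) = unit_root N (b * c) * voiculescu N (a + c, b + e) $$ (i,j)"
    using ij by (simp add: voiculescu_index unit_root_add[symmetric] algebra_simps)
  also have "\<dots> = (unit_root N (b * c) \<cdot>\<^sub>m voiculescu N (a + c, b + e)) $$ (i,j)"
    using ij by (simp add: dims)
  finally show "(voiculescu N (a,b) * voiculescu N (c,e)) $$ (i,j)
      = (unit_root N (b * c) \<cdot>\<^sub>m voiculescu N (a + c, b + e)) $$ (i,j)" .
qed (simp_all only: index_mult_mat(2,3) index_smult_mat(2,3) carrier_matD[OF voiculescu_carrier])

lemma voiculescu_unitary:
  assumes N: "N > 0"
  shows "voiculescu N g \<in> unitaries N"
proof (rule unitariesI[OF voiculescu_carrier])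
  obtain a b where g: "g = (a,b)"
    by (cases g)
  note dims = carrier_matD[OF voiculescu_carrier]
  show "mat_adjoint (voiculescu N g) * voiculescu N g = 1\<^sub>m N"
  proof (rule eq_matI)
    fix i j assume "i < dim_row (1\<^sub>m N :: complex mat)" "j < dim_col (1\<^sub>m N :: complex mat)"
    then have ij: "i < N" "j < N"
      by simp_all
    have "(mat_adjoint (voiculescu N g) * voiculescu N g) $$ (i,j)
        = (\<Sum>k<N. cnj (voiculescu N g $$ (k,i)) * voiculescu N g $$ (k,j))"
      using ij by (simp add: dims scalar_prod_def atLeast0LessThan)
    also have "\<dots> = (\<Sum>k<N. if int N dvd int k - (int j + a)
        then (if i = j then 1 else 0) else 0)"
    proof (intro sum.cong refl)
      fix k assume "k \<in> {..<N}"
      then have k: "k < N"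
        by simp
      have "i = j" if "int N dvd int k - (int j + a)" "int N dvd int k - (int i + a)"
      proof -
        have "int N dvd int i - int j"
          using dvd_diff[OF that] by simp
        then have "int i mod int N = int j mod int N"
          unfolding mod_eq_dvd_iff .
        then show ?thesis
          using ij by (simp add: zmod_int[symmetric])
      qed
      then show "cnj (voiculescu N g $$ (k,i)) * voiculescu N g $$ (k,j)
          = (if int N dvd int k - (int j + a) then (if i = j then 1 else 0) else 0)"
        using ij k by (auto simp: g voiculescu_index cnj_unit_root)
    qed
    also have "\<dots> = 1\<^sub>m N $$ (i,j)"
      unfolding sum_residue_class[OF N] using ij by simp
    finally show "(mat_adjoint (voiculescu N g) * voiculescu N g) $$ (i,j) = 1\<^sub>m N $$ (i,j)" .
  qed (simp_all only: index_mult_mat(2,3) adjoint_dim dims index_one_mat(2,3))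
qed

lemma unit_root_tendsto: "(\<lambda>n. unit_root (Suc n) x) \<longlonglongrightarrow> 1"
proof -
  have "(\<lambda>n. of_int x / real (Suc n)) \<longlonglongrightarrow> 0"
    by (rule LIMSEQ_Suc[OF lim_const_over_n])
  then have "(\<lambda>n. 2 * pi * (of_int x / real (Suc n))) \<longlonglongrightarrow> 2 * pi * 0"
    by (rule tendsto_mult_left)
  then have "(\<lambda>n. exp (\<i> * complex_of_real (2 * pi * (of_int x / real (Suc n))))) \<longlonglongrightarrow> exp (\<i> * complex_of_real (2 * pi * 0))"
    by (rule tendsto_exp[OF tendsto_mult_left[OF tendsto_of_real]])
  then show ?thesis
    unfolding unit_root_def cis_conv_exp by simp
qed

text \<open>The defect is at most the distance of \<open>unit_root (Suc n) (b * c)\<close> from 1,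
  which tends to 0 because \<open>b * c\<close> is fixed while the size grows.\<close>

lemma asymptotic_representation_voiculescu:
  "asymptotic_representation Z2 Suc (\<lambda>n. voiculescu (Suc n))"
  unfolding asymptotic_representation_def
proof (intro conjI allI ballI Pi_I voiculescu_unitary)
  fix g h :: "int \<times> int"
  obtain a b c e where gh: "g = (a,b)" "h = (c,e)"
    by (cases g; cases h)
  let ?D = "\<lambda>n. voiculescu (Suc n) (g \<otimes>\<^bsub>Z2\<^esub> h) - voiculescu (Suc n) g * voiculescu (Suc n) h"
  let ?f = "\<lambda>n. cmod (1 - unit_root (Suc n) (b * c))"
  have "(\<lambda>n. 1 - unit_root (Suc n) (b * c)) \<longlonglongrightarrow> 0"
    using tendsto_diff[OF tendsto_const[of 1] unit_root_tendsto[of "b * c"]] by simp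
  then have lim: "?f \<longlonglongrightarrow> 0"
    by (rule tendsto_norm_zero)
  have le: "op_norm (?D n) \<le> ?f n" for n
  proof -
    let ?K = "voiculescu (Suc n) (a + c, b + e)"
    have "?D n
        = ?K - unit_root (Suc n) (b * c) \<cdot>\<^sub>m ?K"
      unfolding gh voiculescu_mult[OF zero_less_Suc] by simp
    also have "\<dots> = (1 - unit_root (Suc n) (b * c)) \<cdot>\<^sub>m ?K"
      by (intro eq_matI) (simp_all add: algebra_simps)
    finally have "op_norm (?D n)
        \<le> ?f n * op_norm ?K"
      using op_norm_smult[of "1 - unit_root (Suc n) (b * c)" ?K] by simp
    also have "\<dots> \<le> ?f n * 1"
      by (intro mult_left_mono op_norm_unitary_le[OF voiculescu_unitary]) simp_all
    finally show ?thesis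
      by simp
  qed
  show "(\<lambda>n. op_norm (?D n)) \<longlonglongrightarrow> 0"
    by (rule Lim_null_comparison[OF always_eventually lim]) (use le in simp)
qed simp_all

text \<open>Equal dimensions make each \<open>W n\<close> unitary, so the compressions are
  conjugates of commuting unitaries. Close to the Voiculescu pair these are excluded by
  \<open>twisted_pair_far_from_commuting\<close>.\<close>

theorem not_stable_Z2: "\<not> stable_op_norm Z2"
proof
  assume "stable_op_norm Z2"
  then obtain k where k: "approx_by_compressions Z2 Suc (\<lambda>n. voiculescu (Suc n)) k" "\<And>n. k n = Suc n"
    using asymptotic_representation_voiculescu unfolding stable_op_norm_def by blast
  then obtain W \<pi> where W: "\<And>n. W n \<in> isometry_mat (Suc n) (Suc n)"
    and hom: "\<And>n. \<pi> n \<in> hom Z2 (unitary_group (Suc n))"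
    and lim: "\<And>g. g \<in> carrier Z2 \<Longrightarrow>
      (\<lambda>n. op_norm (mat_adjoint (W n) * \<pi> n g * W n - voiculescu (Suc n) g)) \<longlonglongrightarrow> 0"
    unfolding approx_by_compressions_def by auto
  let ?C = "\<lambda>n g. mat_adjoint (W n) * \<pi> n g * W n"
  let ?f = "\<lambda>n. op_norm (?C n (1,0) - voiculescu (Suc n) (1,0)) + op_norm (?C n (0,1) - voiculescu (Suc n) (0,1))
    + cmod (unit_root (Suc n) 1 - 1)"
  have "(\<lambda>n. unit_root (Suc n) 1 - 1) \<longlonglongrightarrow> 0"
    using tendsto_diff[OF unit_root_tendsto[of 1] tendsto_const[of 1]] by simp
  then have "(\<lambda>n. cmod (unit_root (Suc n) 1 - 1)) \<longlonglongrightarrow> 0"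
    by (rule tendsto_norm_zero)
  from tendsto_add[OF tendsto_add[OF lim[of "(1,0)"] lim[of "(0,1)"]] this]
  have "?f \<longlonglongrightarrow> 0"
    by simp
  then have "\<forall>\<^sub>F n in sequentially. ?f n < 1"
    by (rule order_tendstoD) simp
  \<comment> \<open>In size 1 the root of unity equals 1 and no contradiction arises.\<close>
  moreover have "\<forall>\<^sub>F n in sequentially. (1::nat) \<le> n"
    by (rule eventually_ge_at_top)
  ultimately have "\<forall>\<^sub>F n in sequentially. ?f n < 1 \<and> 1 \<le> n"
    by (rule eventually_conj)
  then obtain n where n: "?f n < 1" "1 \<le> n"
    using eventually_happens'[OF sequentially_bot] by blast
  have Wn: "W n \<in> unitaries (Suc n)"
    using W[of n] unfolding isometry_mat_def by (intro unitariesI) auto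
  have \<pi>: "\<pi> n g \<in> unitaries (Suc n)" for g
  proof -
    have "g \<in> carrier Z2"
      by (cases g) simp
    then show ?thesis
      by (rule hom_in_carrier[OF hom])
  qed
  have C: "?C n g \<in> unitaries (Suc n)" for g
    by (intro unitaries_mult unitaries_adjoint Wn \<pi>)
  have "\<pi> n (1,0) * \<pi> n (0,1) = \<pi> n (0,1) * \<pi> n (1,0)"
    using hom_mult[OF hom[of n], of "(1,0)" "(0,1)"] hom_mult[OF hom[of n], of "(0,1)" "(1,0)"] by simp
  then have comm: "?C n (1,0) * ?C n (0,1) = ?C n (0,1) * ?C n (1,0)"
    unfolding unitary_conj_mult[OF Wn unitaries_carrier[OF \<pi>] unitaries_carrier[OF \<pi>]] by (simp only:)
  have "voiculescu (Suc n) (0,1) * voiculescu (Suc n) (1,0)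
      = unit_root (Suc n) 1 \<cdot>\<^sub>m (voiculescu (Suc n) (1,0) * voiculescu (Suc n) (0,1))"
    unfolding voiculescu_mult[OF zero_less_Suc] by (intro eq_matI) simp_all
  from twisted_pair_far_from_commuting[OF voiculescu_unitary voiculescu_unitary zero_less_Suc C C comm this n(1)]
  have "unit_root (Suc n) 1 = 1"
    by simp
  then have "cos (2 * pi * (1 / real (Suc n))) = 1"
    unfolding unit_root_def by (simp add: complex_eq_iff)
  moreover have "cos (2 * pi * (1 / real (Suc n))) < cos 0"
    using n(2) by (intro cos_monotone_0_pi) (simp_all add: field_simps)
  ultimately show False
    by simp
qed

lemma group_Z2: "group Z2"
  by (intro DirProd_group group_integer_group)

theorem corollary2:
  shows "\<not> (\<forall>G :: (int \<times> int) monoid. group G \<and> countable (carrier G) \<longrightarrow>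
             (flexibly_stable_op_norm G \<longleftrightarrow> stable_op_norm G))
         \<and> flexibly_stable_op_norm (integer_group \<times>\<times> integer_group)
         \<and> \<not> stable_op_norm (integer_group \<times>\<times> integer_group)"
proof -
  have "countable (carrier Z2)"
    by simp
  then show ?thesis
    using flexibly_stable_Z2 not_stable_Z2 group_Z2 by blast
qed

end
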